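(* Let $1 \le p \le \infty$ and $n\ge 1$. Let $(k_j)_{j\ge0}$, $(\ell_j)_{j\ge0}$ be special base sequences. Let $\omega$ be a weight function. Then, both for $[\cdot]=\{\cdot\}$ (Roumieu case) and $[\cdot]=(\cdot)$ (Beurling case): (a) $\mathcal{B}^{[\omega]}_{L^p,(k_j)}(\mathbb{R}^n)= \mathcal{B}^{[\omega]}_{L^p}(\mathbb{R}^n)$. (b) $\mathcal{D}^{[\omega]}_{(k_j)}(\mathbb{R}^n)= \mathcal{D}^{[\omega]}(\mathbb{R}^n)$. Assume additionally that $\omega(t)=O(t)$ as $t\to\infty$, in the Roumieu case, and $\omega(t)=o(t)$ as $t\to\infty$, in the Beurling case. Then: (c) $\mathcal{E}^{[\omega]}_{L^p,(k_j)}(U)= \mathcal{E}^{[\omega]}_{L^p}(U)$ for all open $U \subseteq \mathbb{R}^n$. (d) $\mathcal{S}^{[\omega]}_{(k_j),(\ell_j)}(\mathbb{R}^n)= \mathcal{S}^{[\omega]}(\mathbb{R}^n)$.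
   Context: A base sequence is a strictly increasing infinite sequence $0 = k_0 < k_1 < k_2 < \cdots$ of integers; it is called special if $k_{j+1}/k_j$, $j \ge 1$, is bounded. A weight function is a continuous increasing function $\omega : [0,\infty) \to [0,\infty)$ with $\omega(0)=0$, $\omega(2t)=O(\omega(t))$ and $\log t = o(\omega(t))$ as $t \to \infty$, such that $\varphi(t) := \omega(e^t)$ is convex. Put $\varphi^*(s):= \sup_{t\ge 0} (st -\varphi(t))$ for $s \ge 0$, and for $\rho>0$, $k\in\mathbb{N}$ write $W^{\rho}_k:=\exp\big(\tfrac{1}{\rho}\varphi^*(\rho k)\big)$. Function classes: $\mathcal{E}^{\{\omega\}}_{L^p}(U)$ (resp. $\mathcal{E}^{(\omega)}_{L^p}(U)$): all $f\in C^\infty(U)$ such that for every open relatively compact $\Omega\Subset U$ there exist $\rho,C>0$ (resp. for every such $\Omega$ and every $\rho>0$ there is $C>0$) with $\max_{|\alpha|=k}\|\partial^\alpha f\|_{L^p(\Omega)}\le C\,W^\rho_k$ for all $k\ge0$. $\mathcal{B}^{\{\omega\}}_{L^p}(\mathbb{R}^n)$ (resp. $\mathcal{B}^{(\omega)}_{L^p}(\mathbb{R}^n)$): all $f\in C^\infty(\mathbb{R}^n)$ such that there exist $\rho,C>0$ (resp. for every $\rho>0$ there is $C>0$) with $\|\partial^\alpha f\|_{L^p(\mathbb{R}^n)}\le C\,W^\rho_{|\alpha|}$ for all $\alpha\in\mathbb{N}^n$. $\mathcal{D}^{[\omega]}(\mathbb{R}^n):=\mathcal{B}^{[\omega]}_{L^\infty}(\mathbb{R}^n)\cap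 C^\infty_c(\mathbb{R}^n)$. $\mathcal{E}^{[\omega]}_{L^p,(k_j)}(U)$, $\mathcal{B}^{[\omega]}_{L^p,(k_j)}(\mathbb{R}^n)$, $\mathcal{D}^{[\omega]}_{(k_j)}(\mathbb{R}^n)$: the sets of $C^\infty$ functions (with compact support for $\mathcal{D}$) satisfying the respective defining estimates only for multiindices with $|\alpha|\in\{k_j:j\ge0\}$. $\mathcal{S}^{\{\omega\}}(\mathbb{R}^n)$ (resp. $\mathcal{S}^{(\omega)}(\mathbb{R}^n)$): all $f\in C^\infty(\mathbb{R}^n)$ such that for some $\rho>0$ (resp. for all $\rho>0$) $\sup_{\alpha,\beta\in\mathbb{N}^n}\sup_{x\in\mathbb{R}^n}\frac{|x^\alpha\partial^\beta f(x)|}{W^\rho_{|\alpha|}W^\rho_{|\beta|}}<\infty$. $\mathcal{S}^{\{\omega\}}_{(k_j),(\ell_j)}(\mathbb{R}^n)$ (resp. $\mathcal{S}^{(\omega)}_{(k_j),(\ell_j)}(\mathbb{R}^n)$): all $f\in C^\infty(\mathbb{R}^n)$ such that there exist $\rho,C>0$ (resp. for all $\rho>0$ there is $C>0$) such that for all $j\ge0$: $\max_{|\alpha|=k_j}\sup_x|x^\alpha f(x)|\le C\,W^\rho_{k_j}$ and $\max_{|\beta|=\ell_j}\sup_x|\partial^\beta f(x)|\le C\,W^\rho_{\ell_j}$. *)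

theory Defs
  imports "HOL-Analysis.Analysis" "HOL-Probability.Essential_Supremum"
    "HOL-Library.Landau_Symbols"
begin

section \<open>Base sequences\<close>

definition base_seq :: "(nat \<Rightarrow> nat) \<Rightarrow> bool" where
  "base_seq k \<longleftrightarrow> strict_mono k \<and> k 0 = 0"

definition special_base_seq :: "(nat \<Rightarrow> nat) \<Rightarrow> bool" where
  "special_base_seq k \<longleftrightarrow> base_seq k \<and> (\<exists>B. \<forall>j\<ge>1. real (k (Suc j)) / real (k j) \<le> B)"


section \<open>Weight functions\<close>

text \<open>A weight function lives on \<open>[0,\<infinity>)\<close>; its values at negative arguments play no role.
  ``Increasing'' is understood in the wide sense.\<close>

definition weight_function :: "(real \<Rightarrow> real) \<Rightarrow> bool" where
  "weight_function \<omega> \<longleftrightarrow>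
     continuous_on {0..} \<omega> \<and> mono_on {0..} \<omega> \<and> (\<forall>t\<ge>0. 0 \<le> \<omega> t) \<and> \<omega> 0 = 0 \<and>
     (\<lambda>t. \<omega> (2 * t)) \<in> O[at_top](\<omega>) \<and>
     ln \<in> o[at_top](\<omega>) \<and>
     convex_on UNIV (\<lambda>t. \<omega> (exp t))"

definition phi_star :: "(real \<Rightarrow> real) \<Rightarrow> real \<Rightarrow> real" where
  "phi_star \<omega> s = (SUP t\<in>{0..}. s * t - \<omega> (exp t))"

text \<open>The supremum above is a genuine one, because \<open>log t = o(\<omega>(t))\<close>.\<close>

lemma bdd_above_phi_star:
  assumes "weight_function \<omega>" "0 \<le> s"
  shows "bdd_above ((\<lambda>t. s * t - \<omega> (exp t)) ` {0..})"
proof -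
  have nonneg: "0 \<le> \<omega> (exp t)" for t
    using assms(1) by (simp add: weight_function_def)
  have "ln \<in> o[at_top](\<omega>)"
    using assms(1) by (simp add: weight_function_def)
  then have "eventually (\<lambda>t. norm (ln t) \<le> 1 / (s + 1) * norm (\<omega> t)) at_top"
    using assms(2) by (intro landau_o.smallD) auto
  then obtain T where T: "\<And>t. t \<ge> T \<Longrightarrow> \<bar>ln t\<bar> \<le> 1 / (s + 1) * \<bar>\<omega> t\<bar>"
    by (auto simp: eventually_at_top_linorder)
  show ?thesis
  proof (rule bdd_aboveI2)
    fix t :: real assume t: "t \<in> {0..}"
    show "s * t - \<omega> (exp t) \<le> s * \<bar>T\<bar>"
    proof (cases "exp t \<ge> T")
      case True
      from T[OF True] have "(s + 1) * t \<le> \<omega> (exp t)"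
        using assms(2) nonneg[of t] t by (simp add: field_simps)
      then have "s * t - \<omega> (exp t) \<le> 0"
        using t by (simp add: algebra_simps)
      also have "0 \<le> s * \<bar>T\<bar>"
        using assms(2) by simp
      finally show ?thesis .
    next
      case False
      then have "t \<le> \<bar>T\<bar>"
        using exp_ge_add_one_self[of t] by linarith
      then have "s * t \<le> s * \<bar>T\<bar>"
        using assms(2) by (rule mult_left_mono)
      then show ?thesis
        using nonneg[of t] by linarith
    qed
  qed
qed

definition weight_seq :: "(real \<Rightarrow> real) \<Rightarrow> real \<Rightarrow> nat \<Rightarrow> real" where
  "weight_seq \<omega> \<rho> k = exp (1 / \<rho> * phi_star \<omega> (\<rho> * real k))"

datatype growth_case = Roumieu | Beurling

definition for_case :: "growth_case \<Rightarrow> (real \<Rightarrow> bool) \<Rightarrow> bool" where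
  "for_case c P = (case c of Roumieu \<Rightarrow> (\<exists>\<rho>>0. P \<rho>) | Beurling \<Rightarrow> (\<forall>\<rho>>0. P \<rho>))"

definition at_most_linear :: "growth_case \<Rightarrow> (real \<Rightarrow> real) \<Rightarrow> bool" where
  "at_most_linear c \<omega> =
     (case c of Roumieu \<Rightarrow> \<omega> \<in> O[at_top](\<lambda>t. t) | Beurling \<Rightarrow> \<omega> \<in> o[at_top](\<lambda>t. t))"


section \<open>Smooth functions and partial derivatives\<close>

definition partial :: "'n::finite \<Rightarrow> (real^'n \<Rightarrow> complex) \<Rightarrow> real^'n \<Rightarrow> complex" where
  "partial i f x = frechet_derivative f (at x) (axis i 1)"

text \<open>Only used for open sets. A function is \<open>C\<^sup>k\<^sup>+\<^sup>1\<close> iff it is differentiable and all its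
  first order partial derivatives are \<open>C\<^sup>k\<close>.\<close>

primrec Ck_on :: "nat \<Rightarrow> (real^'n::finite) set \<Rightarrow> (real^'n \<Rightarrow> complex) \<Rightarrow> bool" where
  "Ck_on 0 U f \<longleftrightarrow> continuous_on U f"
| "Ck_on (Suc k) U f \<longleftrightarrow> (\<forall>x\<in>U. f differentiable (at x)) \<and> (\<forall>i. Ck_on k U (partial i f))"

definition smooth_on :: "(real^'n::finite) set \<Rightarrow> (real^'n \<Rightarrow> complex) \<Rightarrow> bool" where
  "smooth_on U f \<longleftrightarrow> (\<forall>k. Ck_on k U f)"

type_synonym 'n multiindex = "'n \<Rightarrow> nat"

definition mi_abs :: "'n::finite multiindex \<Rightarrow> nat" where
  "mi_abs \<alpha> = (\<Sum>i\<in>UNIV. \<alpha> i)"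

definition monomial :: "'n::finite multiindex \<Rightarrow> real^'n \<Rightarrow> real" where
  "monomial \<alpha> x = (\<Prod>i\<in>UNIV. (x $ i) ^ \<alpha> i)"

text \<open>The index type carries no order, so the coordinates are enumerated in some fixed order.
  On an open set where the function is smooth, partial derivatives commute, and the
  choice of the order is irrelevant there.\<close>

definition mi_deriv :: "'n::finite multiindex \<Rightarrow> (real^'n \<Rightarrow> complex) \<Rightarrow> real^'n \<Rightarrow> complex" where
  "mi_deriv \<alpha> f =
     foldr (\<lambda>i. partial i ^^ \<alpha> i) (SOME is. distinct is \<and> set is = (UNIV :: 'n set)) f"


section \<open>Function classes\<close>

text \<open>Infinite integrals are handled separately, since the real power is not available
  on \<^typ>\<open>ennreal\<close>.\<close>

definition Lp_norm :: "ennreal \<Rightarrow> (real^'n::finite) set \<Rightarrow> (real^'n \<Rightarrow> complex) \<Rightarrow> ennreal" where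
  "Lp_norm p \<Omega> f =
     (let M = restrict_space lborel \<Omega> in
      if p = \<infinity> then esssup M (\<lambda>x. ennreal (norm (f x)))
      else let r = enn2real p; I = (\<integral>\<^sup>+x. ennreal (norm (f x) powr r) \<partial>M)
           in if I = \<infinity> then \<infinity> else ennreal (enn2real I powr (1 / r)))"

text \<open>In the following classes the set \<open>K\<close> contains the orders \<open>|\<alpha>|\<close> of those derivatives
  that are subject to the defining estimates: \<open>K = UNIV\<close> gives the full classes, while
  \<open>K = range k\<close> gives the classes associated with the base sequence \<open>k\<close>.
  A function on \<open>U\<close> is represented by a total function, and only its values on \<open>U\<close> matter.\<close>

definition E_class ::
  "growth_case \<Rightarrow> ennreal \<Rightarrow> (real \<Rightarrow> real) \<Rightarrow> nat set \<Rightarrow> (real^'n::finite) set \<Rightarrow>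
   (real^'n \<Rightarrow> complex) set" where
  "E_class c p \<omega> K U = {f. smooth_on U f \<and>
     (\<forall>\<Omega>. open \<Omega> \<and> compact (closure \<Omega>) \<and> closure \<Omega> \<subseteq> U \<longrightarrow>
        for_case c (\<lambda>\<rho>. \<exists>C>0. \<forall>\<alpha>. mi_abs \<alpha> \<in> K \<longrightarrow>
          Lp_norm p \<Omega> (mi_deriv \<alpha> f) \<le> ennreal (C * weight_seq \<omega> \<rho> (mi_abs \<alpha>))))}"

definition B_class ::
  "growth_case \<Rightarrow> ennreal \<Rightarrow> (real \<Rightarrow> real) \<Rightarrow> nat set \<Rightarrow> (real^'n::finite \<Rightarrow> complex) set" where
  "B_class c p \<omega> K = {f. smooth_on UNIV f \<and>
     for_case c (\<lambda>\<rho>. \<exists>C>0. \<forall>\<alpha>. mi_abs \<alpha> \<in> K \<longrightarrow>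
       Lp_norm p UNIV (mi_deriv \<alpha> f) \<le> ennreal (C * weight_seq \<omega> \<rho> (mi_abs \<alpha>)))}"

definition D_class ::
  "growth_case \<Rightarrow> (real \<Rightarrow> real) \<Rightarrow> nat set \<Rightarrow> (real^'n::finite \<Rightarrow> complex) set" where
  "D_class c \<omega> K = B_class c \<infinity> \<omega> K \<inter> {f. smooth_on UNIV f \<and> compact (closure {x. f x \<noteq> 0})}"

definition S_class ::
  "growth_case \<Rightarrow> (real \<Rightarrow> real) \<Rightarrow> (real^'n::finite \<Rightarrow> complex) set" where
  "S_class c \<omega> = {f. smooth_on UNIV f \<and>
     for_case c (\<lambda>\<rho>. bdd_above (range (\<lambda>(\<alpha>, \<beta>, x).
       norm (of_real (monomial \<alpha> x) * mi_deriv \<beta> f x) /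
         (weight_seq \<omega> \<rho> (mi_abs \<alpha>) * weight_seq \<omega> \<rho> (mi_abs \<beta>)))))}"

definition S_class_sub ::
  "growth_case \<Rightarrow> (real \<Rightarrow> real) \<Rightarrow> (nat \<Rightarrow> nat) \<Rightarrow> (nat \<Rightarrow> nat) \<Rightarrow>
   (real^'n::finite \<Rightarrow> complex) set" where
  "S_class_sub c \<omega> k l = {f. smooth_on UNIV f \<and>
     for_case c (\<lambda>\<rho>. \<exists>C>0. \<forall>j.
       (\<forall>\<alpha> x. mi_abs \<alpha> = k j \<longrightarrow>
          norm (of_real (monomial \<alpha> x) * f x) \<le> C * weight_seq \<omega> \<rho> (k j)) \<and>
       (\<forall>\<beta> x. mi_abs \<beta> = l j \<longrightarrow>
          norm (mi_deriv \<beta> f x) \<le> C * weight_seq \<omega> \<rho> (l j)))}"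

end

theory Submission
  imports Defs "HOL-Computational_Algebra.Polynomial"
begin

text \<open>
  Derivatives of intermediate order are controlled by those of lower and higher order, as in the
  inequalities of Landau--Kolmogorov and Cartan--Gorny. The point is that the constants grow only
  geometrically in the order, and that weight functions absorb geometric factors.

  \<^emph>\<open>Interpolation.\<close> A polynomial \<open>P\<close> of degree less than \<open>m\<close> is determined by its values at
  \<open>0, \<dots>, m - 1\<close>; in Lagrange's formula the numbers that express \<open>P\<close>'s \<open>c\<close>-th derivative at \<open>0\<close> through
  these values have an absolute sum of at most \<open>e\<^sup>4\<^sup>m\<close> (\<open>sum_abs_diff_weight_le\<close>). Taylor's formula
  turns this into an estimate for functions: with step size \<open>\<eta>\<close>,
  \<open>\<parallel>u\<^sup>(\<^sup>c\<^sup>)\<parallel> \<le> e\<^sup>7\<^sup>m \<eta>\<^sup>-\<^sup>c (\<parallel>u\<parallel> + \<eta>\<^sup>m \<parallel>u\<^sup>(\<^sup>m\<^sup>)\<parallel>)\<close>. It uses only translations by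
  multiples of \<open>\<eta>\<close> and averages over a segment of length \<open>m \<eta>\<close>, hence holds for every \<open>L\<^sup>p\<close> norm,
  provided that the norm on the right is taken over a set containing these translates
  (\<open>interpolates_Lp_norm\<close>, \<open>interpolates_sup_norm\<close>). Treating one coordinate after the other
  extends it to mixed partial derivatives, and for \<open>\<eta> = (M\<^sub>0 / M\<^sub>1)\<^bsup>1/m\<^esup>\<close> one obtains
  \<open>\<parallel>\<partial>\<^sup>\<beta>f\<parallel> \<le> 2 e\<^bsup>8nm\<^esup> M\<^sub>0\<^bsup>1-\<theta>\<^esup> M\<^sub>1\<^bsup>\<theta>\<^esup>\<close> whenever \<open>M\<^sub>0\<close> and \<open>M\<^sub>1\<close> bound the derivatives of the
  orders \<open>a \<le> |\<beta>| \<le> b\<close>, \<open>m = b - a\<close>, and \<open>|\<beta>| = (1 - \<theta>) a + \<theta> b\<close> (\<open>interpolate_mi_deriv\<close>).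

  \<^emph>\<open>Weights.\<close> In a special base sequence every \<open>s \<ge> 1\<close> lies between two members \<open>a \<le> s \<le> b\<close> with
  \<open>b \<le> B s\<close>. As \<open>\<phi>\<^sup>*(s) / s\<close> is increasing, interpolating the weights at \<open>a\<close> and \<open>b\<close> yields at most
  the weight at \<open>s\<close>, with \<open>\<rho>\<close> replaced by \<open>B \<rho>\<close> (\<open>weight_seq_interpolate\<close>). Because of
  \<open>\<omega>(2t) = O(\<omega>(t))\<close>, the factor \<open>e\<^bsup>8nm\<^esup>\<close>, where \<open>m \<le> b \<le> B s\<close>, costs another constant
  factor in \<open>\<rho>\<close> (\<open>weight_seq_absorb_geometric\<close>). That \<open>\<rho>\<close> changes only by a constant factor is what both
  the Roumieu and the Beurling case require. On the whole space \<open>\<eta>\<close> can be chosen freely, which gives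
  the global classes.

  \<^emph>\<open>Local classes.\<close> Here \<open>m \<eta>\<close> has to stay below the distance \<open>\<delta>\<close> that is available between the given set
  and the boundary of \<open>U\<close>. The optimal \<open>\<eta>\<close> satisfies this as soon as \<open>M\<^sub>1 \<ge> M\<^sub>0 (m/\<delta>)\<^sup>m\<close>, and growth of
  \<open>\<omega>\<close> that is at most linear makes the weights large enough for this, up to a geometric factor
  (\<open>weight_seq_gap\<close>). In the Roumieu case that factor may depend on \<open>\<rho>\<close>; in the Beurling case,
  \<open>\<omega>(t) = o(t)\<close> removes it.

  \<^emph>\<open>Rapid decrease.\<close> For a point \<open>x\<close> let \<open>X = |x\<^sub>i|\<close> be its largest coordinate in absolute value. The
  half-space that is bounded by the hyperplane \<open>y\<^sub>i = x\<^sub>i\<close> and does not meet \<open>|y\<^sub>i| < X\<close> is mapped into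
  itself by translations of any length in suitably signed coordinate directions, and on it \<open>f\<close> is
  bounded by a constant times \<open>W\<^sub>2\<^sub>r / X\<^sup>2\<^sup>r\<close>, where \<open>r = |\<alpha>|\<close>. Interpolating halfway between this bound and
  the bound for the derivatives of order \<open>2|\<beta>|\<close> produces the product estimate for
  \<open>x\<^sup>\<alpha> \<partial>\<^sup>\<beta>f(x)\<close> (\<open>decay_times_derivative\<close>).
\<close>

section \<open>Recovering derivatives from equidistant samples\<close>

definition lagrange_basis :: "nat \<Rightarrow> nat \<Rightarrow> real poly" where
  "lagrange_basis m i =
     smult (1 / (\<Prod>l\<in>{..<m} - {i}. real i - real l)) (\<Prod>l\<in>{..<m} - {i}. [:- real l, 1:])"

lemma poly_lagrange_basis:
  assumes "i < m" "l < m"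
  shows "poly (lagrange_basis m i) (real l) = (if l = i then 1 else 0)"
  using assms by (auto simp: lagrange_basis_def poly_prod)

lemma degree_lagrange_basis:
  assumes "i < m" shows "degree (lagrange_basis m i) < m"
proof -
  have "degree (\<Prod>l\<in>{..<m} - {i}. [:- real l, 1:]) \<le> (\<Sum>l\<in>{..<m} - {i}. 1)"
    by (rule order.trans[OF degree_prod_sum_le]) auto
  also have "\<dots> < m" using assms by simp
  finally show ?thesis
    by (auto simp: lagrange_basis_def)
qed

text \<open>Both sides are polynomials of degree less than \<open>m\<close> which agree at the \<open>m\<close> nodes.\<close>

lemma lagrange_interpolation_power:
  assumes "j < m"
  shows "(\<Sum>i<m. smult (real i ^ j) (lagrange_basis m i)) = monom 1 j"
proof -
  let ?P = "(\<Sum>i<m. smult (real i ^ j) (lagrange_basis m i))"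
  have root: "poly (?P - monom 1 j) x = 0" if x: "x \<in> real ` {..<m}" for x
  proof -
    from x obtain l where l: "l < m" "x = real l" by auto
    have "poly ?P x = (\<Sum>i<m. if l = i then real i ^ j else 0)"
      unfolding poly_sum by (rule sum.cong) (use l in \<open>auto simp: poly_lagrange_basis\<close>)
    then show ?thesis using l by (simp add: poly_monom)
  qed
  have "degree ?P \<le> m - 1"
  proof (rule degree_sum_le)
    fix i assume "i \<in> {..<m}"
    then have "degree (lagrange_basis m i) \<le> m - 1" using degree_lagrange_basis[of i m] by simp
    then show "degree (smult (real i ^ j) (lagrange_basis m i)) \<le> m - 1"
      by (rule order.trans[OF degree_smult_le])
  qed simp
  then have deg: "degree (?P - monom 1 j) < m"
    using assms degree_monom_le[of "1::real" j]
    by (intro le_less_trans[OF degree_diff_le_max]) auto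
  show ?thesis
  proof (rule ccontr)
    assume "?P \<noteq> monom 1 j"
    then have nz: "?P - monom 1 j \<noteq> 0" by simp
    have "m = card (real ` {..<m})" by (simp add: card_image)
    also have "\<dots> \<le> card {x. poly (?P - monom 1 j) x = 0}"
      using root by (intro card_mono poly_roots_finite[OF nz]) blast
    also have "\<dots> \<le> degree (?P - monom 1 j)"
      by (rule card_poly_roots_bound[OF nz])
    finally show False using deg by simp
  qed
qed

text \<open>Since all roots are nonnegative, the coefficients alternate in sign, so that the right-hand side
  is the sum of the absolute values of all terms at the point \<open>R\<close>; a single term is estimated by
  the sum. Choosing \<open>R\<close> proportional to the degree is what keeps the sampling weights geometric:
  the power of \<open>R\<close> on the left then pays for the factorial that differentiation introduces.\<close>

lemma abs_coeff_prod_le: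
  fixes r :: "'a \<Rightarrow> real"
  assumes "finite S" "0 \<le> R" "\<And>l. l \<in> S \<Longrightarrow> 0 \<le> r l"
  shows "\<bar>coeff (\<Prod>l\<in>S. [:- r l, 1:]) b\<bar> * R ^ b \<le> (\<Prod>l\<in>S. R + r l)"
  using assms(1,3)
proof (induction S arbitrary: b rule: finite_induct)
  case empty
  then show ?case by (cases b) auto
next
  case (insert s S)
  let ?q = "\<Prod>l\<in>S. [:- r l, 1:]" and ?Q = "\<Prod>l\<in>S. R + r l"
  have s: "0 \<le> r s" using insert by simp
  have IH: "\<bar>coeff ?q b\<bar> * R ^ b \<le> ?Q" for b using insert by simp
  have Q: "0 \<le> ?Q" using insert assms(2) by (intro prod_nonneg) simp
  have "\<bar>coeff ([:- r s, 1:] * ?q) b\<bar> * R ^ b \<le> r s * ?Q + R * ?Q"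
  proof (cases b)
    case 0
    have "\<bar>coeff ([:- r s, 1:] * ?q) b\<bar> * R ^ b = r s * (\<bar>coeff ?q 0\<bar> * R ^ 0)"
      using s 0 by (simp add: abs_mult)
    also have "\<dots> \<le> r s * ?Q" by (rule mult_left_mono[OF IH s])
    also have "\<dots> \<le> r s * ?Q + R * ?Q" using assms(2) Q by simp
    finally show ?thesis .
  next
    case (Suc c)
    have "\<bar>coeff ([:- r s, 1:] * ?q) b\<bar> * R ^ b
        \<le> (r s * \<bar>coeff ?q b\<bar> + \<bar>coeff ?q c\<bar>) * R ^ b"
      using s Suc assms(2) abs_triangle_ineq4[of "coeff ?q c" "r s * coeff ?q b"]
      by (intro mult_right_mono) (auto simp: abs_mult)
    also have "\<dots> = r s * (\<bar>coeff ?q b\<bar> * R ^ b) + R * (\<bar>coeff ?q c\<bar> * R ^ c)"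
      using Suc by (simp add: algebra_simps)
    also have "\<dots> \<le> r s * ?Q + R * ?Q"
      by (intro add_mono mult_left_mono IH s assms(2))
    finally show ?thesis .
  qed
  then show ?case
    using insert.hyps by (simp add: algebra_simps)
qed

lemma abs_prod_nodes_diff:
  assumes "i < m"
  shows "\<bar>\<Prod>l\<in>{..<m} - {i}. real i - real l\<bar> = fact i * fact (m - 1 - i)"
proof -
  have split: "{..<m} - {i} = {..<i} \<union> {Suc i..<m}" using assms by auto
  have "\<bar>\<Prod>l\<in>{..<m} - {i}. real i - real l\<bar>
      = (\<Prod>l<i. \<bar>real i - real l\<bar>) * (\<Prod>l=Suc i..<m. \<bar>real i - real l\<bar>)"
    unfolding abs_prod split by (rule prod.union_disjoint) auto
  also have "(\<Prod>l<i. \<bar>real i - real l\<bar>) = (\<Prod>l<i. real (Suc l))"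
    by (subst prod.nat_diff_reindex[symmetric], rule prod.cong) auto
  also have "\<dots> = fact i" by (simp add: fact_prod_Suc lessThan_atLeast0 del: of_nat_Suc)
  also have "(\<Prod>l=Suc i..<m. \<bar>real i - real l\<bar>) = (\<Prod>l<m - 1 - i. real (Suc l))"
    by (rule prod.reindex_bij_witness[of _ "\<lambda>l. l + Suc i" "\<lambda>l. l - Suc i"]) (auto simp: of_nat_diff)
  also have "\<dots> = fact (m - 1 - i)" by (simp add: fact_prod_Suc lessThan_atLeast0 del: of_nat_Suc)
  finally show ?thesis .
qed

lemma power_div_fact_le_exp:
  assumes "0 \<le> (x::real)" shows "x ^ k / fact k \<le> exp x"
proof -
  have s: "summable (\<lambda>n. x ^ n /\<^sub>R fact n)" by (rule summable_exp_generic)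
  have "(\<Sum>n\<in>{k}. x ^ n /\<^sub>R fact n) \<le> (\<Sum>n. x ^ n /\<^sub>R fact n)"
    by (rule sum_le_suminf[OF s]) (use assms in auto)
  then show ?thesis by (simp add: exp_def divide_inverse mult.commute)
qed

text \<open>The coefficients of the functional \<open>P \<mapsto> P\<^sup>(\<^sup>b\<^sup>)(0)\<close> with respect to evaluation at the
  nodes \<open>0, \<dots>, m - 1\<close>, for polynomials of degree less than \<open>m\<close>.\<close>

definition diff_weight :: "nat \<Rightarrow> nat \<Rightarrow> nat \<Rightarrow> real" where
  "diff_weight m b i = fact b * coeff (lagrange_basis m i) b"

lemma sum_diff_weight_power:
  assumes "j < m"
  shows "(\<Sum>i<m. diff_weight m b i * real i ^ j) = (if j = b then fact b else 0)"
proof -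
  have "(\<Sum>i<m. diff_weight m b i * real i ^ j)
      = fact b * coeff (\<Sum>i<m. smult (real i ^ j) (lagrange_basis m i)) b"
    by (simp add: diff_weight_def coeff_sum sum_distrib_left mult_ac)
  also have "\<dots> = (if j = b then fact b else 0)"
    by (simp add: lagrange_interpolation_power[OF assms])
  finally show ?thesis .
qed

lemma fact_le_power_of_ge: "b \<le> m \<Longrightarrow> (fact b :: real) \<le> real m ^ b"
  by (rule order.trans[OF fact_le_power[of b]]) (auto intro: power_mono)

text \<open>The denominators in Lagrange's formula combine to binomial coefficients. The numerators are at most
  \<open>(2m)\<^bsup>m-1\<^esup>\<close> by the previous coefficient estimate with \<open>R = m\<close>, and the sum is a single term of the
  exponential series at \<open>4m\<close>.\<close>

lemma sum_abs_diff_weight_le: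
  assumes "b < m"
  shows "(\<Sum>i<m. \<bar>diff_weight m b i\<bar>) \<le> exp (4 * real m)"
proof -
  obtain q where q: "m = Suc q" using assms by (cases m) auto
  have m: "0 < real m" using assms by simp
  have each: "\<bar>diff_weight m b i\<bar> \<le> (2 * real m) ^ q / fact q * real (q choose i)" if i: "i < m" for i
  proof -
    let ?c = "coeff (\<Prod>l\<in>{..<m} - {i}. [:- real l, 1:]) b"
    have "fact b * \<bar>?c\<bar> \<le> \<bar>?c\<bar> * real m ^ b"
      using mult_left_mono[OF fact_le_power_of_ge[of b m], of "\<bar>?c\<bar>"] assms
      by (simp add: mult_ac)
    also have "\<dots> \<le> (\<Prod>l\<in>{..<m} - {i}. real m + real l)"
      by (rule abs_coeff_prod_le) auto
    also have "\<dots> \<le> (\<Prod>l\<in>{..<m} - {i}. 2 * real m)"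
      by (rule prod_mono) auto
    also have "\<dots> = (2 * real m) ^ q"
      using i q by simp
    finally have *: "fact b * \<bar>?c\<bar> \<le> (2 * real m) ^ q" .
    have "\<bar>diff_weight m b i\<bar> = fact b * \<bar>?c\<bar> / (fact i * fact (q - i))"
      using abs_prod_nodes_diff[OF i] q
      by (simp add: diff_weight_def lagrange_basis_def abs_mult)
    also have "\<dots> \<le> (2 * real m) ^ q / (fact i * fact (q - i))"
      by (rule divide_right_mono[OF *]) simp
    also have "\<dots> = (2 * real m) ^ q / fact q * real (q choose i)"
      using i q by (simp add: binomial_fact)
    finally show ?thesis .
  qed
  have "(\<Sum>i<m. \<bar>diff_weight m b i\<bar>) \<le> (\<Sum>i<m. (2 * real m) ^ q / fact q * real (q choose i))"
    using each by (intro sum_mono) simp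
  also have "\<dots> = (2 * real m) ^ q / fact q * real (\<Sum>i\<le>q. q choose i)"
    by (simp only: q lessThan_Suc_atMost sum_distrib_left of_nat_sum)
  also have "\<dots> = (4 * real m) ^ q / fact q"
  proof -
    have "(4 * real m) ^ q = (2 * real m) ^ q * 2 ^ q"
      by (subst power_mult_distrib[symmetric]) simp
    then show ?thesis unfolding choose_row_sum of_nat_power of_nat_numeral by (simp only: times_divide_eq_left)
  qed
  also have "\<dots> \<le> exp (4 * real m)"
    using m by (intro power_div_fact_le_exp) simp
  finally show ?thesis .
qed

lemma power_Suc_div_fact_le_exp:
  assumes "1 \<le> m"
  shows "real m ^ m / fact (m - 1) \<le> exp (2 * real m)"
proof -
  have "real m ^ m / fact (m - 1) = real m * (real m ^ m / fact m)"
  proof -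
    have "fact m = real m * fact (m - 1)" using assms by (simp add: fact_reduce)
    then show ?thesis using assms by simp
  qed
  also have "\<dots> \<le> exp (real m) * exp (real m)"
    using exp_ge_add_one_self[of "real m"]
    by (intro mult_mono power_div_fact_le_exp) (linarith | simp)+
  finally show ?thesis by (simp flip: exp_add)
qed

text \<open>Expand each sample \<open>u (i \<eta>)\<close> at \<open>0\<close> by Taylor's formula. The sampling weights annihilate all
  Taylor monomials of degree less than \<open>m\<close> except the one of degree \<open>b\<close>. The remainder is kept in
  its integral form, because only an average of the top derivative over a segment, and not its
  supremum, can be controlled by an \<open>L\<^sup>p\<close> norm.\<close>

lemma derivative_from_samples:
  fixes u :: "nat \<Rightarrow> real \<Rightarrow> complex"
  assumes b: "b < m" and \<eta>: "0 < \<eta>"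
    and deriv: "\<And>j t. j < m \<Longrightarrow> 0 \<le> t \<Longrightarrow> t \<le> m * \<eta> \<Longrightarrow>
      (u j has_vector_derivative u (Suc j) t) (at t within {0..m * \<eta>})"
    and cont: "continuous_on {0..m * \<eta>} (u m)"
  shows "\<eta> ^ b * norm (u b 0) \<le>
    (\<Sum>i<m. \<bar>diff_weight m b i\<bar> * norm (u 0 (i * \<eta>))) +
    exp (4 * real m) * ((m * \<eta>) ^ (m - 1) / fact (m - 1)) * integral {0..m * \<eta>} (\<lambda>t. norm (u m t))"
proof -
  define R where "R i = u 0 (i * \<eta>) - (\<Sum>j<m. ((i * \<eta>) ^ j / fact j) *\<^sub>R u j 0)" for i :: nat
  define J where "J = (m * \<eta>) ^ (m - 1) / fact (m - 1) * integral {0..m * \<eta>} (\<lambda>t. norm (u m t))"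
  have R: "norm (R i) \<le> J" if i: "i < m" for i
  proof -
    let ?h = "\<lambda>t. ((i * \<eta> - t) ^ (m - 1) / fact (m - 1)) *\<^sub>R u m t"
    have sub: "{0..i * \<eta>} \<subseteq> {0..m * \<eta>}" using i \<eta> by auto
    have int: "(?h has_integral R i) {0..i * \<eta>}"
    proof -
      have "(?h has_integral u 0 (i * \<eta>) - (\<Sum>j<m. ((i * \<eta> - 0) ^ j / fact j) *\<^sub>R u j 0)) {0..i * \<eta>}"
      proof (rule Taylor_has_integral)
        fix j t assume "j < m" "0 \<le> t" "t \<le> i * \<eta>"
        then show "(u j has_vector_derivative u (Suc j) t) (at t within {0..i * \<eta>})"
          using sub by (intro has_vector_derivative_within_subset[OF deriv sub]) auto
      qed (use i \<eta> in auto)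
      then show ?thesis by (simp add: R_def)
    qed
    have ci: "continuous_on {0..i * \<eta>} (u m)" by (rule continuous_on_subset[OF cont sub])
    have "norm (R i) = norm (integral {0..i * \<eta>} ?h)"
      using int by (simp add: integral_unique)
    also have "\<dots> \<le> integral {0..i * \<eta>} (\<lambda>t. (m * \<eta>) ^ (m - 1) / fact (m - 1) * norm (u m t))"
    proof (rule integral_norm_bound_integral)
      fix t assume t: "t \<in> {0..i * \<eta>}"
      have "i * \<eta> \<le> m * \<eta>" using i \<eta> by simp
      then have "(i * \<eta> - t) ^ (m - 1) \<le> (m * \<eta>) ^ (m - 1)"
        using t by (intro power_mono) auto
      then show "norm (?h t) \<le> (m * \<eta>) ^ (m - 1) / fact (m - 1) * norm (u m t)"
        using t by (auto simp: abs_mult intro!: mult_right_mono divide_right_mono)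
    qed (use int ci in \<open>auto intro!: integrable_continuous_real continuous_intros simp: has_integral_iff\<close>)
    also have "\<dots> = (m * \<eta>) ^ (m - 1) / fact (m - 1) * integral {0..i * \<eta>} (\<lambda>t. norm (u m t))"
      by simp
    also have "\<dots> \<le> J"
      unfolding J_def using sub cont ci \<eta>
      by (intro mult_left_mono integral_subset_le)
        (auto intro!: integrable_continuous_real continuous_intros)
    finally show ?thesis .
  qed
  have J0: "0 \<le> J"
    unfolding J_def using \<eta> cont
    by (intro mult_nonneg_nonneg integral_nonneg integrable_continuous_real continuous_intros) auto
  have "(\<Sum>i<m. diff_weight m b i *\<^sub>R (u 0 (i * \<eta>) - R i))
      = (\<Sum>i<m. \<Sum>j<m. (diff_weight m b i * real i ^ j * (\<eta> ^ j / fact j)) *\<^sub>R u j 0)"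
    by (simp add: R_def scaleR_sum_right power_mult_distrib mult_ac)
  also have "\<dots> = (\<Sum>j<m. ((\<Sum>i<m. diff_weight m b i * real i ^ j) * (\<eta> ^ j / fact j)) *\<^sub>R u j 0)"
    by (subst sum.swap) (simp only: scaleR_sum_left sum_distrib_right)
  also have "\<dots> = (\<Sum>j<m. if j = b then \<eta> ^ b *\<^sub>R u b 0 else 0)"
    by (rule sum.cong) (auto simp: sum_diff_weight_power)
  also have "\<dots> = \<eta> ^ b *\<^sub>R u b 0" using b by simp
  finally have "\<eta> ^ b * norm (u b 0) = norm (\<Sum>i<m. diff_weight m b i *\<^sub>R (u 0 (i * \<eta>) - R i))"
    using \<eta> by simp
  also have "\<dots> \<le> (\<Sum>i<m. \<bar>diff_weight m b i\<bar> * norm (u 0 (i * \<eta>)) + \<bar>diff_weight m b i\<bar> * J)"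
  proof (rule sum_norm_le)
    fix i assume "i \<in> {..<m}"
    then have "norm (u 0 (i * \<eta>) - R i) \<le> norm (u 0 (i * \<eta>)) + J"
      using R[of i] norm_triangle_ineq4[of "u 0 (i * \<eta>)" "R i"] by simp
    then show "norm (diff_weight m b i *\<^sub>R (u 0 (i * \<eta>) - R i))
        \<le> \<bar>diff_weight m b i\<bar> * norm (u 0 (i * \<eta>)) + \<bar>diff_weight m b i\<bar> * J"
      by (simp add: mult_left_mono flip: distrib_left)
  qed
  also have "\<dots> = (\<Sum>i<m. \<bar>diff_weight m b i\<bar> * norm (u 0 (i * \<eta>))) + (\<Sum>i<m. \<bar>diff_weight m b i\<bar>) * J"
    by (simp add: sum.distrib sum_distrib_right)
  also have "\<dots> \<le> (\<Sum>i<m. \<bar>diff_weight m b i\<bar> * norm (u 0 (i * \<eta>))) + exp (4 * real m) * J"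
    using J0 by (intro add_left_mono mult_right_mono sum_abs_diff_weight_le[OF b])
  finally show ?thesis by (simp add: J_def mult_ac)
qed

section \<open>Interpolating mixed partial derivatives of intermediate order\<close>

lemma smooth_on_partial: "smooth_on U f \<Longrightarrow> smooth_on U (partial i f)"
  unfolding smooth_on_def by (meson Ck_on.simps(2))

lemma smooth_on_partial_power: "smooth_on U f \<Longrightarrow> smooth_on U ((partial i ^^ m) f)"
  by (induction m) (simp_all add: smooth_on_partial)

lemma smooth_on_foldr_partial:
  "smooth_on U f \<Longrightarrow> smooth_on U (foldr (\<lambda>i. partial i ^^ \<alpha> i) xs f)"
  by (induction xs) (simp_all add: smooth_on_partial_power)

lemma smooth_on_mi_deriv: "smooth_on U f \<Longrightarrow> smooth_on U (mi_deriv \<alpha> f)"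
  unfolding mi_deriv_def by (rule smooth_on_foldr_partial)

text \<open>The argument for mixed derivatives is the same for all norms. The relation \<open>bd r F M\<close> stands for
  ``the norm of \<open>F\<close> on the \<open>r\<close>-th set of a decreasing chain is at most \<open>M\<close>''. Differentiating in one
  direction costs one step in the chain, since the samples are taken in a neighbourhood of size
  \<open>\<delta>\<close>. On the whole space all sets of the chain are equal. The number \<open>7\<close> is \<open>4\<close> for the
  sampling weights, plus \<open>2\<close> for the remainder in Taylor's formula, plus \<open>1\<close> to absorb the factor
  \<open>2\<close> lost when two summands are separated in an \<open>L\<^sup>p\<close> norm.\<close>

definition interpolates ::
  "(real^'n::finite) set \<Rightarrow> real \<Rightarrow> (nat \<Rightarrow> (real^'n \<Rightarrow> complex) \<Rightarrow> real \<Rightarrow> bool) \<Rightarrow> bool" where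
  "interpolates U \<delta> bd \<longleftrightarrow>
     (\<forall>r G M M'. smooth_on U G \<longrightarrow> bd r G M \<longrightarrow> M \<le> M' \<longrightarrow>
        bd r G M' \<and> bd (Suc r) G M') \<and>
     (\<forall>r G i c m \<eta> M0 M1. smooth_on U G \<longrightarrow> 1 \<le> m \<longrightarrow> c \<le> m \<longrightarrow> 0 < \<eta> \<longrightarrow> m * \<eta> \<le> \<delta> \<longrightarrow>
        0 \<le> M0 \<longrightarrow> 0 \<le> M1 \<longrightarrow> bd r G M0 \<longrightarrow> bd r ((partial i ^^ m) G) M1 \<longrightarrow>
        bd (Suc r) ((partial i ^^ c) G) (exp (7 * real m) / \<eta> ^ c * (M0 + \<eta> ^ m * M1)))"

lemma interpolates_mono:
  "\<lbrakk>interpolates U \<delta> bd; smooth_on U G; bd r G M; M \<le> M'\<rbrakk>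
   \<Longrightarrow> bd r G M' \<and> bd (Suc r) G M'"
  unfolding interpolates_def by blast

lemma interpolates_partial:
  "\<lbrakk>interpolates U \<delta> bd; smooth_on U G; 1 \<le> m; c \<le> m; 0 < \<eta>; m * \<eta> \<le> \<delta>; 0 \<le> M0; 0 \<le> M1;
    bd r G M0; bd r ((partial i ^^ m) G) M1\<rbrakk>
   \<Longrightarrow> bd (Suc r) ((partial i ^^ c) G) (exp (7 * real m) / \<eta> ^ c * (M0 + \<eta> ^ m * M1))"
  unfolding interpolates_def by blast

lemma interpolates_level:
  assumes "interpolates U \<delta> bd" "smooth_on U G" "bd 0 G M"
  shows "bd r G M"
  by (induction r) (use assms interpolates_mono[OF assms(1,2)] in auto)

lemma foldr_partial_fun_upd:
  "i \<notin> set ys \<Longrightarrow>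
   foldr (\<lambda>j. partial j ^^ (\<alpha>(i := c)) j) ys f = foldr (\<lambda>j. partial j ^^ \<alpha> j) ys f"
  by (rule foldr_cong) auto

lemma sum_list_fun_upd:
  "i \<notin> set ys \<Longrightarrow> (\<Sum>j\<leftarrow>ys. (\<alpha>(i := c)) j) = (\<Sum>j\<leftarrow>ys. \<alpha> j :: nat)"
  by (induction ys) auto

text \<open>The derivatives are taken in a fixed order of the coordinates, and the claim is proved by induction
  on that list. If the inner derivatives already reach order \<open>a\<close>, they are controlled by the
  induction hypothesis, and the outermost coordinate is interpolated between them and order \<open>b\<close>.
  Otherwise a part of the outermost derivative fills up order \<open>a\<close>, and the rest is interpolated
  between \<open>a\<close> and \<open>b\<close>. In both cases only derivatives in the fixed order occur, which
  is why the hypotheses can be confined to these.\<close>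

lemma interpolate_iterated_partials:
  fixes xs :: "'n::finite list" and f :: "real^'n \<Rightarrow> complex" and \<alpha> :: "'n \<Rightarrow> nat"
  assumes interp: "interpolates U \<delta> bd" and f: "smooth_on U f"
    and ab: "a < b" and \<eta>: "0 < \<eta>" "real (b - a) * \<eta> \<le> \<delta>" and M: "0 \<le> M0" "0 \<le> M1"
    and "distinct xs"
    and "\<And>\<alpha>. (\<Sum>i\<leftarrow>xs. \<alpha> i) = a \<Longrightarrow> bd 0 (foldr (\<lambda>i. partial i ^^ \<alpha> i) xs f) M0"
    and "\<And>\<alpha>. (\<Sum>i\<leftarrow>xs. \<alpha> i) = b \<Longrightarrow> bd 0 (foldr (\<lambda>i. partial i ^^ \<alpha> i) xs f) M1"
    and "a \<le> (\<Sum>i\<leftarrow>xs. \<alpha> i)" "(\<Sum>i\<leftarrow>xs. \<alpha> i) \<le> b"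
  shows "bd (length xs) (foldr (\<lambda>i. partial i ^^ \<alpha> i) xs f)
    (exp (8 * real (length xs) * real (b - a)) / \<eta> ^ ((\<Sum>i\<leftarrow>xs. \<alpha> i) - a) * (M0 + \<eta> ^ (b - a) * M1))"
  using assms(8-12)
proof (induction xs arbitrary: \<alpha>)
  case Nil
  then have a: "a = 0" by simp
  have "bd 0 f M0" using Nil.prems(2)[of \<alpha>] a by simp
  moreover have "M0 \<le> M0 + \<eta> ^ b * M1" using \<eta> M by simp
  ultimately show ?case using a
    interpolates_mono[OF interp f] by simp
next
  case (Cons i ys)
  define m where "m = b - a"
  define D where "D \<alpha> = foldr (\<lambda>i. partial i ^^ \<alpha> i) ys f" for \<alpha> :: "'n \<Rightarrow> nat"
  define E where "E = M0 + \<eta> ^ m * M1"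
  define s where "s = (\<Sum>j\<leftarrow>ys. \<alpha> j)"
  define c where "c = \<alpha> i"
  define n where "n = length ys"
  have m: "1 \<le> m" using ab by (simp add: m_def)
  have E: "0 \<le> E" using M \<eta> by (simp add: E_def)
  have i: "i \<notin> set ys" "distinct ys" using Cons.prems(1) by auto
  have sm: "smooth_on U (D \<beta>)" for \<beta> unfolding D_def by (rule smooth_on_foldr_partial[OF f])
  \<comment> \<open>The hypotheses of order \<open>a\<close> and \<open>b\<close> for \<open>i # ys\<close>, with the exponent of \<open>i\<close> chosen freely.\<close>
  have top: "bd r ((partial i ^^ k) (D \<beta>)) M1" if k: "k + (\<Sum>j\<leftarrow>ys. \<beta> j) = b" for r k \<beta>
  proof (rule interpolates_level[OF interp smooth_on_partial_power[OF sm]])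
    have "bd 0 (foldr (\<lambda>j. partial j ^^ (\<beta>(i := k)) j) (i # ys) f) M1"
      using k sum_list_fun_upd[OF i(1), of \<beta> k] by (intro Cons.prems(3)) simp
    then show "bd 0 ((partial i ^^ k) (D \<beta>)) M1"
      using foldr_partial_fun_upd[OF i(1), of \<beta> k f] by (simp add: D_def)
  qed
  have bot: "bd r ((partial i ^^ k) (D \<beta>)) M0" if k: "k + (\<Sum>j\<leftarrow>ys. \<beta> j) = a" for r k \<beta>
  proof (rule interpolates_level[OF interp smooth_on_partial_power[OF sm]])
    have "bd 0 (foldr (\<lambda>j. partial j ^^ (\<beta>(i := k)) j) (i # ys) f) M0"
      using k sum_list_fun_upd[OF i(1), of \<beta> k] by (intro Cons.prems(2)) simp
    then show "bd 0 ((partial i ^^ k) (D \<beta>)) M0"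
      using foldr_partial_fun_upd[OF i(1), of \<beta> k f] by (simp add: D_def)
  qed
  have cs: "a \<le> c + s" "c + s \<le> b" using Cons.prems(4,5) by (simp_all add: c_def s_def)
  have "bd (Suc n) ((partial i ^^ c) (D \<alpha>)) (exp (8 * real (Suc n) * m) / \<eta> ^ (c + s - a) * E)"
  proof (cases "a \<le> s")
    case True
    define X where "X = exp (8 * real n * m) / \<eta> ^ (s - a) * E"
    have X: "0 \<le> X" using E \<eta> by (simp add: X_def)
    have IH: "bd n (D \<alpha>) X"
      unfolding D_def X_def n_def E_def m_def s_def
    proof (rule Cons.IH[OF i(2)])
      show "bd 0 (foldr (\<lambda>i. partial i ^^ \<alpha> i) ys f) M0" if "(\<Sum>i\<leftarrow>ys. \<alpha> i) = a" for \<alpha>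
        using bot[of 0 \<alpha>] that by (simp add: D_def)
      show "bd 0 (foldr (\<lambda>i. partial i ^^ \<alpha> i) ys f) M1" if "(\<Sum>i\<leftarrow>ys. \<alpha> i) = b" for \<alpha>
        using top[of 0 \<alpha>] that by (simp add: D_def)
    qed (use True cs in \<open>auto simp: s_def\<close>)
    show ?thesis
    proof (cases "s = b")
      case True
      then have "c = 0" using cs by simp
      moreover have "X \<le> exp (8 * real (Suc n) * m) / \<eta> ^ (c + s - a) * E"
        using \<open>c = 0\<close> \<eta> E unfolding X_def
        by (auto simp: algebra_simps intro!: mult_left_mono mult_right_mono divide_right_mono)
      ultimately show ?thesis
        using interpolates_mono[OF interp sm IH] by simp
    next
      case False
      define k where "k = b - s"
      have k: "1 \<le> k" "c \<le> k" "k \<le> m" "m = k + (s - a)"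
        using False cs True by (auto simp: k_def m_def)
      have "bd (Suc n) ((partial i ^^ c) (D \<alpha>)) (exp (7 * real k) / \<eta> ^ c * (X + \<eta> ^ k * M1))"
      proof (rule interpolates_partial[OF interp sm k(1,2) \<eta>(1) _ X M(2) IH top])
        have "real k * \<eta> \<le> real m * \<eta>" using k \<eta> by simp
        also have "\<dots> \<le> \<delta>" using \<eta> unfolding m_def by blast
        finally show "real k * \<eta> \<le> \<delta>" .
      qed (use False cs in \<open>simp add: k_def s_def\<close>)
      moreover have "exp (7 * real k) / \<eta> ^ c * (X + \<eta> ^ k * M1)
          \<le> exp (8 * real (Suc n) * m) / \<eta> ^ (c + s - a) * E"
      proof -
        \<comment> \<open>The new term is dominated by the bound \<open>X\<close> from the induction hypothesis, so that one step costs
          a factor \<open>2\<close>, which is absorbed in \<open>exp m\<close>.\<close>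
        have "\<eta> ^ k * M1 = \<eta> ^ m * M1 / \<eta> ^ (s - a)"
          using \<eta> k(4) by (simp add: power_add)
        also have "\<dots> \<le> E / \<eta> ^ (s - a)"
          using \<eta> M by (intro divide_right_mono) (auto simp: E_def)
        also have "\<dots> \<le> X"
          using E \<eta> mult_right_mono[of 1 "exp (8 * real n * m)" "E / \<eta> ^ (s - a)"]
          by (simp add: X_def)
        finally have "X + \<eta> ^ k * M1 \<le> 2 * X" by simp
        then have "exp (7 * real k) / \<eta> ^ c * (X + \<eta> ^ k * M1) \<le> exp (7 * real m) / \<eta> ^ c * (2 * X)"
          using k \<eta> X M by (intro mult_mono divide_right_mono) auto
        also have "\<dots> \<le> exp (7 * real m) / \<eta> ^ c * (exp (real m) * X)"
        proof -
          have "2 \<le> exp (real m)" using exp_ge_add_one_self[of "real m"] m by linarith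
          then show ?thesis using \<eta> X by (intro mult_left_mono mult_right_mono) auto
        qed
        also have "\<dots> = exp (8 * real (Suc n) * m) / \<eta> ^ (c + (s - a)) * E"
          by (simp add: X_def power_add field_simps flip: exp_add)
        also have "c + (s - a) = c + s - a" using True by simp
        finally show ?thesis .
      qed
      ultimately show ?thesis
        using interpolates_mono[OF interp smooth_on_partial_power[OF sm]] by blast
    qed
  next
    case False
    have "bd (Suc n) ((partial i ^^ (c + s - a)) ((partial i ^^ (a - s)) (D \<alpha>)))
      (exp (7 * real m) / \<eta> ^ (c + s - a) * E)"
      unfolding E_def
    proof (rule interpolates_partial[OF interp smooth_on_partial_power[OF sm] m _ \<eta>(1) _ M])
      show "bd n ((partial i ^^ m) ((partial i ^^ (a - s)) (D \<alpha>))) M1"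
      proof -
        have "m + (a - s) + s = b" using False ab by (simp add: m_def)
        then show ?thesis using top[of "m + (a - s)" \<alpha> n] by (simp only: funpow_add comp_apply s_def)
      qed
    qed (use \<eta> cs False bot in \<open>auto simp: m_def s_def\<close>)
    moreover have "(c + s - a) + (a - s) = c" using False cs by simp
    ultimately have "bd (Suc n) ((partial i ^^ c) (D \<alpha>)) (exp (7 * real m) / \<eta> ^ (c + s - a) * E)"
      by (metis comp_apply funpow_add)
    moreover have "exp (7 * real m) / \<eta> ^ (c + s - a) * E
        \<le> exp (8 * real (Suc n) * m) / \<eta> ^ (c + s - a) * E"
      using \<eta> E m by (intro mult_right_mono divide_right_mono) (auto simp: algebra_simps)
    ultimately show ?thesis
      using interpolates_mono[OF interp smooth_on_partial_power[OF sm]] by blast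
  qed
  then show ?case
    by (simp add: D_def c_def s_def E_def m_def n_def)
qed

lemma mi_deriv_as_foldr:
  obtains xs :: "'n::finite list" where "distinct xs" "set xs = UNIV" "length xs = CARD('n)"
    "\<And>\<alpha> f. mi_deriv \<alpha> f = foldr (\<lambda>i. partial i ^^ \<alpha> i) xs f"
    "\<And>\<alpha>. mi_abs \<alpha> = (\<Sum>i\<leftarrow>xs. \<alpha> i)"
proof -
  let ?P = "\<lambda>is. distinct is \<and> set is = (UNIV :: 'n set)"
  define xs where "xs = (SOME is. ?P is)"
  have xs: "?P xs"
    unfolding xs_def by (rule someI_ex) (use finite_distinct_list[of "UNIV :: 'n set"] in auto)
  show ?thesis
  proof (rule that[of xs])
    show "length xs = CARD('n)" using xs distinct_card by force
    show "mi_abs \<alpha> = (\<Sum>i\<leftarrow>xs. \<alpha> i)" for \<alpha>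
      using xs by (simp add: mi_abs_def sum_list_distinct_conv_sum_set)
  qed (use xs in \<open>auto simp: mi_deriv_def xs_def\<close>)
qed

text \<open>With the step size \<open>\<eta> = (M\<^sub>0 / M\<^sub>1)\<^bsup>1/m\<^esup>\<close> the two summands of the interpolation estimate are equal.
  The assumption on \<open>\<delta>\<close> says precisely that this step size is admissible.\<close>

lemma interpolate_mi_deriv:
  fixes f :: "real^'n::finite \<Rightarrow> complex"
  assumes interp: "interpolates U \<delta> bd" and f: "smooth_on U f"
    and ab: "a < b" and M: "0 < M0" "0 < M1"
    and gap: "M0 * (real (b - a) / \<delta>) ^ (b - a) \<le> M1" and "0 < \<delta>"
    and lower: "\<And>\<alpha>. mi_abs \<alpha> = a \<Longrightarrow> bd 0 (mi_deriv \<alpha> f) M0"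
    and upper: "\<And>\<alpha>. mi_abs \<alpha> = b \<Longrightarrow> bd 0 (mi_deriv \<alpha> f) M1"
    and \<beta>: "a \<le> mi_abs \<beta>" "mi_abs \<beta> \<le> b"
    and \<theta>: "\<theta> = real (mi_abs \<beta> - a) / real (b - a)"
  shows "bd CARD('n) (mi_deriv \<beta> f)
    (2 * exp (8 * real CARD('n) * real (b - a)) * (M0 powr (1 - \<theta>) * M1 powr \<theta>))"
proof -
  define m where "m = b - a"
  define s where "s = mi_abs \<beta> - a"
  define \<eta> where "\<eta> = (M0 / M1) powr (1 / real m)"
  have m: "0 < m" using ab by (simp add: m_def)
  have \<eta>: "0 < \<eta>" using M by (simp add: \<eta>_def)
  have pw: "\<eta> ^ j = (M0 / M1) powr (real j / real m)" for j
    using \<eta> M m by (simp add: \<eta>_def powr_powr flip: powr_realpow)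
  have \<eta>m: "\<eta> ^ m = M0 / M1" using pw[of m] m M by simp
  have "(real m * \<eta>) ^ m \<le> \<delta> ^ m"
    using gap M \<open>0 < \<delta>\<close> by (simp add: power_mult_distrib \<eta>m power_divide field_simps flip: m_def)
  then have step: "real m * \<eta> \<le> \<delta>"
    using \<open>0 < \<delta>\<close> m \<eta> by (meson less_imp_le power_mono_iff mult_nonneg_nonneg of_nat_0_le_iff)
  obtain xs :: "'n list" where xs: "distinct xs" "set xs = UNIV" "length xs = CARD('n)"
    "\<And>\<alpha> f. mi_deriv \<alpha> f = foldr (\<lambda>i. partial i ^^ \<alpha> i) xs f"
    "\<And>\<alpha>. mi_abs \<alpha> = (\<Sum>i\<leftarrow>xs. \<alpha> i)"
    by (rule mi_deriv_as_foldr) blast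
  have "bd CARD('n) (mi_deriv \<beta> f)
      (exp (8 * real CARD('n) * m) / \<eta> ^ s * (M0 + \<eta> ^ m * M1))"
    unfolding xs(4) s_def m_def xs(3)[symmetric] xs(5)
    by (rule interpolate_iterated_partials[OF interp f ab \<eta> _ _ _ xs(1)])
      (use step M lower upper \<beta> in \<open>auto simp: xs(4,5) m_def\<close>)
  also have "exp (8 * real CARD('n) * m) / \<eta> ^ s * (M0 + \<eta> ^ m * M1)
      = 2 * exp (8 * real CARD('n) * m) * (M0 powr (1 - \<theta>) * M1 powr \<theta>)"
  proof -
    have "\<eta> ^ s = M0 powr \<theta> / M1 powr \<theta>"
      using M by (simp add: pw \<theta> powr_divide s_def m_def)
    moreover have "M0 powr (1 - \<theta>) = M0 / M0 powr \<theta>"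
      using M by (simp add: powr_diff)
    ultimately show ?thesis
      using M by (simp add: \<eta>m)
  qed
  finally show ?thesis by (simp add: m_def)
qed

section \<open>The interpolation estimate for suprema\<close>

lemma Ck_on_imp_continuous_on: "Ck_on k U f \<Longrightarrow> continuous_on U f"
  by (cases k) (auto intro!: continuous_at_imp_continuous_on differentiable_imp_continuous_within)

lemma smooth_on_continuous_on: "smooth_on U f \<Longrightarrow> continuous_on U f"
  unfolding smooth_on_def using Ck_on_imp_continuous_on by blast

lemma smooth_on_differentiable: "smooth_on U f \<Longrightarrow> x \<in> U \<Longrightarrow> f differentiable (at x)"
  unfolding smooth_on_def by (meson Ck_on.simps(2))

lemma has_vector_derivative_along_axis:
  fixes G :: "real^'n::finite \<Rightarrow> complex"
  assumes "G differentiable (at (x + t *\<^sub>R (\<sigma> *\<^sub>R axis i 1)))"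
  shows "((\<lambda>t. G (x + t *\<^sub>R (\<sigma> *\<^sub>R axis i 1))) has_vector_derivative
    \<sigma> *\<^sub>R partial i G (x + t *\<^sub>R (\<sigma> *\<^sub>R axis i 1))) (at t within S)"
proof -
  let ?v = "\<sigma> *\<^sub>R axis i 1 :: real^'n"
  let ?D = "frechet_derivative G (at (x + t *\<^sub>R ?v))"
  have D: "(G has_derivative ?D) (at (x + t *\<^sub>R ?v))"
    using assms frechet_derivative_works by blast
  have "((\<lambda>t. x + t *\<^sub>R ?v) has_derivative (\<lambda>h. h *\<^sub>R ?v)) (at t within S)"
    by (auto intro!: derivative_eq_intros)
  from has_derivative_compose[OF this D]
  have "((\<lambda>t. G (x + t *\<^sub>R ?v)) has_derivative (\<lambda>h. ?D (h *\<^sub>R ?v))) (at t within S)" .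
  also have "(\<lambda>h. ?D (h *\<^sub>R ?v)) = (\<lambda>h. h *\<^sub>R (\<sigma> *\<^sub>R partial i G (x + t *\<^sub>R ?v)))"
    using has_derivative_linear[OF D] by (simp add: linear_scale partial_def)
  finally show ?thesis unfolding has_vector_derivative_def .
qed

text \<open>The one-dimensional estimate along a coordinate line. The sign \<open>\<sigma>\<close> permits samples on either
  side of \<open>x\<close>, as is needed when \<open>x\<close> lies at the boundary of a half-space.\<close>

lemma partial_power_estimate:
  fixes G :: "real^'n::finite \<Rightarrow> complex"
  defines "v \<equiv> \<lambda>i \<sigma>. \<sigma> *\<^sub>R axis i 1 :: real^'n"
  assumes G: "smooth_on U G" and \<sigma>: "\<bar>\<sigma>\<bar> = 1" and c: "c < m" and \<eta>: "0 < \<eta>"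
    and U: "\<And>t. 0 \<le> t \<Longrightarrow> t \<le> m * \<eta> \<Longrightarrow> x + t *\<^sub>R v i \<sigma> \<in> U"
  shows "\<eta> ^ c * norm ((partial i ^^ c) G x) \<le>
    (\<Sum>j<m. \<bar>diff_weight m c j\<bar> * norm (G (x + (j * \<eta>) *\<^sub>R v i \<sigma>))) +
    exp (4 * real m) * ((m * \<eta>) ^ (m - 1) / fact (m - 1)) *
      integral {0..m * \<eta>} (\<lambda>t. norm ((partial i ^^ m) G (x + t *\<^sub>R v i \<sigma>)))"
proof -
  define u where "u j t = \<sigma> ^ j *\<^sub>R (partial i ^^ j) G (x + t *\<^sub>R v i \<sigma>)" for j t
  have norm_u: "norm (u j t) = norm ((partial i ^^ j) G (x + t *\<^sub>R v i \<sigma>))" for j t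
    using \<sigma> by (simp add: u_def power_abs)
  have "\<eta> ^ c * norm (u c 0) \<le>
    (\<Sum>j<m. \<bar>diff_weight m c j\<bar> * norm (u 0 (j * \<eta>))) +
    exp (4 * real m) * ((m * \<eta>) ^ (m - 1) / fact (m - 1)) * integral {0..m * \<eta>} (\<lambda>t. norm (u m t))"
  proof (rule derivative_from_samples[OF c \<eta>])
    fix j :: nat and t :: real assume t: "0 \<le> t" "t \<le> m * \<eta>"
    have "(partial i ^^ j) G differentiable (at (x + t *\<^sub>R v i \<sigma>))"
      using U[OF t] by (intro smooth_on_differentiable[OF smooth_on_partial_power[OF G]])
    from has_vector_derivative_along_axis[OF this[unfolded v_def], of "{0..m * \<eta>}"]
    have "((\<lambda>t. \<sigma> ^ j *\<^sub>R (partial i ^^ j) G (x + t *\<^sub>R v i \<sigma>)) has_vector_derivative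
        \<sigma> ^ j *\<^sub>R \<sigma> *\<^sub>R partial i ((partial i ^^ j) G) (x + t *\<^sub>R v i \<sigma>)) (at t within {0..m * \<eta>})"
      unfolding v_def by (rule bounded_linear.has_vector_derivative[OF bounded_linear_scaleR_right])
    then show "(u j has_vector_derivative u (Suc j) t) (at t within {0..m * \<eta>})"
      by (simp add: u_def[abs_def] mult.commute)
  next
    have "continuous_on {0..m * \<eta>} (\<lambda>t. (partial i ^^ m) G (x + t *\<^sub>R v i \<sigma>))"
      by (rule continuous_on_compose2[OF smooth_on_continuous_on[OF smooth_on_partial_power[OF G]]])
        (auto intro!: continuous_intros U)
    then show "continuous_on {0..m * \<eta>} (u m)"
      unfolding u_def[abs_def] by (intro continuous_intros)
  qed
  then show ?thesis by (simp add: norm_u)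
qed

lemma taylor_remainder_constant_le:
  assumes "1 \<le> m" "0 \<le> \<eta>"
  shows "(m * \<eta>) ^ (m - 1) / fact (m - 1) * (m * \<eta>) \<le> exp (2 * real m) * \<eta> ^ m"
proof -
  have "(m * \<eta>) ^ (m - 1) / fact (m - 1) * (m * \<eta>) = (m * \<eta>) ^ m / fact (m - 1)"
    using assms(1) power_minus_mult[of m "m * \<eta>"] by simp
  also have "\<dots> = real m ^ m / fact (m - 1) * \<eta> ^ m"
    by (simp add: power_mult_distrib)
  also have "\<dots> \<le> exp (2 * real m) * \<eta> ^ m"
    using assms by (intro mult_right_mono power_Suc_div_fact_le_exp) auto
  finally show ?thesis .
qed

lemma top_order_le:
  assumes "0 < (\<eta>::real)" "0 \<le> M0" "0 \<le> M1"
  shows "M1 \<le> exp (7 * real m) / \<eta> ^ m * (M0 + \<eta> ^ m * M1)"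
proof -
  have "M1 = 1 * (\<eta> ^ m * M1 / \<eta> ^ m)" using assms by simp
  also have "\<dots> \<le> exp (7 * real m) * ((M0 + \<eta> ^ m * M1) / \<eta> ^ m)"
    using assms by (intro mult_mono divide_right_mono) auto
  finally show ?thesis by simp
qed

lemma interpolates_sup_norm:
  fixes Q :: "nat \<Rightarrow> (real^'n::finite) set" and \<sigma> :: "'n \<Rightarrow> real"
  assumes Q: "\<And>r. Q r \<subseteq> U" "\<And>i. \<bar>\<sigma> i\<bar> = 1"
    and shift: "\<And>r x i t. x \<in> Q (Suc r) \<Longrightarrow> 0 \<le> t \<Longrightarrow> t \<le> \<delta> \<Longrightarrow> x + t *\<^sub>R (\<sigma> i *\<^sub>R axis i 1) \<in> Q r"
    and "0 < \<delta>"
  shows "interpolates U \<delta> (\<lambda>r F M. \<forall>x\<in>Q r. norm (F x) \<le> M)"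
  unfolding interpolates_def
proof (intro conjI allI impI ballI)
  have sub: "Q (Suc r) \<subseteq> Q r" for r using shift[of _ r 0] \<open>0 < \<delta>\<close> by auto
  fix r x and G :: "real^'n \<Rightarrow> complex" and M M' :: real
  assume *: "\<forall>x\<in>Q r. norm (G x) \<le> M" "M \<le> M'"
  show "norm (G x) \<le> M'" if "x \<in> Q r" using * that by force
  show "norm (G x) \<le> M'" if "x \<in> Q (Suc r)" using * that sub[of r] by force
next
  fix r c m :: nat and G :: "real^'n \<Rightarrow> complex" and i x and \<eta> M0 M1 :: real
  assume G: "smooth_on U G" and m: "1 \<le> m" "c \<le> m" and \<eta>: "0 < \<eta>" "m * \<eta> \<le> \<delta>"
    and M: "0 \<le> M0" "0 \<le> M1"
    and M0: "\<forall>x\<in>Q r. norm (G x) \<le> M0" and M1: "\<forall>x\<in>Q r. norm ((partial i ^^ m) G x) \<le> M1"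
    and x: "x \<in> Q (Suc r)"
  have xt: "x + t *\<^sub>R (\<sigma> i *\<^sub>R axis i 1) \<in> Q r" if "0 \<le> t" "t \<le> m * \<eta>" for t
    using shift[OF x that(1)] that \<eta> by simp
  show "norm ((partial i ^^ c) G x) \<le> exp (7 * real m) / \<eta> ^ c * (M0 + \<eta> ^ m * M1)"
  proof (cases "c = m")
    case True
    have "norm ((partial i ^^ c) G x) \<le> M1" using True M1 xt[of 0] \<eta> by simp
    also have "\<dots> \<le> exp (7 * real m) / \<eta> ^ c * (M0 + \<eta> ^ m * M1)"
      unfolding True by (rule top_order_le[OF \<eta>(1) M])
    finally show ?thesis .
  next
    case False
    define T where "T = (m * \<eta>) ^ (m - 1) / fact (m - 1)"
    let ?y = "\<lambda>t. x + t *\<^sub>R (\<sigma> i *\<^sub>R axis i 1)"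
    have c: "c < m" using False m by simp
    have T: "0 \<le> T" using \<eta> by (simp add: T_def)
    have cont: "continuous_on {0..m * \<eta>} (\<lambda>t. (partial i ^^ m) G (?y t))"
      using xt Q(1)[of r]
      by (intro continuous_on_compose2[OF smooth_on_continuous_on[OF smooth_on_partial_power[OF G]]])
        (auto intro!: continuous_intros)
    have int: "integral {0..m * \<eta>} (\<lambda>t. norm ((partial i ^^ m) G (?y t))) \<le> m * \<eta> * M1"
    proof -
      have "integral {0..m * \<eta>} (\<lambda>t. norm ((partial i ^^ m) G (?y t))) \<le> integral {0..m * \<eta>} (\<lambda>t. M1)"
        using M1 xt by (intro integral_le integrable_continuous_real continuous_intros cont) auto
      then show ?thesis using \<eta> by simp
    qed
    have samples: "norm (G (?y (j * \<eta>))) \<le> M0" if "j < m" for j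
      using that \<eta> M0 xt[of "j * \<eta>"] by simp
    have "\<eta> ^ c * norm ((partial i ^^ c) G x) \<le>
        (\<Sum>j<m. \<bar>diff_weight m c j\<bar> * norm (G (?y (j * \<eta>)))) +
        exp (4 * real m) * T * integral {0..m * \<eta>} (\<lambda>t. norm ((partial i ^^ m) G (?y t)))"
      unfolding T_def using xt Q(1) by (intro partial_power_estimate[OF G Q(2) c \<eta>(1)]) blast
    also have "\<dots> \<le> (\<Sum>j<m. \<bar>diff_weight m c j\<bar> * M0) + exp (4 * real m) * T * (m * \<eta> * M1)"
      using samples int T by (intro add_mono sum_mono mult_left_mono) auto
    also have "(\<Sum>j<m. \<bar>diff_weight m c j\<bar> * M0) \<le> exp (4 * real m) * M0"
      unfolding sum_distrib_right[symmetric] using M by (intro mult_right_mono sum_abs_diff_weight_le[OF c])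
    also have "exp (4 * real m) * T * (m * \<eta> * M1) = exp (4 * real m) * (T * (m * \<eta>) * M1)"
      by (simp add: mult_ac)
    also have "\<dots> \<le> exp (4 * real m) * (exp (2 * real m) * \<eta> ^ m * M1)"
      unfolding T_def using M \<eta> m
      by (intro mult_left_mono mult_right_mono taylor_remainder_constant_le) auto
    finally have "\<eta> ^ c * norm ((partial i ^^ c) G x)
        \<le> exp (4 * real m) * (M0 + exp (2 * real m) * (\<eta> ^ m * M1))"
      by (simp add: algebra_simps)
    also have "\<dots> \<le> exp (4 * real m) * (exp (3 * real m) * M0 + exp (3 * real m) * (\<eta> ^ m * M1))"
      using M \<eta> mult_right_mono[of 1 "exp (3 * real m)" M0]
      by (intro mult_left_mono add_mono mult_right_mono) auto
    also have "\<dots> = exp (7 * real m) * (M0 + \<eta> ^ m * M1)"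
      by (simp add: algebra_simps flip: exp_add)
    finally show ?thesis using \<eta> by (simp add: field_simps)
  qed
qed

section \<open>The interpolation estimate for integral norms\<close>

text \<open>Both forms of Jensen's inequality below, for sums and for integrals, follow by averaging this
  tangent inequality. The value \<open>y = 0\<close> is treated separately since \<open>0 powr r = 0\<close>.\<close>

lemma powr_above_tangent:
  fixes a y r :: real
  assumes "1 \<le> r" "0 < a" "0 \<le> y"
  shows "a powr r + r * a powr (r - 1) * (y - a) \<le> y powr r"
proof (cases "y = 0")
  case True
  have "a powr (r - 1) * a = a powr r" using assms by (simp add: powr_diff)
  then have "a powr r + r * a powr (r - 1) * (y - a) = (1 - r) * a powr r"
    using True by (simp add: algebra_simps)
  also have "\<dots> \<le> 0" using assms by (intro mult_nonpos_nonneg) auto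
  also have "0 = y powr r" using True by simp
  finally show ?thesis .
next
  case False
  have "(r * a powr (r - 1)) * (y - a) \<le> y powr r - a powr r"
  proof (rule convex_on_imp_above_tangent[OF powr_convex[OF assms(1)]])
    show "((\<lambda>x. x powr r) has_real_derivative r * a powr (r - 1)) (at a within {0<..})"
      using has_real_derivative_powr[OF assms(2)] by (rule has_field_derivative_at_within)
  qed (use assms False in \<open>auto simp: interior_open\<close>)
  then show ?thesis by simp
qed

text \<open>Jensen's inequality for weights of total mass at most \<open>S\<close>.\<close>

lemma powr_sum_le:
  fixes w y :: "'a \<Rightarrow> real"
  assumes "1 \<le> r" "0 < S" "(\<Sum>j\<in>J. w j) \<le> S" "\<And>j. j \<in> J \<Longrightarrow> 0 \<le> w j" "\<And>j. j \<in> J \<Longrightarrow> 0 \<le> y j"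
  shows "(\<Sum>j\<in>J. w j * y j) powr r \<le> S powr (r - 1) * (\<Sum>j\<in>J. w j * y j powr r)"
proof -
  define W where "W = (\<Sum>j\<in>J. w j)"
  define a where "a = (\<Sum>j\<in>J. w j * y j) / S"
  have nn: "0 \<le> (\<Sum>j\<in>J. w j * y j)" "0 \<le> (\<Sum>j\<in>J. w j * y j powr r)"
    using assms by (auto intro!: sum_nonneg)
  have Sa: "(\<Sum>j\<in>J. w j * y j) = S * a" using assms by (simp add: a_def)
  show ?thesis
  proof (cases "a = 0")
    case True
    then show ?thesis using Sa nn by simp
  next
    case False
    then have a: "0 < a" using nn assms by (simp add: a_def)
    have "S * a powr r \<le> W * a powr r + r * a powr (r - 1) * (S * a - W * a)"
    proof -
      have "a powr (r - 1) * a = a powr r" using a by (simp add: powr_diff)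
      then have "W * a powr r + r * a powr (r - 1) * (S * a - W * a) - S * a powr r
          = (r - 1) * (S - W) * a powr r" by (simp add: algebra_simps)
      also have "0 \<le> \<dots>" using assms(1,3) by (simp add: W_def)
      finally show ?thesis by simp
    qed
    also have "\<dots> = (\<Sum>j\<in>J. w j * (a powr r + r * a powr (r - 1) * (y j - a)))"
      unfolding W_def Sa[symmetric]
      by (simp add: sum.distrib sum_subtractf sum_distrib_left sum_distrib_right algebra_simps)
    also have "\<dots> \<le> (\<Sum>j\<in>J. w j * y j powr r)"
      using assms a by (intro sum_mono mult_left_mono powr_above_tangent) auto
    finally have "S powr (r - 1) * (S * a powr r) \<le> S powr (r - 1) * (\<Sum>j\<in>J. w j * y j powr r)"
      by (intro mult_left_mono) auto
    moreover have "S powr (r - 1) * (S * a powr r) = (S * a) powr r"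
      using assms a by (simp add: powr_diff powr_mult)
    ultimately show ?thesis by (simp add: Sa)
  qed
qed

lemma powr_integral_le:
  fixes \<phi> :: "real \<Rightarrow> real"
  assumes "1 \<le> r" "0 < T" and cont: "continuous_on {0..T} \<phi>" and nonneg: "\<And>t. t \<in> {0..T} \<Longrightarrow> 0 \<le> \<phi> t"
  shows "(integral {0..T} \<phi>) powr r \<le> T powr (r - 1) * integral {0..T} (\<lambda>t. \<phi> t powr r)"
proof -
  define a where "a = integral {0..T} \<phi> / T"
  have contr: "continuous_on {0..T} (\<lambda>t. \<phi> t powr r)"
    using assms by (intro continuous_on_powr' continuous_intros) auto
  have nn: "0 \<le> integral {0..T} \<phi>" "0 \<le> integral {0..T} (\<lambda>t. \<phi> t powr r)"
    using assms contr by (auto intro!: integral_nonneg integrable_continuous_real)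
  have Ta: "integral {0..T} \<phi> = T * a" using assms by (simp add: a_def)
  show ?thesis
  proof (cases "a = 0")
    case True
    then show ?thesis using Ta nn by simp
  next
    case False
    then have a: "0 < a" using nn assms by (simp add: a_def)
    have "((\<lambda>t. a powr r + r * a powr (r - 1) * (\<phi> t - a)) has_integral
        (T * a powr r + r * a powr (r - 1) * (T * a - T * a))) {0..T}"
      using assms integrable_integral[OF integrable_continuous_real[OF cont]] 
        has_integral_const_real[of a 0 T] has_integral_const_real[of "a powr r" 0 T]
      by (intro has_integral_add has_integral_mult_right has_integral_diff) (auto simp: Ta)
    then have "T * a powr r \<le> integral {0..T} (\<lambda>t. \<phi> t powr r)"
      using has_integral_le[OF _ integrable_integral[OF integrable_continuous_real[OF contr]]]
        powr_above_tangent[OF assms(1) a nonneg] by fastforce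
    then have "T powr (r - 1) * (T * a powr r) \<le> T powr (r - 1) * integral {0..T} (\<lambda>t. \<phi> t powr r)"
      by (intro mult_left_mono) auto
    moreover have "T powr (r - 1) * (T * a powr r) = (T * a) powr r"
      using assms a by (simp add: powr_diff powr_mult)
    ultimately show ?thesis by (simp add: Ta)
  qed
qed

lemma powr_add_le:
  fixes a b r :: real
  assumes "1 \<le> r" "0 \<le> a" "0 \<le> b"
  shows "(a + b) powr r \<le> 2 powr r * (a powr r + b powr r)" "a powr r + b powr r \<le> (a + b) powr r"
proof -
  have "(a + b) powr r \<le> (2 * max a b) powr r" using assms by (intro powr_mono2) auto
  also have "\<dots> = 2 powr r * max a b powr r" by (rule powr_mult)
  also have "\<dots> \<le> 2 powr r * (a powr r + b powr r)" by (intro mult_left_mono) (auto simp: max_def)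
  finally show "(a + b) powr r \<le> 2 powr r * (a powr r + b powr r)" .
  show "a powr r + b powr r \<le> (a + b) powr r"
  proof (cases "a + b = 0")
    case True
    then have "a = 0" "b = 0" using assms by auto
    then show ?thesis by simp
  next
    case False
    have split: "z powr r = z * z powr (r - 1)" if "0 \<le> z" for z :: real
      using that by (cases "z = 0") (auto simp: powr_diff)
    have "a powr r + b powr r \<le> a * (a + b) powr (r - 1) + b * (a + b) powr (r - 1)"
      using assms by (simp only: split[of a] split[of b]) (intro add_mono mult_left_mono powr_mono2; simp)
    also have "\<dots> = (a + b) powr r" using split[of "a + b"] assms by (simp add: algebra_simps)
    finally show ?thesis .
  qed
qed

definition power_integral :: "real \<Rightarrow> (real^'n::finite) set \<Rightarrow> (real^'n \<Rightarrow> complex) \<Rightarrow> ennreal" where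
  "power_integral r \<Omega> F = (\<integral>\<^sup>+x. ennreal (norm (F x) powr r) * indicator \<Omega> x \<partial>lborel)"

lemma Lp_norm_le_iff_power_integral:
  assumes p: "1 \<le> p" "p \<noteq> \<infinity>" and M: "0 \<le> M" and \<Omega>: "open \<Omega>"
  shows "Lp_norm p \<Omega> F \<le> ennreal M \<longleftrightarrow> power_integral (enn2real p) \<Omega> F \<le> ennreal (M powr enn2real p)"
proof -
  define r where "r = enn2real p"
  have r: "1 \<le> r"
    using p enn2real_mono[of 1 p] by (simp add: r_def less_top)
  define I where "I = power_integral r \<Omega> F"
  have "Lp_norm p \<Omega> F = (if I = \<infinity> then \<infinity> else ennreal (enn2real I powr (1 / r)))"
    using p \<Omega> by (simp add: Lp_norm_def Let_def I_def power_integral_def r_def nn_integral_restrict_space)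
  moreover have "ennreal (enn2real I powr (1 / r)) \<le> ennreal M \<longleftrightarrow> I \<le> ennreal (M powr r)" if fin: "I \<noteq> \<infinity>"
  proof -
    obtain J where J: "I = ennreal J" "0 \<le> J" using fin by (cases I) auto
    have "J powr (1 / r) \<le> M \<longleftrightarrow> J \<le> M powr r"
    proof
      assume "J powr (1 / r) \<le> M"
      then have "(J powr (1 / r)) powr r \<le> M powr r" using r by (intro powr_mono2) auto
      then show "J \<le> M powr r" using r J by (simp add: powr_powr)
    next
      assume "J \<le> M powr r"
      then have "J powr (1 / r) \<le> (M powr r) powr (1 / r)" using r J by (intro powr_mono2) auto
      then show "J powr (1 / r) \<le> M" using r M by (simp add: powr_powr)
    qed
    then show ?thesis using J M by (simp add: ennreal_le_iff)
  qed
  ultimately show ?thesis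
    by (auto simp: I_def[symmetric] r_def[symmetric] top_unique)
qed

lemma power_integrand_measurable:
  fixes F :: "real^'n::finite \<Rightarrow> complex"
  assumes "open \<Omega>" "continuous_on \<Omega> F"
  shows "(\<lambda>x. ennreal (norm (F x) powr r) * indicator \<Omega> x) \<in> borel_measurable borel"
proof -
  have "(\<lambda>x. norm (indicator \<Omega> x *\<^sub>R F x)) \<in> borel_measurable borel"
    using borel_measurable_continuous_on_indicator[OF _ assms(2)] assms(1) by measurable
  then have "(\<lambda>x. ennreal (norm (indicator \<Omega> x *\<^sub>R F x) powr r)) \<in> borel_measurable borel"
    by measurable
  also have "(\<lambda>x. ennreal (norm (indicator \<Omega> x *\<^sub>R F x) powr r))
      = (\<lambda>x. ennreal (norm (F x) powr r) * indicator \<Omega> x)"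
    by (auto simp: indicator_def)
  finally show ?thesis .
qed

lemma nn_integral_lborel_shift:
  fixes h :: "'a::euclidean_space \<Rightarrow> ennreal"
  assumes [measurable]: "h \<in> borel_measurable borel"
  shows "(\<integral>\<^sup>+x. h (x + a) \<partial>lborel) = (\<integral>\<^sup>+x. h x \<partial>lborel)"
proof -
  have "(\<integral>\<^sup>+x. h x \<partial>lborel) = (\<integral>\<^sup>+x. h x \<partial>distr lborel borel ((+) a))"
    by (simp add: lborel_distr_plus)
  also have "\<dots> = (\<integral>\<^sup>+x. h (a + x) \<partial>lborel)" by (rule nn_integral_distr) auto
  finally show ?thesis by (simp add: add.commute)
qed

text \<open>Fubini and translation invariance: averaging over translations preserves the integral. This is how
  the integral remainder of Taylor's formula is estimated in \<open>L\<^sup>p\<close>.\<close>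

lemma nn_integral_shift_average:
  fixes h :: "'a::euclidean_space \<Rightarrow> ennreal"
  assumes [measurable]: "h \<in> borel_measurable borel" and "0 \<le> T"
  shows "(\<integral>\<^sup>+x. (\<integral>\<^sup>+t. h (x + t *\<^sub>R v) * indicator {0..T} t \<partial>lborel) \<partial>lborel)
    = ennreal T * (\<integral>\<^sup>+x. h x \<partial>lborel)"
proof -
  have "(\<integral>\<^sup>+x. (\<integral>\<^sup>+t. h (x + t *\<^sub>R v) * indicator {0..T} t \<partial>lborel) \<partial>lborel)
      = (\<integral>\<^sup>+t. (\<integral>\<^sup>+x. h (x + t *\<^sub>R v) * indicator {0..T} t \<partial>lborel) \<partial>lborel)"
    by (rule lborel_pair.Fubini'[symmetric]) measurable
  also have "\<dots> = (\<integral>\<^sup>+t. (\<integral>\<^sup>+x. h x \<partial>lborel) * indicator {0..T} t \<partial>lborel)"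
    by (simp add: nn_integral_multc nn_integral_lborel_shift)
  also have "\<dots> = (\<integral>\<^sup>+x. h x \<partial>lborel) * ennreal T"
    using assms by (simp add: nn_integral_cmult)
  finally show ?thesis by (simp add: mult.commute)
qed

lemma power_integral_mono:
  "\<Omega> \<subseteq> \<Omega>' \<Longrightarrow> power_integral r \<Omega> F \<le> power_integral r \<Omega>' F"
  unfolding power_integral_def by (intro nn_integral_mono) (auto simp: indicator_def)

text \<open>Raise the pointwise estimate to the power \<open>r\<close>, move the power inside the sum and the integral by
  Jensen's inequality, and integrate over \<open>\<Omega>\<close>. Every translate of \<open>\<Omega>\<close> that occurs is contained
  in \<open>\<Omega>'\<close>.\<close>

lemma power_integral_partial_power_le:
  fixes G :: "real^'n::finite \<Rightarrow> complex"
  defines "v \<equiv> \<lambda>i. axis i 1 :: real^'n"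
  assumes r: "1 \<le> r" and G: "smooth_on U G" and c: "c < m" and \<eta>: "0 < \<eta>" 
    and \<Omega>: "open \<Omega>" "open \<Omega>'" "\<Omega>' \<subseteq> U"
    and shift: "\<And>x t. x \<in> \<Omega> \<Longrightarrow> 0 \<le> t \<Longrightarrow> t \<le> m * \<eta> \<Longrightarrow> x + t *\<^sub>R v i \<in> \<Omega>'"
    and M: "0 \<le> M0" "0 \<le> M1"
    and M0: "power_integral r \<Omega>' G \<le> ennreal (M0 powr r)"
    and M1: "power_integral r \<Omega>' ((partial i ^^ m) G) \<le> ennreal (M1 powr r)"
  shows "power_integral r \<Omega> ((partial i ^^ c) G)
    \<le> ennreal ((exp (7 * real m) / \<eta> ^ c * (M0 + \<eta> ^ m * M1)) powr r)"
proof -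
  define S where "S = exp (4 * real m)"
  define R where "R = S * ((m * \<eta>) ^ (m - 1) / fact (m - 1))"
  define T where "T = m * \<eta>"
  define H where "H = (partial i ^^ m) G"
  define w where "w j = \<bar>diff_weight m c j\<bar>" for j
  define hG where "hG x = ennreal (norm (G x) powr r) * indicator \<Omega>' x" for x
  define hH where "hH x = ennreal (norm (H x) powr r) * indicator \<Omega>' x" for x
  define E where "E = \<eta> ^ c"
  have m: "1 \<le> m" using c by simp
  have pos: "0 < S" "0 \<le> R" "0 < T" "0 < E" using \<eta> c by (auto simp: S_def R_def T_def E_def)
  have w: "0 \<le> w j" "(\<Sum>j<m. w j) \<le> S" for j
    by (simp_all add: w_def S_def sum_abs_diff_weight_le[OF c])
  have sH: "smooth_on U H" unfolding H_def by (rule smooth_on_partial_power[OF G])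
  have contG: "continuous_on \<Omega>' G" and contH: "continuous_on \<Omega>' H"
    using continuous_on_subset[OF smooth_on_continuous_on \<Omega>(3)] G sH by blast+
  have meas[measurable]: "hG \<in> borel_measurable borel" "hH \<in> borel_measurable borel"
    unfolding hG_def hH_def
    by (intro power_integrand_measurable \<Omega> contG contH)+
  have weighted_sum: "(\<Sum>j<m. ennreal (w j) * ennreal (z j)) = ennreal (\<Sum>j<m. w j * z j)"
    and weighted_sum_nonneg: "0 \<le> (\<Sum>j<m. w j * z j)"
    if "\<And>j. 0 \<le> z j" for z
    using that w by (simp_all add: sum_nonneg flip: ennreal_mult)
  have ptw: "ennreal ((E * norm ((partial i ^^ c) G x)) powr r) \<le>
      ennreal (2 powr r) * (ennreal (S powr (r - 1)) * (\<Sum>j<m. ennreal (w j) * hG (x + (j * \<eta>) *\<^sub>R v i))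
        + ennreal (R powr r * T powr (r - 1)) * (\<integral>\<^sup>+t. hH (x + t *\<^sub>R v i) * indicator {0..T} t \<partial>lborel))"
    if x: "x \<in> \<Omega>" for x
  proof -
    let ?y = "\<lambda>t. x + t *\<^sub>R v i"
    define A where "A = (\<Sum>j<m. w j * norm (G (?y (j * \<eta>))))"
    define I where "I = integral {0..T} (\<lambda>t. norm (H (?y t)))"
    define Ir where "Ir = integral {0..T} (\<lambda>t. norm (H (?y t)) powr r)"
    have y: "?y t \<in> \<Omega>'" if "0 \<le> t" "t \<le> T" for t using shift[OF x] that by (simp add: T_def)
    have yj: "?y (j * \<eta>) \<in> \<Omega>'" if "j < m" for j using y[of "j * \<eta>"] that \<eta> by (simp add: T_def)
    have cont: "continuous_on {0..T} (\<lambda>t. norm (H (?y t)))"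
      using y by (intro continuous_on_norm continuous_on_compose2[OF contH]) (auto intro!: continuous_intros)
    have contr: "continuous_on {0..T} (\<lambda>t. norm (H (?y t)) powr r)"
      by (rule continuous_on_powr'[OF cont]) (use r in \<open>auto intro!: continuous_intros\<close>)
    have nn: "0 \<le> A" "0 \<le> I" "0 \<le> Ir"
      unfolding A_def I_def Ir_def using w cont contr
      by (auto intro!: sum_nonneg integral_nonneg integrable_continuous_real)
    have "E * norm ((partial i ^^ c) G x) \<le> A + R * I"
      using partial_power_estimate[OF G, of 1 c m \<eta> x i] c \<eta> y \<Omega>(3)
      by (auto simp: E_def A_def R_def I_def S_def T_def H_def w_def v_def)
    then have "(E * norm ((partial i ^^ c) G x)) powr r \<le> (A + R * I) powr r"
      using pos r by (intro powr_mono2) auto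
    also have "\<dots> \<le> 2 powr r * (A powr r + (R * I) powr r)"
      using r nn pos by (intro powr_add_le) auto
    also have "\<dots> \<le> 2 powr r * (S powr (r - 1) * (\<Sum>j<m. w j * norm (G (?y (j * \<eta>))) powr r)
        + R powr r * (T powr (r - 1) * Ir))"
    proof (intro mult_left_mono add_mono)
      show "A powr r \<le> S powr (r - 1) * (\<Sum>j<m. w j * norm (G (?y (j * \<eta>))) powr r)"
        unfolding A_def using r pos w by (intro powr_sum_le) auto
      have "I powr r \<le> T powr (r - 1) * Ir"
        unfolding I_def Ir_def by (rule powr_integral_le[OF r pos(3) cont]) simp
      then show "(R * I) powr r \<le> R powr r * (T powr (r - 1) * Ir)"
        by (simp add: powr_mult mult_left_mono)
    qed auto
    finally have "ennreal ((E * norm ((partial i ^^ c) G x)) powr r) \<le>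
       ennreal (2 powr r * (S powr (r - 1) * (\<Sum>j<m. w j * norm (G (?y (j * \<eta>))) powr r)
        + R powr r * (T powr (r - 1) * Ir)))"
      by (rule ennreal_leI)
    also have "\<dots> = ennreal (2 powr r) * (ennreal (S powr (r - 1)) *
        (\<Sum>j<m. ennreal (w j) * ennreal (norm (G (?y (j * \<eta>))) powr r))
        + ennreal (R powr r * T powr (r - 1)) * ennreal Ir)"
      using nn weighted_sum_nonneg by (simp add: weighted_sum ennreal_mult mult.assoc)
    also have "(\<Sum>j<m. ennreal (w j) * ennreal (norm (G (?y (j * \<eta>))) powr r))
        = (\<Sum>j<m. ennreal (w j) * hG (?y (j * \<eta>)))"
      using yj by (intro sum.cong) (auto simp: hG_def)
    also have "ennreal Ir = (\<integral>\<^sup>+t. ennreal (norm (H (?y t)) powr r) * indicator {0..T} t \<partial>lborel)"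
      unfolding Ir_def
      by (rule nn_integral_has_integral_lebesgue'[symmetric])
        (auto intro!: integrable_integral integrable_continuous_real contr)
    also have "\<dots> = (\<integral>\<^sup>+t. hH (?y t) * indicator {0..T} t \<partial>lborel)"
      using y by (intro nn_integral_cong) (auto simp: hH_def indicator_def)
    finally show ?thesis .
  qed
  have "ennreal (E powr r) * power_integral r \<Omega> ((partial i ^^ c) G)
      = (\<integral>\<^sup>+x. ennreal ((E * norm ((partial i ^^ c) G x)) powr r) * indicator \<Omega> x \<partial>lborel)"
  proof -
    have "\<Omega> \<subseteq> U" using shift[of _ 0] \<eta> \<Omega>(3) by auto
    then have "continuous_on \<Omega> ((partial i ^^ c) G)"
      using continuous_on_subset[OF smooth_on_continuous_on[OF smooth_on_partial_power[OF G]]] by blast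
    then have "(\<lambda>x. ennreal (norm ((partial i ^^ c) G x) powr r) * indicator \<Omega> x) \<in> borel_measurable lborel"
      using power_integrand_measurable[OF \<Omega>(1)] by simp
    then show ?thesis
      unfolding power_integral_def
      by (subst nn_integral_cmult[symmetric]) (auto simp: powr_mult ennreal_mult mult.assoc)
  qed
  also have "\<dots> \<le> (\<integral>\<^sup>+x. ennreal (2 powr r) * (ennreal (S powr (r - 1)) *
        (\<Sum>j<m. ennreal (w j) * hG (x + (j * \<eta>) *\<^sub>R v i))
        + ennreal (R powr r * T powr (r - 1)) * (\<integral>\<^sup>+t. hH (x + t *\<^sub>R v i) * indicator {0..T} t \<partial>lborel)) \<partial>lborel)"
    using ptw by (intro nn_integral_mono) (auto simp: indicator_def)
  also have "\<dots> = ennreal (2 powr r) * (ennreal (S powr (r - 1)) *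
        (\<Sum>j<m. ennreal (w j) * power_integral r \<Omega>' G)
        + ennreal (R powr r * T powr (r - 1)) * (ennreal T * power_integral r \<Omega>' H))"
  proof -
    have 1: "(\<integral>\<^sup>+x. hG (x + (j * \<eta>) *\<^sub>R v i) \<partial>lborel) = power_integral r \<Omega>' G" for j :: nat
      by (subst nn_integral_lborel_shift) (auto simp: power_integral_def hG_def[abs_def, symmetric] meas)
    have 2: "(\<integral>\<^sup>+x. (\<integral>\<^sup>+t. hH (x + t *\<^sub>R v i) * indicator {0..T} t \<partial>lborel) \<partial>lborel)
        = ennreal T * power_integral r \<Omega>' H"
      using pos by (subst nn_integral_shift_average) (auto simp: power_integral_def hH_def[abs_def, symmetric] meas)
    show ?thesis
      by (simp add: nn_integral_cmult nn_integral_add nn_integral_sum 1 2)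
  qed
  also have "\<dots> \<le> ennreal (2 powr r) * (ennreal (S powr (r - 1)) *
        (\<Sum>j<m. ennreal (w j) * ennreal (M0 powr r))
        + ennreal (R powr r * T powr (r - 1)) * (ennreal T * ennreal (M1 powr r)))"
    using M0 M1 unfolding H_def by (intro mult_left_mono add_mono sum_mono) auto
  also have "\<dots> = ennreal (2 powr r * (S powr (r - 1) * ((\<Sum>j<m. w j) * M0 powr r)
        + R powr r * T powr (r - 1) * (T * M1 powr r)))"
    using pos weighted_sum_nonneg[of "\<lambda>_. M0 powr r"]
    by (simp add: weighted_sum ennreal_mult sum_distrib_right)
  also have "\<dots> \<le> ennreal ((E * (exp (7 * real m) / E * (M0 + \<eta> ^ m * M1))) powr r)"
  proof (rule ennreal_leI)
    have pr: "z powr (r - 1) * z = z powr r" if "0 < z" for z :: real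
      using that by (simp add: powr_diff)
    have "S powr (r - 1) * ((\<Sum>j<m. w j) * M0 powr r) \<le> S powr (r - 1) * (S * M0 powr r)"
      using w by (intro mult_left_mono mult_right_mono) auto
    also have "\<dots> = (S * M0) powr r" using pr[OF pos(1)] by (simp add: powr_mult)
    finally have 1: "S powr (r - 1) * ((\<Sum>j<m. w j) * M0 powr r) \<le> (S * M0) powr r" .
    have 2: "R powr r * T powr (r - 1) * (T * M1 powr r) = (R * T * M1) powr r"
      using pr[OF pos(3)] by (simp add: powr_mult)
    \<comment> \<open>\<open>R T\<close> is the constant of the Taylor remainder after averaging over the segment of length \<open>T\<close>.\<close>
    have RT: "R * T * M1 \<le> S * (exp (2 * real m) * (\<eta> ^ m * M1))"
      using mult_left_mono[OF mult_right_mono[OF taylor_remainder_constant_le[OF m, of \<eta>] M(2)], of S] \<eta> pos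
      by (simp add: R_def T_def mult_ac)
    have "S powr (r - 1) * ((\<Sum>j<m. w j) * M0 powr r) + R powr r * T powr (r - 1) * (T * M1 powr r)
        \<le> (S * M0) powr r + (R * T * M1) powr r"
      using 1 2 by simp
    also have "\<dots> \<le> (S * M0 + R * T * M1) powr r"
      using r pos M by (intro powr_add_le) auto
    finally have "2 powr r * (S powr (r - 1) * ((\<Sum>j<m. w j) * M0 powr r) + R powr r * T powr (r - 1) * (T * M1 powr r))
        \<le> (2 * (S * M0 + R * T * M1)) powr r"
      by (subst powr_mult) (rule mult_left_mono, simp_all)
    also have "\<dots> \<le> (exp (7 * real m) * (M0 + \<eta> ^ m * M1)) powr r"
    proof (rule powr_mono2)
      have X: "0 \<le> \<eta> ^ m * M1" using \<eta> M by simp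
      have "S * M0 + R * T * M1 \<le> S * (exp (2 * real m) * M0) + S * (exp (2 * real m) * (\<eta> ^ m * M1))"
        using RT pos M mult_right_mono[of 1 "exp (2 * real m)" M0]
        by (intro add_mono mult_left_mono) auto
      also have "\<dots> = exp (6 * real m) * (M0 + \<eta> ^ m * M1)"
        by (simp add: S_def algebra_simps flip: exp_add)
      moreover have "2 \<le> exp (real m)" using exp_ge_add_one_self[of "real m"] m by linarith
      ultimately have "2 * (S * M0 + R * T * M1) \<le> exp (real m) * (exp (6 * real m) * (M0 + \<eta> ^ m * M1))"
        using M X pos by (intro mult_mono) auto
      then show "2 * (S * M0 + R * T * M1) \<le> exp (7 * real m) * (M0 + \<eta> ^ m * M1)"
        by (simp add: mult.assoc[symmetric] flip: exp_add)
    qed (use r pos M in auto)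
    finally show "2 powr r * (S powr (r - 1) * ((\<Sum>j<m. w j) * M0 powr r) + R powr r * T powr (r - 1) * (T * M1 powr r))
        \<le> (E * (exp (7 * real m) / E * (M0 + \<eta> ^ m * M1))) powr r"
      using pos by simp
  qed
  also have "\<dots> = ennreal (E powr r) * ennreal ((exp (7 * real m) / E * (M0 + \<eta> ^ m * M1)) powr r)"
    by (subst powr_mult, subst ennreal_mult) simp_all
  finally show ?thesis
    using pos unfolding E_def[symmetric] by (subst (asm) ennreal_mult_le_mult_iff) auto
qed

text \<open>For a continuous function the set where a bound is violated is open, and a nonempty open set is not
  a null set.\<close>

lemma Lp_norm_infinity_le_iff:
  fixes F :: "real^'n::finite \<Rightarrow> complex"
  assumes \<Omega>: "open \<Omega>" and F: "continuous_on \<Omega> F" and M: "0 \<le> M"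
  shows "Lp_norm \<infinity> \<Omega> F \<le> ennreal M \<longleftrightarrow> (\<forall>x\<in>\<Omega>. norm (F x) \<le> M)"
proof -
  let ?M = "restrict_space lborel \<Omega>" and ?f = "\<lambda>x. ennreal (norm (F x))"
  have "(\<lambda>x. norm (F x)) \<in> borel_measurable (restrict_space borel \<Omega>)"
    by (intro borel_measurable_continuous_on_restrict continuous_intros F)
  then have meas: "?f \<in> borel_measurable ?M"
    by (simp add: measurable_cong_sets[OF sets_restrict_space_cong[OF sets_lborel] refl])
  have norm: "Lp_norm \<infinity> \<Omega> F = esssup ?M ?f" by (simp add: Lp_norm_def)
  show ?thesis
  proof
    assume "\<forall>x\<in>\<Omega>. norm (F x) \<le> M"
    then show "Lp_norm \<infinity> \<Omega> F \<le> ennreal M"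
      unfolding norm by (intro esssup_I[OF meas]) (auto intro!: AE_I2 ennreal_leI simp: space_restrict_space)
  next
    assume le: "Lp_norm \<infinity> \<Omega> F \<le> ennreal M"
    define V where "V = \<Omega> \<inter> {x \<in> \<Omega>. M < norm (F x)}"
    have "open V"
    proof -
      have "openin (top_of_set \<Omega>) (\<Omega> \<inter> (\<lambda>x. norm (F x)) -` {M<..})"
        by (rule continuous_openin_preimage_gen) (auto intro!: continuous_intros F)
      then show ?thesis
        using \<Omega> openin_open_trans by (auto simp: V_def vimage_def Int_def)
    qed
    have "AE x in ?M. ?f x \<le> ennreal M"
      using esssup_AE[of ?f ?M] le unfolding norm by (auto elim: eventually_mono)
    then have "AE x in lborel. x \<in> \<Omega> \<longrightarrow> norm (F x) \<le> M"
      using \<Omega> M by (simp add: AE_restrict_space_iff)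
    then have "AE x in lborel. x \<notin> V"
      by eventually_elim (auto simp: V_def)
    then have "V \<in> null_sets lborel"
      using \<open>open V\<close> by (simp add: AE_iff_null_sets)
    then have "negligible V"
      by (simp add: negligible_iff_null_sets null_sets_completionI)
    then have "V = {}" using open_not_negligible \<open>open V\<close> by blast
    then show "\<forall>x\<in>\<Omega>. norm (F x) \<le> M" by (auto simp: V_def not_less)
  qed
qed

lemma interpolates_restrict_nonneg:
  assumes interp: "interpolates U \<delta> bd"
    and iff: "\<And>r F M. smooth_on U F \<Longrightarrow> bd' r F M \<longleftrightarrow> 0 \<le> M \<and> bd r F M"
  shows "interpolates U \<delta> bd'"
  unfolding interpolates_def
proof (intro conjI allI impI)
  fix r G and M M' :: real
  assume G: "smooth_on U G" and *: "bd' r G M" "M \<le> M'"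
  show "bd' r G M'" "bd' (Suc r) G M'"
    using interpolates_mono[OF interp G _ *(2), of r] *(1,2) unfolding iff[OF G] by auto
next
  fix r c m :: nat and G i and \<eta> M0 M1 :: real
  assume G: "smooth_on U G" and m: "1 \<le> m" "c \<le> m" and \<eta>: "0 < \<eta>" "m * \<eta> \<le> \<delta>"
    and M: "0 \<le> M0" "0 \<le> M1" and bd: "bd' r G M0" "bd' r ((partial i ^^ m) G) M1"
  note smooth = smooth_on_partial_power[OF G]
  have "bd r G M0" "bd r ((partial i ^^ m) G) M1"
    using bd unfolding iff[OF G] iff[OF smooth] by auto
  then show "bd' (Suc r) ((partial i ^^ c) G) (exp (7 * real m) / \<eta> ^ c * (M0 + \<eta> ^ m * M1))"
    unfolding iff[OF smooth] using interpolates_partial[OF interp G m \<eta> M] \<eta> M by auto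
qed

text \<open>The conjunct \<open>0 \<le> M\<close> is there because \<open>ennreal\<close> sends negative reals to \<open>0\<close>.\<close>

lemma interpolates_Lp_norm:
  fixes \<Omega> :: "nat \<Rightarrow> (real^'n::finite) set"
  assumes p: "1 \<le> p" and \<Omega>: "\<And>r. open (\<Omega> r)" "\<And>r. \<Omega> r \<subseteq> U" and \<delta>: "0 < \<delta>"
    and shift: "\<And>r x i t. x \<in> \<Omega> (Suc r) \<Longrightarrow> 0 \<le> t \<Longrightarrow> t \<le> \<delta> \<Longrightarrow> x + t *\<^sub>R axis i 1 \<in> \<Omega> r"
  shows "interpolates U \<delta> (\<lambda>r F M. 0 \<le> M \<and> Lp_norm p (\<Omega> r) F \<le> ennreal M)"
proof (cases "p = \<infinity>")
  case True
  have "interpolates U \<delta> (\<lambda>r F M. \<forall>x\<in>\<Omega> r. norm (F x) \<le> M)"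
    using interpolates_sup_norm[of \<Omega> U "\<lambda>_. 1" \<delta>] \<Omega> \<delta> shift by simp
  moreover have "Lp_norm \<infinity> (\<Omega> r) F \<le> ennreal M \<longleftrightarrow> (\<forall>x\<in>\<Omega> r. norm (F x) \<le> M)"
    if F: "smooth_on U F" and M: "0 \<le> M" for r F M
    by (rule Lp_norm_infinity_le_iff[OF \<Omega>(1)
          continuous_on_subset[OF smooth_on_continuous_on[OF F] \<Omega>(2)] M])
  ultimately show ?thesis
    unfolding True by (auto intro: interpolates_restrict_nonneg)
next
  case False
  let ?r = "enn2real p"
  have r: "1 \<le> ?r"
    using p False enn2real_mono[of 1 p] by (simp add: less_top)
  note iff = Lp_norm_le_iff_power_integral[OF p False _ \<Omega>(1)]
  have sub: "\<Omega> (Suc r) \<subseteq> \<Omega> r" for r using shift[of _ r 0] \<delta> by auto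
  show ?thesis
    unfolding interpolates_def
  proof (intro conjI allI impI; (elim conjE)?)
    fix r and G :: "real^'n \<Rightarrow> complex" and M M' :: real
    assume G: "smooth_on U G" and M: "M \<le> M'" "0 \<le> M" and le: "Lp_norm p (\<Omega> r) G \<le> ennreal M"
    show "0 \<le> M'" "0 \<le> M'" using M by auto
    show "Lp_norm p (\<Omega> r) G \<le> ennreal M'" using le M by (meson ennreal_leI order.trans)
    have "power_integral ?r (\<Omega> (Suc r)) G \<le> ennreal (M powr ?r)"
      using le M iff[of M r G] power_integral_mono[OF sub[of r], of ?r G] by (auto intro: order.trans)
    then have "Lp_norm p (\<Omega> (Suc r)) G \<le> ennreal M" using iff M by simp
    then show "Lp_norm p (\<Omega> (Suc r)) G \<le> ennreal M'" using M by (meson ennreal_leI order.trans)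
  next
    fix r c m :: nat and G :: "real^'n \<Rightarrow> complex" and i and \<eta> M0 M1 :: real
    assume G: "smooth_on U G" and m: "1 \<le> m" "c \<le> m" and \<eta>: "0 < \<eta>" "m * \<eta> \<le> \<delta>"
      and M: "0 \<le> M0" "0 \<le> M1"
      and M0: "Lp_norm p (\<Omega> r) G \<le> ennreal M0"
      and M1: "Lp_norm p (\<Omega> r) ((partial i ^^ m) G) \<le> ennreal M1"
    define B where "B = exp (7 * real m) / \<eta> ^ c * (M0 + \<eta> ^ m * M1)"
    show B: "0 \<le> exp (7 * real m) / \<eta> ^ c * (M0 + \<eta> ^ m * M1)" using M \<eta> by simp
    have "power_integral ?r (\<Omega> (Suc r)) ((partial i ^^ c) G) \<le> ennreal (B powr ?r)"
    proof (cases "c = m")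
      case True
      have "power_integral ?r (\<Omega> (Suc r)) ((partial i ^^ c) G) \<le> ennreal (M1 powr ?r)"
        using M1 M True iff[of M1 r] power_integral_mono[OF sub[of r]] by (auto intro: order.trans)
      also have "\<dots> \<le> ennreal (B powr ?r)"
        using top_order_le[OF \<eta>(1) M, of m] M True r unfolding B_def
        by (intro ennreal_leI powr_mono2) auto
      finally show ?thesis .
    next
      case False
      then show ?thesis
        unfolding B_def using m \<eta> M M0 M1 iff shift
        by (intro power_integral_partial_power_le[OF r G _ \<eta>(1) \<Omega>(1) \<Omega>(1) \<Omega>(2)]) auto
    qed
    then show "Lp_norm p (\<Omega> (Suc r)) ((partial i ^^ c) G) \<le> ennreal (exp (7 * real m) / \<eta> ^ c * (M0 + \<eta> ^ m * M1))"
      using iff[OF B] unfolding B_def by simp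
  qed
qed

section \<open>Weight sequences and special base sequences\<close>

lemma le_phi_star:
  assumes "weight_function \<omega>" "0 \<le> s" "0 \<le> t"
  shows "s * t - \<omega> (exp t) \<le> phi_star \<omega> s"
  unfolding phi_star_def
  by (rule cSUP_upper[OF _ bdd_above_phi_star[OF assms(1,2)]]) (use assms in auto)

lemma phi_star_le:
  assumes "\<And>t. 0 \<le> t \<Longrightarrow> s * t - \<omega> (exp t) \<le> M"
  shows "phi_star \<omega> s \<le> M"
  unfolding phi_star_def by (rule cSUP_least) (use assms in auto)

text \<open>This holds for each function under the supremum because \<open>\<omega> \<ge> 0\<close>. It says that \<open>\<phi>\<^sup>*(s) / s\<close> is increasing.\<close>

lemma phi_star_scale:
  assumes w: "weight_function \<omega>" and "0 \<le> q" "q \<le> 1" "0 \<le> s"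
  shows "phi_star \<omega> (q * s) \<le> q * phi_star \<omega> s"
proof (rule phi_star_le)
  fix t :: real assume t: "0 \<le> t"
  have "0 \<le> \<omega> (exp t)" using w by (simp add: weight_function_def)
  then have "q * \<omega> (exp t) \<le> \<omega> (exp t)"
    using assms mult_right_mono[of q 1 "\<omega> (exp t)"] by simp
  then have "q * s * t - \<omega> (exp t) \<le> q * (s * t - \<omega> (exp t))"
    by (simp add: algebra_simps)
  also have "\<dots> \<le> q * phi_star \<omega> s"
    using assms t by (intro mult_left_mono le_phi_star)
  finally show "q * s * t - \<omega> (exp t) \<le> q * phi_star \<omega> s" .
qed

lemma phi_star_le_ratio:
  assumes "weight_function \<omega>" "0 \<le> r" "r \<le> s" "0 < s"
  shows "phi_star \<omega> r \<le> r / s * phi_star \<omega> s"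
  using phi_star_scale[OF assms(1), of "r / s" s] assms by simp

lemma phi_star_0_le: "weight_function \<omega> \<Longrightarrow> phi_star \<omega> 0 \<le> 0"
  using phi_star_scale[of \<omega> 0 0] by simp

lemma weight_seq_pos: "0 < weight_seq \<omega> \<rho> k"
  by (simp add: weight_seq_def)

lemma weight_seq_mono:
  assumes "weight_function \<omega>" "0 < \<rho>" "\<rho> \<le> \<sigma>"
  shows "weight_seq \<omega> \<rho> k \<le> weight_seq \<omega> \<sigma> k"
proof -
  have "phi_star \<omega> (\<rho> / \<sigma> * (\<sigma> * k)) \<le> \<rho> / \<sigma> * phi_star \<omega> (\<sigma> * k)"
    using assms by (intro phi_star_scale) auto
  then show ?thesis
    using assms by (simp add: weight_seq_def field_simps)
qed

text \<open>By monotonicity of \<open>\<phi>\<^sup>*(s) / s\<close>, the values of \<open>\<phi>\<^sup>*\<close> at \<open>\<rho> a\<close> and \<open>\<rho> b\<close> lie below the line through the origin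
  and the point of the graph over \<open>B \<rho> s\<close>. Convex combinations stay below that line.\<close>

lemma weight_seq_interpolate:
  assumes w: "weight_function \<omega>" and "0 < \<rho>" "1 \<le> B"
    and ab: "a \<le> s" "s \<le> b" "a < b" "1 \<le> s" "real b \<le> B * real s"
    and \<theta>: "\<theta> = real (s - a) / real (b - a)"
  shows "weight_seq \<omega> \<rho> a powr (1 - \<theta>) * weight_seq \<omega> \<rho> b powr \<theta> \<le> weight_seq \<omega> (B * \<rho>) s"
proof -
  define \<Phi> where "\<Phi> = phi_star \<omega> (B * \<rho> * s)"
  have Bs: "0 < B * real s" and a: "real a \<le> B * real s"
    using assms mult_mono[of 1 B "real s" "real s"] by auto
  have le: "phi_star \<omega> (\<rho> * x) \<le> x / (B * s) * \<Phi>" if "0 \<le> x" "x \<le> B * s" for x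
  proof -
    have "0 < B * \<rho> * s" using mult_pos_pos[OF assms(2) Bs] by (simp add: mult_ac)
    then show ?thesis
      using phi_star_le_ratio[OF w, of "\<rho> * x" "B * \<rho> * s"] that assms(2)
        mult_left_mono[of x "B * s" \<rho>]
      by (simp add: \<Phi>_def mult_ac)
  qed
  have \<theta>01: "0 \<le> \<theta>" "\<theta> \<le> 1" using ab by (auto simp: \<theta>)
  have convex: "(1 - \<theta>) * a + \<theta> * b = s"
  proof -
    have "\<theta> * (real b - real a) = real s - real a"
      using ab by (simp add: \<theta> of_nat_diff)
    then show ?thesis by (simp add: algebra_simps)
  qed
  have "(1 - \<theta>) * phi_star \<omega> (\<rho> * a) + \<theta> * phi_star \<omega> (\<rho> * b)
      \<le> (1 - \<theta>) * (a / (B * s) * \<Phi>) + \<theta> * (b / (B * s) * \<Phi>)"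
    using \<theta>01 a ab by (intro add_mono mult_left_mono le) auto
  also have "\<dots> = ((1 - \<theta>) * a + \<theta> * b) / (B * s) * \<Phi>"
    by (simp only: times_divide_eq_left times_divide_eq_right add_divide_distrib distrib_right)
  also have "\<dots> = \<Phi> / B" using convex ab Bs by simp
  finally have "((1 - \<theta>) * phi_star \<omega> (\<rho> * a) + \<theta> * phi_star \<omega> (\<rho> * b)) / \<rho> \<le> \<Phi> / B / \<rho>"
    using assms(2) by (intro divide_right_mono) auto
  then show ?thesis
    by (simp add: weight_seq_def \<Phi>_def exp_powr_real add_divide_distrib mult_ac flip: exp_add)
qed

lemma weight_seq_mult_le:
  assumes w: "weight_function \<omega>" and "0 < \<rho>"
  shows "weight_seq \<omega> \<rho> a * weight_seq \<omega> \<rho> b \<le> weight_seq \<omega> \<rho> (a + b)"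
proof -
  have "phi_star \<omega> (\<rho> * a) + phi_star \<omega> (\<rho> * b) \<le> phi_star \<omega> (\<rho> * real (a + b))"
  proof (cases "a + b = 0")
    case True
    then show ?thesis using phi_star_0_le[OF w] by simp
  next
    case False
    define s where "s = real (a + b)"
    have s: "0 < s" using False unfolding s_def by (simp only: of_nat_0_less_iff)
    have "phi_star \<omega> (\<rho> * a) + phi_star \<omega> (\<rho> * b)
        \<le> (\<rho> * a) / (\<rho> * s) * phi_star \<omega> (\<rho> * s) + (\<rho> * b) / (\<rho> * s) * phi_star \<omega> (\<rho> * s)"
      using assms s by (intro add_mono phi_star_le_ratio) (auto simp: s_def)
    also have "\<dots> = (a + b) / s * phi_star \<omega> (\<rho> * s)"
      using assms s by (simp add: field_simps)
    finally show ?thesis using s by (simp add: s_def)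
  qed
  then have "(phi_star \<omega> (\<rho> * a) + phi_star \<omega> (\<rho> * b)) / \<rho> \<le> phi_star \<omega> (\<rho> * real (a + b)) / \<rho>"
    using assms by (intro divide_right_mono) auto
  then show ?thesis
    by (simp add: weight_seq_def add_divide_distrib flip: exp_add)
qed

text \<open>Passing to a square root of a weight amounts to a change of \<open>\<rho>\<close>; this is what makes interpolation
  with exponent \<open>1/2\<close> lossless.\<close>

lemma weight_seq_double: "weight_seq \<omega> \<rho> (2 * i) = weight_seq \<omega> (2 * \<rho>) i ^ 2"
  by (simp add: weight_seq_def mult_ac flip: exp_of_nat_mult exp_double)

lemma weight_function_dilation:
  assumes w: "weight_function \<omega>"
  obtains K K' where "1 \<le> K" "0 \<le> K'" "\<And>t. 0 \<le> t \<Longrightarrow> \<omega> (2 ^ r * t) \<le> K * \<omega> t + K'"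
proof -
  have mono: "\<omega> x \<le> \<omega> y" if "0 \<le> x" "x \<le> y" for x y
    using w that by (auto simp: weight_function_def mono_on_def)
  have nonneg: "0 \<le> \<omega> x" if "0 \<le> x" for x using w that by (simp add: weight_function_def)
  have "(\<lambda>t. \<omega> (2 * t)) \<in> O[at_top](\<omega>)" using w by (simp add: weight_function_def)
  then obtain c where "eventually (\<lambda>t. norm (\<omega> (2 * t)) \<le> c * norm (\<omega> t)) at_top"
    by (rule landau_o.bigE)
  then obtain T where T: "\<And>t. T \<le> t \<Longrightarrow> \<bar>\<omega> (2 * t)\<bar> \<le> c * \<bar>\<omega> t\<bar>"
    by (auto simp: eventually_at_top_linorder)
  define L L' where "L = max 1 c" and "L' = \<omega> (2 * \<bar>T\<bar>)"
  have L: "1 \<le> L" "0 \<le> L'" using nonneg by (auto simp: L_def L'_def)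
  have double: "\<omega> (2 * t) \<le> L * \<omega> t + L'" if t: "0 \<le> t" for t
  proof (cases "T \<le> t")
    case True
    have "\<omega> (2 * t) \<le> c * \<omega> t" using T[OF True] nonneg[of t] nonneg[of "2 * t"] t by simp
    also have "\<dots> \<le> L * \<omega> t" using nonneg[OF t] by (intro mult_right_mono) (auto simp: L_def)
    finally show ?thesis using L by simp
  next
    case False
    then have "\<omega> (2 * t) \<le> L'" unfolding L'_def using t by (intro mono) auto
    moreover have "0 \<le> L * \<omega> t" using L nonneg[OF t] by (intro mult_nonneg_nonneg) auto
    ultimately show ?thesis by simp
  qed
  have "\<exists>K K'. 1 \<le> K \<and> 0 \<le> K' \<and> (\<forall>t\<ge>0. \<omega> (2 ^ r * t) \<le> K * \<omega> t + K')"
  proof (induction r)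
    case 0
    show ?case by (rule exI[of _ 1], rule exI[of _ 0]) simp
  next
    case (Suc r)
    then obtain K K' where K: "1 \<le> K" "0 \<le> K'" "\<forall>t\<ge>0. \<omega> (2 ^ r * t) \<le> K * \<omega> t + K'" by blast
    have "\<omega> (2 ^ Suc r * t) \<le> (L * K) * \<omega> t + (L * K' + L')" if "0 \<le> t" for t
    proof -
      have "\<omega> (2 ^ Suc r * t) \<le> L * \<omega> (2 ^ r * t) + L'"
        using double[of "2 ^ r * t"] that by (simp add: mult_ac)
      also have "\<dots> \<le> L * (K * \<omega> t + K') + L'"
        using K that L by (intro add_right_mono mult_left_mono) auto
      finally show ?thesis by (simp add: algebra_simps)
    qed
    moreover have "1 \<le> L * K" "0 \<le> L * K' + L'"
      using K L mult_mono[of 1 L 1 K] by auto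
    ultimately show ?case by blast
  qed
  then show ?thesis using that by blast
qed

text \<open>A dilation of \<open>\<omega>\<close> by \<open>A\<close> is a translation of \<open>\<phi>\<close> by \<open>log A\<close>, which adds a linear term to \<open>\<phi>\<^sup>*\<close>; the
  bound \<open>\<omega>(At) \<le> L \<omega>(t) + L'\<close> becomes a rescaling of \<open>\<phi>\<^sup>*\<close> after conjugation. It is essential for the
  Beurling case that \<open>L\<close> depends only on \<open>A\<close>, and not on \<open>\<rho>\<close>.\<close>

lemma weight_seq_absorb_geometric:
  assumes w: "weight_function \<omega>" and "1 \<le> A"
  obtains L where "1 \<le> L"
    "\<And>\<rho>. 0 < \<rho> \<Longrightarrow> \<exists>C\<ge>1. \<forall>j. A ^ j * weight_seq \<omega> \<rho> j \<le> C * weight_seq \<omega> (L * \<rho>) j"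
proof -
  have mono: "\<omega> x \<le> \<omega> y" if "0 \<le> x" "x \<le> y" for x y
    using w that by (auto simp: weight_function_def mono_on_def)
  obtain r where r: "A < 2 ^ r" using real_arch_pow[of 2 A] by auto
  obtain L L' where L: "1 \<le> L" "0 \<le> L'" "\<And>t. 0 \<le> t \<Longrightarrow> \<omega> (2 ^ r * t) \<le> L * \<omega> t + L'"
    by (rule weight_function_dilation[OF w]) blast
  have key: "s * ln A + phi_star \<omega> s \<le> (phi_star \<omega> (L * s) + L') / L" if s: "0 \<le> s" for s
  proof -
    have "phi_star \<omega> s \<le> (phi_star \<omega> (L * s) + L') / L - s * ln A"
    proof (rule phi_star_le)
      fix t :: real assume t: "0 \<le> t"
      have "\<omega> (exp (t + ln A)) \<le> \<omega> (2 ^ r * exp t)"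
        using assms(2) r by (intro mono) (auto simp: exp_add mult.commute)
      also have "\<dots> \<le> L * \<omega> (exp t) + L'" by (rule L(3)) simp
      finally have 1: "\<omega> (exp (t + ln A)) \<le> L * \<omega> (exp t) + L'" .
      have "(L * s) * (t + ln A) - \<omega> (exp (t + ln A)) \<le> phi_star \<omega> (L * s)"
        using assms(2) s L t by (intro le_phi_star[OF w]) auto
      with 1 have "L * (s * t - \<omega> (exp t) + s * ln A) \<le> phi_star \<omega> (L * s) + L'"
        by (simp add: algebra_simps)
      then show "s * t - \<omega> (exp t) \<le> (phi_star \<omega> (L * s) + L') / L - s * ln A"
        using L by (simp add: field_simps)
    qed
    then show ?thesis by simp
  qed
  show ?thesis
  proof (rule that[OF L(1)])
    fix \<rho> :: real assume \<rho>: "0 < \<rho>"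
    have "A ^ j * weight_seq \<omega> \<rho> j \<le> exp (L' / (L * \<rho>)) * weight_seq \<omega> (L * \<rho>) j" for j
    proof -
      have "(\<rho> * j * ln A + phi_star \<omega> (\<rho> * j)) / \<rho> \<le> (phi_star \<omega> (L * (\<rho> * j)) + L') / L / \<rho>"
        using \<rho> by (intro divide_right_mono key) auto
      moreover have "A ^ j = exp (j * ln A)" using assms(2) by (simp add: exp_of_nat_mult)
      ultimately show ?thesis
        using \<rho> L by (simp add: weight_seq_def add_divide_distrib mult_ac flip: exp_add)
    qed
    then show "\<exists>C\<ge>1. \<forall>j. A ^ j * weight_seq \<omega> \<rho> j \<le> C * weight_seq \<omega> (L * \<rho>) j"
      using \<rho> L by (intro exI[of _ "exp (L' / (L * \<rho>))"]) auto
  qed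
qed

text \<open>The left-hand side is the conjugate of \<open>c e\<^sup>t + c'\<close>, up to a constant: insert \<open>t = ln (s/c)\<close>, or \<open>t = 0\<close>
  when that logarithm is negative.\<close>

lemma phi_star_lower_bound:
  assumes w: "weight_function \<omega>" and c: "0 < c" "0 \<le> c'" and s: "0 < s"
    and le: "\<And>t. 0 \<le> t \<Longrightarrow> \<omega> t \<le> c * t + c'"
  shows "s * ln (s / c) - s - (c + c') \<le> phi_star \<omega> s"
proof (cases "c \<le> s")
  case True
  have "s * ln (s / c) - (c * exp (ln (s / c)) + c') \<le> s * ln (s / c) - \<omega> (exp (ln (s / c)))"
    by (intro diff_left_mono le) simp
  also have "\<dots> \<le> phi_star \<omega> s"
    using True c s by (intro le_phi_star[OF w]) auto
  finally show ?thesis using c s by simp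
next
  case False
  have "s * ln (s / c) \<le> 0" using False c s by (simp add: mult_le_0_iff ln_le_zero_iff)
  then have "s * ln (s / c) - s - (c + c') \<le> s * 0 - \<omega> (exp 0)"
    using le[of 1] s by simp
  also have "\<dots> \<le> phi_star \<omega> s" using s by (intro le_phi_star[OF w]) auto
  finally show ?thesis .
qed

lemma power_le_weight_seq:
  assumes w: "weight_function \<omega>" and c: "0 < c" "0 \<le> c'" and \<rho>: "0 < \<rho>"
    and le: "\<And>t. 0 \<le> t \<Longrightarrow> \<omega> t \<le> c * t + c'"
  shows "(\<rho> * m / (c * exp 1)) ^ m \<le> exp ((c + c') / \<rho>) * weight_seq \<omega> \<rho> m"
proof (cases "m = 0")
  case True
  have "- (c + c') \<le> 0 * 0 - \<omega> (exp 0)" using le[of 1] by simp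
  also have "\<dots> \<le> phi_star \<omega> 0" by (intro le_phi_star[OF w]) auto
  finally show ?thesis using True \<rho> by (simp add: weight_seq_def field_simps flip: exp_add)
next
  case False
  define x where "x = \<rho> * m / (c * exp 1)"
  have x: "0 < x" using False \<rho> c by (simp add: x_def)
  have "\<rho> * m * ln x = \<rho> * m * ln (\<rho> * m / c) - \<rho> * m"
    using False \<rho> c by (simp add: x_def ln_div ln_mult algebra_simps)
  also have "\<dots> \<le> phi_star \<omega> (\<rho> * m) + (c + c')"
    using phi_star_lower_bound[OF w c _ le, of "\<rho> * m"] False \<rho> by simp
  finally have "\<rho> * m * ln x / \<rho> \<le> (phi_star \<omega> (\<rho> * m) + (c + c')) / \<rho>"
    using \<rho> by (intro divide_right_mono) auto
  moreover have "x ^ m = exp (m * ln x)" using x by (simp add: exp_of_nat_mult)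
  ultimately show ?thesis
    unfolding x_def[symmetric] using \<rho> by (simp add: weight_seq_def add_divide_distrib algebra_simps flip: exp_add)
qed

text \<open>If \<open>\<omega>\<close> grows at most linearly, then the weights grow at least like \<open>m\<^sup>m\<close> up to a geometric factor.
  Since the weights are supermultiplicative, the quotient of the weights at \<open>b\<close> and at \<open>a\<close> is at least as large
  as the weight at \<open>b - a\<close>. The slope \<open>c\<close> determines the factor \<open>A\<close>: a small slope allows \<open>A = 1\<close>.\<close>

lemma weight_seq_gap:
  assumes w: "weight_function \<omega>" and c: "0 < c" "0 \<le> c'" and \<rho>: "0 < \<rho>" and \<delta>: "0 < \<delta>"
    and le: "\<And>t. 0 \<le> t \<Longrightarrow> \<omega> t \<le> c * t + c'"
    and A: "c * exp 1 / (\<rho> * \<delta>) \<le> A" and ab: "a \<le> b"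
  shows "weight_seq \<omega> \<rho> a * (real (b - a) / \<delta>) ^ (b - a)
    \<le> exp ((c + c') / \<rho>) * A ^ (b - a) * weight_seq \<omega> \<rho> b"
proof -
  define m where "m = b - a"
  have "0 \<le> c * exp 1 / (\<rho> * \<delta>)" using c \<rho> \<delta> by simp
  then have A0: "0 \<le> A" using A by linarith
  have "(real m / \<delta>) ^ m = (c * exp 1 / (\<rho> * \<delta>)) ^ m * (\<rho> * m / (c * exp 1)) ^ m"
    using c \<rho> by (simp flip: power_mult_distrib)
  also have "\<dots> \<le> A ^ m * (exp ((c + c') / \<rho>) * weight_seq \<omega> \<rho> m)"
    using c \<rho> \<delta> A
    by (intro mult_mono power_mono power_le_weight_seq[OF w c \<rho> le]) (auto simp: A0)
  finally have "weight_seq \<omega> \<rho> a * (real m / \<delta>) ^ m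
      \<le> weight_seq \<omega> \<rho> a * (A ^ m * (exp ((c + c') / \<rho>) * weight_seq \<omega> \<rho> m))"
    by (intro mult_left_mono less_imp_le[OF weight_seq_pos])
  also have "\<dots> = exp ((c + c') / \<rho>) * A ^ m * (weight_seq \<omega> \<rho> a * weight_seq \<omega> \<rho> m)"
    by (simp add: mult_ac)
  also have "\<dots> \<le> exp ((c + c') / \<rho>) * A ^ m * weight_seq \<omega> \<rho> (a + m)"
    using A0 by (intro mult_left_mono weight_seq_mult_le[OF w \<rho>]) auto
  finally show ?thesis using ab by (simp add: m_def)
qed

lemma bound_from_eventually_le_linear:
  assumes w: "weight_function \<omega>" and "eventually (\<lambda>t. \<bar>\<omega> t\<bar> \<le> c * \<bar>t\<bar>) at_top" and "0 < c"
  obtains c' where "0 \<le> c'" "\<And>t. 0 \<le> t \<Longrightarrow> \<omega> t \<le> c * t + c'"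
proof -
  have mono: "\<omega> x \<le> \<omega> y" if "0 \<le> x" "x \<le> y" for x y
    using w that by (auto simp: weight_function_def mono_on_def)
  obtain T where T: "\<And>t. T \<le> t \<Longrightarrow> \<bar>\<omega> t\<bar> \<le> c * \<bar>t\<bar>"
    using assms(2) by (auto simp: eventually_at_top_linorder)
  show ?thesis
  proof (rule that[of "\<omega> \<bar>T\<bar>"])
    show nonneg: "0 \<le> \<omega> \<bar>T\<bar>" using w by (simp add: weight_function_def)
    show "\<omega> t \<le> c * t + \<omega> \<bar>T\<bar>" if t: "0 \<le> t" for t
    proof (cases "T \<le> t")
      case True
      then show ?thesis using T[OF True] t nonneg by simp
    next
      case False
      then have "\<omega> t \<le> \<omega> \<bar>T\<bar>" using t by (intro mono) auto
      then show ?thesis using t \<open>0 < c\<close> by (simp add: add_increasing)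
    qed
  qed
qed

lemma special_base_seq_bracket:
  assumes "special_base_seq k"
  obtains B :: real where "1 \<le> B"
    "\<And>s. 1 \<le> s \<Longrightarrow> \<exists>a\<in>range k. \<exists>b\<in>range k. a \<le> s \<and> s \<le> b \<and> a < b \<and> real b \<le> B * real s"
proof -
  have k: "strict_mono k" "k 0 = 0" and "\<exists>B. \<forall>j\<ge>1. real (k (Suc j)) / real (k j) \<le> B"
    using assms by (auto simp: special_base_seq_def base_seq_def)
  then obtain B where B: "\<And>j. 1 \<le> j \<Longrightarrow> real (k (Suc j)) / real (k j) \<le> B" by blast
  define B' where "B' = Max {1, B, real (k 1)}"
  have B': "1 \<le> B'" "B \<le> B'" "real (k 1) \<le> B'" by (auto simp: B'_def)
  show ?thesis
  proof (rule that[OF B'(1)])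
    fix s :: nat assume s: "1 \<le> s"
    define j where "j = (GREATEST j. k j \<le> s)"
    have bound: "\<And>i. k i \<le> s \<Longrightarrow> i \<le> s"
      using strict_mono_imp_increasing[OF k(1)] order.trans by blast
    have "k j \<le> s" unfolding j_def by (rule GreatestI_nat[of _ 0 s]) (use k bound in auto)
    moreover have "s < k (Suc j)"
      using Greatest_le_nat[of "\<lambda>j. k j \<le> s" "Suc j" s] bound unfolding j_def
      by (metis Suc_n_not_le_n not_le)
    moreover have "real (k (Suc j)) \<le> B' * real s"
    proof (cases "j = 0")
      case True
      have "real (k 1) * 1 \<le> B' * real s" using B' s by (intro mult_mono) auto
      then show ?thesis using True by simp
    next
      case False
      then have "0 < k j" using strict_monoD[OF k(1), of 0 j] k(2) by simp
      then have "real (k (Suc j)) \<le> B * real (k j)" using B[of j] False by (simp add: field_simps)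
      also have "\<dots> \<le> B' * real s" using B' \<open>k j \<le> s\<close> by (intro mult_mono) auto
      finally show ?thesis .
    qed
    ultimately show "\<exists>a\<in>range k. \<exists>b\<in>range k. a \<le> s \<and> s \<le> b \<and> a < b \<and> real b \<le> B' * real s"
      by (intro bexI[of _ "k j"] bexI[of _ "k (Suc j)"]) auto
  qed
qed

section \<open>Filling the gaps of a special base sequence\<close>

text \<open>For all pairs of orders \<open>a < b\<close> the optimal step size is admissible, after the weight at \<open>b\<close> has been
  enlarged by a constant and a geometric factor.\<close>

definition interpolates_weight ::
  "(real \<Rightarrow> real) \<Rightarrow> real \<Rightarrow> real \<Rightarrow> real \<Rightarrow> (real^'n::finite) set \<Rightarrow>
   (nat \<Rightarrow> (real^'n \<Rightarrow> complex) \<Rightarrow> real \<Rightarrow> bool) \<Rightarrow> bool" where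
  "interpolates_weight \<omega> \<rho> A C U bd \<longleftrightarrow>
     (\<forall>a b. a < b \<longrightarrow> (\<exists>\<delta>>0. interpolates U \<delta> bd \<and>
        weight_seq \<omega> \<rho> a * (real (b - a) / \<delta>) ^ (b - a) \<le> C * A ^ (b - a) * weight_seq \<omega> \<rho> b))"

text \<open>One step in the chain is spent per coordinate, so the conclusion is at level \<open>CARD('n)\<close>. A single \<open>K\<close>
  serves all functions and all constants \<open>C\<close>.\<close>

definition fills_gaps ::
  "(real \<Rightarrow> real) \<Rightarrow> nat set \<Rightarrow> real \<Rightarrow> real \<Rightarrow> real \<Rightarrow> (real^'n::finite) set \<Rightarrow>
   (nat \<Rightarrow> (real^'n \<Rightarrow> complex) \<Rightarrow> real \<Rightarrow> bool) \<Rightarrow> bool" where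
  "fills_gaps \<omega> J \<rho> \<sigma> K U bd \<longleftrightarrow>
     (\<forall>f C. 0 < C \<longrightarrow> smooth_on U f \<longrightarrow>
        (\<forall>\<alpha>. mi_abs \<alpha> \<in> J \<longrightarrow> bd 0 (mi_deriv \<alpha> f) (C * weight_seq \<omega> \<rho> (mi_abs \<alpha>))) \<longrightarrow>
        (\<forall>\<alpha>. bd CARD('n) (mi_deriv \<alpha> f) (K * C * weight_seq \<omega> \<sigma> (mi_abs \<alpha>))))"

lemma fills_gapsD:
  fixes U :: "(real^'n::finite) set"
  assumes "fills_gaps \<omega> J \<rho> \<sigma> K U bd" "0 < C" "smooth_on U f"
    "\<And>\<alpha>. mi_abs \<alpha> \<in> J \<Longrightarrow> bd 0 (mi_deriv \<alpha> f) (C * weight_seq \<omega> \<rho> (mi_abs \<alpha>))"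
  shows "bd CARD('n) (mi_deriv \<alpha> f) (K * C * weight_seq \<omega> \<sigma> (mi_abs \<alpha>))"
  using assms unfolding fills_gaps_def by blast

text \<open>Combines the interpolation of derivatives with that of the weights between neighbouring members of
  \<open>k\<close>. The order of the quantifiers matters: \<open>\<Lambda>\<close> may depend on the geometric factor \<open>A\<close>, but not on \<open>\<rho>\<close> or on the
  constant \<open>C'\<close>.\<close>

lemma special_base_seq_fills_gaps:
  assumes sp: "special_base_seq k" and w: "weight_function \<omega>" and A: "1 \<le> A"
  shows "\<exists>\<Lambda>\<ge>1. \<forall>\<rho>>0. \<forall>C'\<ge>1. \<exists>K\<ge>1. \<forall>(U :: (real^'n::finite) set) bd.
    interpolates_weight \<omega> \<rho> A C' U bd \<longrightarrow> fills_gaps \<omega> (range k) \<rho> (\<Lambda> * \<rho>) K U bd"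
proof -
  obtain B :: real where B: "1 \<le> B" and bracket:
    "\<And>s. 1 \<le> s \<Longrightarrow> \<exists>a\<in>range k. \<exists>b\<in>range k. a \<le> s \<and> s \<le> b \<and> a < b \<and> real b \<le> B * real s"
    by (rule special_base_seq_bracket[OF sp]) blast
  define N where "N = 8 * real CARD('n)"
  define A1 where "A1 = exp (N * B) * A"
  have N: "0 \<le> N" by (simp add: N_def)
  have A1: "1 \<le> A1" using mult_mono[of 1 "exp (N * B)" 1 A] A B N by (simp add: A1_def)
  obtain L where L: "1 \<le> L" and absorb:
    "\<And>\<rho>. 0 < \<rho> \<Longrightarrow> \<exists>C\<ge>1. \<forall>j. A1 ^ j * weight_seq \<omega> \<rho> j \<le> C * weight_seq \<omega> (L * \<rho>) j"
    by (rule weight_seq_absorb_geometric[OF w A1]) blast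
  have \<Lambda>: "1 \<le> L * B" using mult_mono[of 1 L 1 B] L B by simp
  show ?thesis
  proof (rule exI[of _ "L * B"], intro conjI allI impI \<Lambda>)
    fix \<rho> C' :: real
    assume \<rho>: "0 < \<rho>" and C': "1 \<le> C'"
    have "0 < B * \<rho>" using B \<rho> by simp
    from absorb[OF this] obtain D where D: "1 \<le> D"
      "\<And>j. A1 ^ j * weight_seq \<omega> (B * \<rho>) j \<le> D * weight_seq \<omega> (L * (B * \<rho>)) j" by blast
    define K where "K = 2 * C' * D"
    have K: "1 \<le> K" using mult_mono[of 1 C' 1 D] C' D by (simp add: K_def)
    show "\<exists>K\<ge>1. \<forall>(U :: (real^'n) set) bd.
      interpolates_weight \<omega> \<rho> A C' U bd \<longrightarrow> fills_gaps \<omega> (range k) \<rho> (L * B * \<rho>) K U bd"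
      unfolding interpolates_weight_def fills_gaps_def
    proof (intro exI[of _ K] conjI allI impI K)
      fix U :: "(real^'n) set" and bd f and C :: real and \<alpha> :: "'n \<Rightarrow> nat"
      assume C: "0 < C" and f: "smooth_on U f"
        and gap: "\<forall>a b. a < b \<longrightarrow> (\<exists>\<delta>>0. interpolates U \<delta> bd \<and>
         weight_seq \<omega> \<rho> a * (real (b - a) / \<delta>) ^ (b - a) \<le> C' * A ^ (b - a) * weight_seq \<omega> \<rho> b)"
        and bd: "\<forall>\<alpha>. mi_abs \<alpha> \<in> range k \<longrightarrow> bd 0 (mi_deriv \<alpha> f) (C * weight_seq \<omega> \<rho> (mi_abs \<alpha>))"
      define s where "s = mi_abs \<alpha>"
      note sm = smooth_on_mi_deriv[OF f]
      show "bd CARD('n) (mi_deriv \<alpha> f) (K * C * weight_seq \<omega> (L * B * \<rho>) (mi_abs \<alpha>))"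
      proof (cases "s = 0")
        case True
        obtain \<delta> where \<delta>: "interpolates U \<delta> bd" using gap[rule_format, of 0 1] by auto
        have "k 0 = 0" using sp by (simp add: special_base_seq_def base_seq_def)
        then have "0 \<in> range k" by (metis rangeI)
        then have "bd 0 (mi_deriv \<alpha> f) (C * weight_seq \<omega> \<rho> s)" using bd True s_def by metis
        then have "bd CARD('n) (mi_deriv \<alpha> f) (C * weight_seq \<omega> \<rho> s)"
          by (rule interpolates_level[OF \<delta> sm])
        moreover have "C * weight_seq \<omega> \<rho> s \<le> K * C * weight_seq \<omega> (L * B * \<rho>) s"
          using weight_seq_mono[OF w \<rho>, of "L * B * \<rho>" s] mult_right_mono[OF \<Lambda>, of \<rho>] \<rho> C K
            weight_seq_pos[of \<omega> \<rho> s] mult_right_mono[OF K, of C]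
          by (intro mult_mono) auto
        ultimately show ?thesis
          using interpolates_mono[OF \<delta> sm] unfolding s_def by blast
      next
        case False
        then have s1: "1 \<le> s" by simp
        obtain a b where ab: "a \<in> range k" "b \<in> range k" "a \<le> s" "s \<le> b" "a < b" "real b \<le> B * real s"
          using bracket[OF s1] by blast
        define m where "m = b - a"
        define \<theta> where "\<theta> = real (s - a) / real m"
        obtain \<delta> where \<delta>: "0 < \<delta>" "interpolates U \<delta> bd"
          "weight_seq \<omega> \<rho> a * (real m / \<delta>) ^ m \<le> C' * A ^ m * weight_seq \<omega> \<rho> b"
          using gap ab(5) unfolding m_def by blast
        \<comment> \<open>\<open>M1\<close> is larger than the given bound at \<open>b\<close>, so as to make the optimal step size admissible. The
          additional factor \<open>A\<^sup>m\<close> enters the result only with exponent \<open>\<theta>\<close>, hence as \<open>A\<^bsup>s-a\<^esup>\<close>.\<close>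
        define M0 where "M0 = C * weight_seq \<omega> \<rho> a"
        define M1 where "M1 = C * (C' * A ^ m * weight_seq \<omega> \<rho> b)"
        have m: "0 < m" using ab by (simp add: m_def)
        have \<theta>: "0 \<le> \<theta>" "\<theta> \<le> 1" using ab by (auto simp: \<theta>_def m_def)
        have M: "0 < M0" "0 < M1" using C C' A by (auto simp: M0_def M1_def weight_seq_pos)
        have res: "bd CARD('n) (mi_deriv \<alpha> f)
            (2 * exp (8 * real CARD('n) * real (b - a)) * (M0 powr (1 - \<theta>) * M1 powr \<theta>))"
        proof (rule interpolate_mi_deriv[OF \<delta>(2) f ab(5) M _ \<delta>(1)])
          show "M0 * (real (b - a) / \<delta>) ^ (b - a) \<le> M1"
            using mult_left_mono[OF \<delta>(3), of C] C by (simp add: M0_def M1_def m_def mult.assoc)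
          show "bd 0 (mi_deriv \<beta> f) M0" if "mi_abs \<beta> = a" for \<beta>
            using bd that ab(1) by (auto simp: M0_def)
          have "weight_seq \<omega> \<rho> b \<le> C' * A ^ m * weight_seq \<omega> \<rho> b"
            using mult_right_mono[OF mult_mono[OF C' one_le_power[OF A, of m]], of "weight_seq \<omega> \<rho> b"]
              weight_seq_pos[of \<omega> \<rho> b] C' by simp
          then have le: "C * weight_seq \<omega> \<rho> b \<le> M1"
            using C by (simp add: M1_def)
          show "bd 0 (mi_deriv \<beta> f) M1" if "mi_abs \<beta> = b" for \<beta>
            using bd that ab(2) interpolates_mono[OF \<delta>(2) sm _ le, of 0] by auto
        qed (use ab in \<open>auto simp: s_def \<theta>_def m_def\<close>)
        have "M0 powr (1 - \<theta>) * M1 powr \<theta>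
            = (C powr (1 - \<theta>) * C powr \<theta>) * C' powr \<theta> * (A ^ m) powr \<theta> *
              (weight_seq \<omega> \<rho> a powr (1 - \<theta>) * weight_seq \<omega> \<rho> b powr \<theta>)"
          by (simp add: M0_def M1_def powr_mult mult_ac)
        also have "C powr (1 - \<theta>) * C powr \<theta> = C" using C by (simp flip: powr_add)
        also have "(A ^ m) powr \<theta> = A ^ (s - a)"
          using A m by (simp add: \<theta>_def powr_powr flip: powr_realpow)
        also have "C * C' powr \<theta> * A ^ (s - a) *
              (weight_seq \<omega> \<rho> a powr (1 - \<theta>) * weight_seq \<omega> \<rho> b powr \<theta>)
            \<le> C * C' * A ^ s * weight_seq \<omega> (B * \<rho>) s"
          using C C' A \<theta> powr_mono[of \<theta> 1 C'] ab s1
          by (intro mult_mono weight_seq_interpolate[OF w \<rho> B]) (auto simp: \<theta>_def m_def power_increasing)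
        finally have prod: "M0 powr (1 - \<theta>) * M1 powr \<theta> \<le> C * C' * A ^ s * weight_seq \<omega> (B * \<rho>) s" .
        have "exp (8 * real CARD('n) * real (b - a)) \<le> exp (N * B * s)"
          using ab mult_left_mono[of "real (b - a)" "B * s" N] N by (simp add: N_def of_nat_diff mult.assoc)
        also have "\<dots> = exp (N * B) ^ s" by (simp add: exp_of_nat_mult mult.commute)
        finally have expN: "exp (8 * real CARD('n) * real (b - a)) \<le> exp (N * B) ^ s" .
        have "2 * exp (8 * real CARD('n) * real (b - a)) * (M0 powr (1 - \<theta>) * M1 powr \<theta>)
            \<le> 2 * exp (N * B) ^ s * (C * C' * A ^ s * weight_seq \<omega> (B * \<rho>) s)"
          by (rule mult_mono[OF mult_left_mono[OF expN] prod]) simp_all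
        also have "\<dots> = 2 * C * C' * (A1 ^ s * weight_seq \<omega> (B * \<rho>) s)"
          by (simp add: A1_def power_mult_distrib mult_ac)
        also have "\<dots> \<le> 2 * C * C' * (D * weight_seq \<omega> (L * (B * \<rho>)) s)"
          using D C C' by (intro mult_left_mono) auto
        also have "\<dots> = K * C * weight_seq \<omega> (L * B * \<rho>) s"
          by (simp add: K_def mult_ac)
        finally show ?thesis
          using interpolates_mono[OF \<delta>(2) sm res] unfolding s_def by blast
      qed
    qed
  qed
qed

lemma exists_step_size:
  fixes x y :: real
  assumes "0 < x" "0 < y" "1 \<le> m"
  shows "\<exists>\<delta>>0. x * (real m / \<delta>) ^ m \<le> y"
proof (intro exI conjI)
  let ?\<delta> = "real m * (x / y) powr (1 / m)"
  show "0 < ?\<delta>" using assms by simp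
  have "(real m / ?\<delta>) ^ m = 1 / ((x / y) powr (1 / m)) ^ m"
    using assms by (simp add: power_divide)
  also have "((x / y) powr (1 / m)) ^ m = x / y"
    using assms by (simp add: powr_powr flip: powr_realpow)
  finally show "x * (real m / ?\<delta>) ^ m \<le> y" using assms by simp
qed

lemma interpolates_weight_global:
  assumes "\<And>\<delta>. 0 < \<delta> \<Longrightarrow> interpolates U \<delta> bd"
  shows "interpolates_weight \<omega> \<rho> 1 1 U bd"
  unfolding interpolates_weight_def
proof (intro allI impI)
  fix a b :: nat assume "a < b"
  then have "1 \<le> b - a" by simp
  from exists_step_size[OF weight_seq_pos weight_seq_pos this] obtain \<delta> where "0 < \<delta>"
      "weight_seq \<omega> \<rho> a * (real (b - a) / \<delta>) ^ (b - a) \<le> weight_seq \<omega> \<rho> b" by blast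
  then show "\<exists>\<delta>>0. interpolates U \<delta> bd \<and>
      weight_seq \<omega> \<rho> a * (real (b - a) / \<delta>) ^ (b - a) \<le> 1 * 1 ^ (b - a) * weight_seq \<omega> \<rho> b"
    using assms by auto
qed

lemma special_base_seq_fills_gaps_global:
  assumes sp: "special_base_seq k" and w: "weight_function \<omega>"
  obtains \<Lambda> where "1 \<le> \<Lambda>"
    "\<And>\<rho>. 0 < \<rho> \<Longrightarrow> \<exists>K\<ge>1. \<forall>(U :: (real^'n::finite) set) bd.
      (\<forall>\<delta>>0. interpolates U \<delta> bd) \<longrightarrow> fills_gaps \<omega> (range k) \<rho> (\<Lambda> * \<rho>) K U bd"
proof -
  obtain \<Lambda> where \<Lambda>: "1 \<le> \<Lambda>" and gaps:
    "\<forall>\<rho>>0. \<forall>C'\<ge>1. \<exists>K\<ge>1. \<forall>(U :: (real^'n) set) bd.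
      interpolates_weight \<omega> \<rho> 1 C' U bd \<longrightarrow> fills_gaps \<omega> (range k) \<rho> (\<Lambda> * \<rho>) K U bd"
    using special_base_seq_fills_gaps[OF sp w order.refl] by blast
  have "\<exists>K\<ge>1. \<forall>(U :: (real^'n::finite) set) bd.
      (\<forall>\<delta>>0. interpolates U \<delta> bd) \<longrightarrow> fills_gaps \<omega> (range k) \<rho> (\<Lambda> * \<rho>) K U bd" if "0 < \<rho>" for \<rho>
    using gaps[rule_format, OF that order.refl] interpolates_weight_global by blast
  then show ?thesis using that \<Lambda> by blast
qed

section \<open>Global and local classes\<close>

lemma for_case_mono:
  assumes "for_case c P" "\<And>\<rho>. P \<rho> \<Longrightarrow> Q \<rho>"
  shows "for_case c Q"
  using assms by (cases c) (auto simp: for_case_def)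

text \<open>An implication that changes \<open>\<rho>\<close> by a constant factor carries over to both cases: read forwards for Roumieu, and
  starting from \<open>\<rho> / \<Lambda>\<close> for Beurling.\<close>

lemma for_case_transfer:
  assumes "0 < \<Lambda>" "\<And>\<rho>. 0 < \<rho> \<Longrightarrow> P \<rho> \<Longrightarrow> Q (\<Lambda> * \<rho>)" "for_case c P"
  shows "for_case c Q"
proof (cases c)
  case Roumieu
  then obtain \<rho> where "0 < \<rho>" "P \<rho>" using assms(3) by (auto simp: for_case_def)
  then show ?thesis
    using assms(1,2) Roumieu unfolding for_case_def by (auto intro!: exI[of _ "\<Lambda> * \<rho>"])
next
  case Beurling
  have "Q \<rho>" if "0 < \<rho>" for \<rho>
    using assms(2)[of "\<rho> / \<Lambda>"] assms(1,3) that Beurling by (simp add: for_case_def)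
  then show ?thesis using Beurling by (simp add: for_case_def)
qed

lemma B_class_eq:
  assumes p: "1 \<le> p" and sp: "special_base_seq k" and w: "weight_function \<omega>"
  shows "(B_class c p \<omega> (range k) :: (real^'n::finite \<Rightarrow> complex) set) = B_class c p \<omega> UNIV"
proof
  show "(B_class c p \<omega> UNIV :: (real^'n \<Rightarrow> complex) set) \<subseteq> B_class c p \<omega> (range k)"
    unfolding B_class_def
    by (rule subsetI, elim CollectE conjE, intro CollectI conjI, assumption, erule for_case_mono, blast)
  obtain \<Lambda> where \<Lambda>: "1 \<le> \<Lambda>" and gaps:
    "\<And>\<rho>. 0 < \<rho> \<Longrightarrow> \<exists>K\<ge>1. \<forall>(U :: (real^'n) set) bd.
      (\<forall>\<delta>>0. interpolates U \<delta> bd) \<longrightarrow> fills_gaps \<omega> (range k) \<rho> (\<Lambda> * \<rho>) K U bd"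
    by (rule special_base_seq_fills_gaps_global[OF sp w]) (rule that)
  let ?bd = "\<lambda>(r::nat) F M. 0 \<le> M \<and> Lp_norm p (UNIV :: (real^'n) set) F \<le> ennreal M"
  have interp: "interpolates (UNIV :: (real^'n) set) \<delta> ?bd" if "0 < \<delta>" for \<delta>
    using interpolates_Lp_norm[of p "\<lambda>_. UNIV :: (real^'n) set" UNIV \<delta>] p that by simp
  show "(B_class c p \<omega> (range k) :: (real^'n \<Rightarrow> complex) set) \<subseteq> B_class c p \<omega> UNIV"
    unfolding B_class_def
  proof (intro subsetI CollectI; elim CollectE conjE; intro conjI)
    fix f :: "real^'n \<Rightarrow> complex"
    assume f: "smooth_on UNIV f" and bound: "for_case c (\<lambda>\<rho>. \<exists>C>0. \<forall>\<alpha>. mi_abs \<alpha> \<in> range k \<longrightarrow>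
       Lp_norm p UNIV (mi_deriv \<alpha> f) \<le> ennreal (C * weight_seq \<omega> \<rho> (mi_abs \<alpha>)))"
    show "for_case c (\<lambda>\<rho>. \<exists>C>0. \<forall>\<alpha>. mi_abs \<alpha> \<in> UNIV \<longrightarrow>
       Lp_norm p UNIV (mi_deriv \<alpha> f) \<le> ennreal (C * weight_seq \<omega> \<rho> (mi_abs \<alpha>)))"
    proof (rule for_case_transfer[OF _ _ bound, of \<Lambda>])
      fix \<rho> :: real assume \<rho>: "0 < \<rho>"
      assume "\<exists>C>0. \<forall>\<alpha>. mi_abs \<alpha> \<in> range k \<longrightarrow>
         Lp_norm p UNIV (mi_deriv \<alpha> f) \<le> ennreal (C * weight_seq \<omega> \<rho> (mi_abs \<alpha>))"
      then obtain C where C: "0 < C" "\<And>\<alpha>. mi_abs \<alpha> \<in> range k \<Longrightarrow>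
         Lp_norm p UNIV (mi_deriv \<alpha> f) \<le> ennreal (C * weight_seq \<omega> \<rho> (mi_abs \<alpha>))" by blast
      obtain K where K: "1 \<le> K" and fill: "fills_gaps \<omega> (range k) \<rho> (\<Lambda> * \<rho>) K UNIV ?bd"
        using gaps[OF \<rho>] interp by blast
      have "?bd CARD('n) (mi_deriv \<alpha> f) (K * C * weight_seq \<omega> (\<Lambda> * \<rho>) (mi_abs \<alpha>))" for \<alpha>
        by (rule fills_gapsD[OF fill C(1) f]) (use C less_imp_le[OF weight_seq_pos] in simp)
      then show "\<exists>C>0. \<forall>\<alpha>. mi_abs \<alpha> \<in> UNIV \<longrightarrow>
         Lp_norm p UNIV (mi_deriv \<alpha> f) \<le> ennreal (C * weight_seq \<omega> (\<Lambda> * \<rho>) (mi_abs \<alpha>))"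
        using K C(1) by (intro exI[of _ "K * C"]) auto
    qed (use \<Lambda> in simp)
  qed
qed

lemma D_class_eq:
  assumes sp: "special_base_seq k" and w: "weight_function \<omega>"
  shows "(D_class c \<omega> (range k) :: (real^'n::finite \<Rightarrow> complex) set) = D_class c \<omega> UNIV"
  unfolding D_class_def by (simp add: B_class_eq[OF _ sp w])

text \<open>The \<open>r\<close>-th set consists of the points at distance less than \<open>(n + 1 - r) \<delta>\<close> from \<open>\<Omega>\<close> for
  \<open>r < n\<close>, then comes \<open>\<Omega>\<close> itself, and then the empty set.\<close>

lemma neighbourhood_chain:
  fixes \<Omega> :: "(real^'n::finite) set"
  assumes "open \<Omega>" "compact (closure \<Omega>)" "closure \<Omega> \<subseteq> U" "open U"
  obtains V :: "nat \<Rightarrow> (real^'n) set" and \<delta> :: real where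
    "0 < \<delta>" "\<And>r. open (V r)" "\<And>r. V r \<subseteq> U" "compact (closure (V 0))" "closure (V 0) \<subseteq> U"
    "V CARD('n) = \<Omega>"
    "\<And>r x i t. x \<in> V (Suc r) \<Longrightarrow> 0 \<le> t \<Longrightarrow> t \<le> \<delta> \<Longrightarrow> x + t *\<^sub>R axis i 1 \<in> V r"
proof -
  let ?n = "CARD('n)"
  obtain \<epsilon> where \<epsilon>: "0 < \<epsilon>" "(\<Union>x\<in>closure \<Omega>. cball x \<epsilon>) \<subseteq> U"
    using compact_subset_open_imp_cball_epsilon_subset[OF assms(2,4,3)] by blast
  define \<delta> where "\<delta> = \<epsilon> / (?n + 1)"
  define N where "N r = (\<Union>x\<in>\<Omega>. ball x ((?n + 1 - real r) * \<delta>))" for r :: nat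
  define V where "V r = (if r < ?n then N r else if r = ?n then \<Omega> else {})" for r
  have \<delta>: "0 < \<delta>" using \<epsilon> by (simp add: \<delta>_def add_pos_pos)
  have n0: "V 0 = N 0" by (simp add: V_def)
  define S where "S = (\<Union>x\<in>closure \<Omega>. \<Union>y\<in>cball 0 \<epsilon>. {x + y})"
  have S: "compact S" "S \<subseteq> U"
  proof -
    show "compact S" unfolding S_def by (rule compact_sums'[OF assms(2) compact_cball])
    have "x + y \<in> cball x \<epsilon>" if "y \<in> cball 0 \<epsilon>" for x y :: "real^'n"
      using that by (simp add: dist_norm)
    then show "S \<subseteq> U" unfolding S_def using \<epsilon>(2) by blast
  qed
  have NS: "N r \<subseteq> S" for r
  proof
    fix z assume "z \<in> N r"
    then obtain x where x: "x \<in> \<Omega>" "dist x z < (?n + 1 - real r) * \<delta>" by (auto simp: N_def)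
    have "(?n + 1 - real r) * \<delta> \<le> (?n + 1) * \<delta>" using \<delta> by simp
    also have "\<dots> = \<epsilon>" by (simp add: \<delta>_def field_simps add_pos_pos)
    finally have "z - x \<in> cball 0 \<epsilon>" using x by (simp add: dist_norm norm_minus_commute)
    moreover have "x \<in> closure \<Omega>" using x closure_subset by blast
    moreover have "z = x + (z - x)" by simp
    ultimately show "z \<in> S" unfolding S_def by blast
  qed
  have cl: "closure (V 0) \<subseteq> S"
    unfolding n0 using NS compact_imp_closed[OF S(1)] by (intro closure_minimal) auto
  show ?thesis
  proof (rule that[OF \<delta>])
    show "open (V r)" for r using assms(1) by (auto simp: V_def N_def)
    show "V r \<subseteq> U" for r
      using NS[of r] S(2) assms(3) closure_subset[of \<Omega>] unfolding V_def by (simp, blast)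
    show "compact (closure (V 0))"
      using cl S(1) by (meson bounded_subset closed_closure compact_eq_bounded_closed)
    show "closure (V 0) \<subseteq> U" using cl S(2) by blast
    show "V ?n = \<Omega>" by (simp add: V_def)
    fix r x i t assume x: "x \<in> V (Suc r)" and t: "0 \<le> t" "t \<le> \<delta>"
    have move: "dist x (x + t *\<^sub>R axis i 1) \<le> \<delta>" using t by (simp add: dist_norm)
    have r: "r < ?n" using x by (auto simp: V_def split: if_splits)
    have "x + t *\<^sub>R axis i 1 \<in> N r"
    proof (cases "Suc r = ?n")
      case True
      then have "x \<in> \<Omega>" using x by (simp add: V_def)
      moreover have "real ?n = real r + 1" using True by linarith
      ultimately show ?thesis
        using move \<delta> by (auto simp: N_def intro!: bexI[of _ x])
    next
      case False
      then obtain z where z: "z \<in> \<Omega>" "dist z x < (?n + 1 - real (Suc r)) * \<delta>"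
        using x r by (auto simp: V_def N_def)
      have "dist z (x + t *\<^sub>R axis i 1) \<le> dist z x + dist x (x + t *\<^sub>R axis i 1)"
        by (rule dist_triangle)
      also have "\<dots> < (?n + 1 - real r) * \<delta>" using z move by (simp add: algebra_simps)
      finally show ?thesis using z by (auto simp: N_def)
    qed
    then show "x + t *\<^sub>R axis i 1 \<in> V r" using r by (simp add: V_def)
  qed
qed

lemma E_class_eq:
  fixes U :: "(real^'n::finite) set"
  assumes p: "1 \<le> p" and sp: "special_base_seq k" and w: "weight_function \<omega>"
    and lin: "at_most_linear c \<omega>" and U: "open U"
  shows "E_class c p \<omega> (range k) U = E_class c p \<omega> UNIV U"
proof
  show "E_class c p \<omega> UNIV U \<subseteq> E_class c p \<omega> (range k) U"
    unfolding E_class_def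
    by (rule subsetI, elim CollectE conjE, intro CollectI conjI allI impI, assumption, drule spec, drule mp, assumption,
        erule for_case_mono, blast)
  show "E_class c p \<omega> (range k) U \<subseteq> E_class c p \<omega> UNIV U"
    unfolding E_class_def
  proof (intro subsetI CollectI; elim CollectE conjE; intro conjI allI impI; (elim conjE)?)
    fix f and \<Omega> :: "(real^'n) set"
    assume f: "smooth_on U f" and \<Omega>: "open \<Omega>" "compact (closure \<Omega>)" "closure \<Omega> \<subseteq> U"
      and bound: "\<forall>\<Omega>. open \<Omega> \<and> compact (closure \<Omega>) \<and> closure \<Omega> \<subseteq> U \<longrightarrow>
        for_case c (\<lambda>\<rho>. \<exists>C>0. \<forall>\<alpha>. mi_abs \<alpha> \<in> range k \<longrightarrow>
          Lp_norm p \<Omega> (mi_deriv \<alpha> f) \<le> ennreal (C * weight_seq \<omega> \<rho> (mi_abs \<alpha>)))"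
    obtain V :: "nat \<Rightarrow> (real^'n) set" and \<delta> where \<delta>: "0 < \<delta>"
      and V: "\<And>r. open (V r)" "\<And>r. V r \<subseteq> U" "compact (closure (V 0))" "closure (V 0) \<subseteq> U" "V CARD('n) = \<Omega>"
        "\<And>r x i t. x \<in> V (Suc r) \<Longrightarrow> 0 \<le> t \<Longrightarrow> t \<le> \<delta> \<Longrightarrow> x + t *\<^sub>R axis i 1 \<in> V r"
      by (rule neighbourhood_chain[OF \<Omega> U]) blast
    let ?bd = "\<lambda>r F M. 0 \<le> M \<and> Lp_norm p (V r) F \<le> ennreal M"
    let ?P = "\<lambda>\<Omega> K \<rho>. \<exists>C>0. \<forall>\<alpha>. mi_abs \<alpha> \<in> K \<longrightarrow>
          Lp_norm p \<Omega> (mi_deriv \<alpha> f) \<le> ennreal (C * weight_seq \<omega> \<rho> (mi_abs \<alpha>))"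
    have interp: "interpolates U \<delta> ?bd"
      by (rule interpolates_Lp_norm[OF p V(1,2) \<delta> V(6)])
    have V0: "for_case c (?P (V 0) (range k))"
      using bound V(1,3,4) by blast
    have step: "\<exists>\<Lambda>\<ge>1. \<forall>\<rho>>0. (\<exists>c>0. \<exists>c'\<ge>0. (\<forall>t\<ge>0. \<omega> t \<le> c * t + c') \<and> c * exp 1 / (\<rho> * \<delta>) \<le> A) \<longrightarrow>
        ?P (V 0) (range k) \<rho> \<longrightarrow> ?P \<Omega> UNIV (\<Lambda> * \<rho>)" if A: "1 \<le> A" for A
    proof -
      obtain \<Lambda> where \<Lambda>: "1 \<le> \<Lambda>" and gaps:
        "\<forall>\<rho>>0. \<forall>C'\<ge>1. \<exists>K\<ge>1. \<forall>(U :: (real^'n) set) bd.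
          interpolates_weight \<omega> \<rho> A C' U bd \<longrightarrow> fills_gaps \<omega> (range k) \<rho> (\<Lambda> * \<rho>) K U bd"
        using special_base_seq_fills_gaps[OF sp w A] by blast
      show ?thesis
      proof (rule exI[of _ \<Lambda>], intro conjI allI impI \<Lambda>, elim exE conjE)
        fix \<rho> q q' C :: real
        assume \<rho>: "0 < \<rho>" and q: "0 < q" "0 \<le> q'" and le: "\<forall>t\<ge>0. \<omega> t \<le> q * t + q'"
          and qA: "q * exp 1 / (\<rho> * \<delta>) \<le> A" and C: "0 < C"
          and CV: "\<forall>\<alpha>. mi_abs \<alpha> \<in> range k \<longrightarrow>
            Lp_norm p (V 0) (mi_deriv \<alpha> f) \<le> ennreal (C * weight_seq \<omega> \<rho> (mi_abs \<alpha>))"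
        define C' where "C' = exp ((q + q') / \<rho>)"
        have C': "1 \<le> C'" using q \<rho> by (simp add: C'_def)
        have "interpolates_weight \<omega> \<rho> A C' U ?bd"
          unfolding interpolates_weight_def
          using weight_seq_gap[OF w q \<rho> \<delta> _ qA] le \<delta> interp
          by (intro allI impI exI[of _ \<delta>]) (auto simp: C'_def)
        then obtain K where K: "1 \<le> K" and fill: "fills_gaps \<omega> (range k) \<rho> (\<Lambda> * \<rho>) K U ?bd"
          using gaps[rule_format, OF \<rho> C'] by blast
        have "?bd CARD('n) (mi_deriv \<alpha> f) (K * C * weight_seq \<omega> (\<Lambda> * \<rho>) (mi_abs \<alpha>))" for \<alpha>
          by (rule fills_gapsD[OF fill C f]) (use C CV less_imp_le[OF weight_seq_pos] in simp)
        then show "\<exists>C>0. \<forall>\<alpha>. mi_abs \<alpha> \<in> UNIV \<longrightarrow>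
            Lp_norm p \<Omega> (mi_deriv \<alpha> f) \<le> ennreal (C * weight_seq \<omega> (\<Lambda> * \<rho>) (mi_abs \<alpha>))"
          using K C V(5) by (intro exI[of _ "K * C"]) auto
      qed
    qed
    show "for_case c (?P \<Omega> UNIV)"
    proof (cases c)
      case Roumieu
      then obtain \<rho> where \<rho>: "0 < \<rho>" "?P (V 0) (range k) \<rho>" using V0 by (auto simp: for_case_def)
      have "\<omega> \<in> O[at_top](\<lambda>t. t)" using lin Roumieu by (simp add: at_most_linear_def)
      then obtain q where q: "0 < q" "eventually (\<lambda>t. norm (\<omega> t) \<le> q * norm t) at_top"
        by (rule landau_o.bigE)
      obtain q' where q': "0 \<le> q'" "\<And>t. 0 \<le> t \<Longrightarrow> \<omega> t \<le> q * t + q'"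
        using bound_from_eventually_le_linear[OF w _ q(1)] q(2) by auto
      \<comment> \<open>There is only one \<open>\<rho>\<close> to consider, so that \<open>A\<close>, and with it \<open>\<Lambda>\<close>, may depend on it.\<close>
      obtain \<Lambda> where "1 \<le> \<Lambda>" "?P \<Omega> UNIV (\<Lambda> * \<rho>)"
        using step[of "max 1 (q * exp 1 / (\<rho> * \<delta>))"] \<rho> q(1) q' by (metis max.cobounded1 max.cobounded2)
      moreover have "0 < \<Lambda> * \<rho>" using \<open>1 \<le> \<Lambda>\<close> \<rho>(1) by simp
      ultimately show ?thesis
        using Roumieu unfolding for_case_def by auto
    next
      case Beurling
      obtain \<Lambda> where \<Lambda>: "1 \<le> \<Lambda>" and "\<forall>\<rho>>0. (\<exists>c>0. \<exists>c'\<ge>0. (\<forall>t\<ge>0. \<omega> t \<le> c * t + c') \<and> c * exp 1 / (\<rho> * \<delta>) \<le> 1) \<longrightarrow>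
        ?P (V 0) (range k) \<rho> \<longrightarrow> ?P \<Omega> UNIV (\<Lambda> * \<rho>)" using step[of 1] by auto
      then have tr: "?P \<Omega> UNIV (\<Lambda> * \<rho>)" if "0 < \<rho>"
        "\<exists>c>0. \<exists>c'\<ge>0. (\<forall>t\<ge>0. \<omega> t \<le> c * t + c') \<and> c * exp 1 / (\<rho> * \<delta>) \<le> 1" "?P (V 0) (range k) \<rho>" for \<rho>
        using that by blast
      have "?P \<Omega> UNIV (\<Lambda> * \<rho>)" if \<rho>: "0 < \<rho>" "?P (V 0) (range k) \<rho>" for \<rho>
      proof (rule tr[OF \<rho>(1) _ \<rho>(2)])
        \<comment> \<open>The slope for which the factor \<open>A = 1\<close> is just large enough; then \<open>\<Lambda>\<close> is independent of \<open>\<rho>\<close>.\<close>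
        define q where "q = \<rho> * \<delta> / exp 1"
        have q: "0 < q" using \<rho> \<delta> by (simp add: q_def)
        have "\<omega> \<in> o[at_top](\<lambda>t. t)" using lin Beurling by (simp add: at_most_linear_def)
        then have "eventually (\<lambda>t. norm (\<omega> t) \<le> q * norm t) at_top" using q by (rule landau_o.smallD)
        then obtain q' where q': "0 \<le> q'" "\<And>t. 0 \<le> t \<Longrightarrow> \<omega> t \<le> q * t + q'"
          using bound_from_eventually_le_linear[OF w _ q] by auto
        have "q * exp 1 / (\<rho> * \<delta>) \<le> 1" using \<rho> \<delta> by (simp add: q_def)
        then show "\<exists>c>0. \<exists>c'\<ge>0. (\<forall>t\<ge>0. \<omega> t \<le> c * t + c') \<and> c * exp 1 / (\<rho> * \<delta>) \<le> 1"
          using q q' by blast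
      qed
      then show ?thesis
        using for_case_transfer[OF _ _ V0, of \<Lambda> "?P \<Omega> UNIV"] \<Lambda> by simp
    qed
  qed
qed

section \<open>Rapidly decreasing functions\<close>

lemma mi_deriv_0: "mi_deriv (\<lambda>_. 0) f = f"
proof -
  have "foldr (\<lambda>i. partial i ^^ 0) xs f = f" for xs by (induction xs) auto
  then show ?thesis by (simp add: mi_deriv_def)
qed

lemma monomial_0: "monomial (\<lambda>_. 0) x = 1"
  by (simp add: monomial_def)

lemma mi_abs_0 [simp]: "mi_abs (\<lambda>_. 0) = 0"
  by (simp add: mi_abs_def)

lemma mi_abs_eq_0_iff: "mi_abs \<alpha> = 0 \<longleftrightarrow> \<alpha> = (\<lambda>_. 0)"
  by (auto simp: mi_abs_def fun_eq_iff)

lemma monomial_single: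
  "monomial (\<lambda>j. if j = i then a else 0) x = (x $ i) ^ a" "mi_abs (\<lambda>j. if j = i then a else 0) = a"
proof -
  have "monomial (\<lambda>j. if j = i then a else 0) x = (\<Prod>j\<in>UNIV. if j = i then (x $ i) ^ a else 1)"
    unfolding monomial_def by (rule prod.cong) auto
  then show "monomial (\<lambda>j. if j = i then a else 0) x = (x $ i) ^ a" by simp
qed (simp add: mi_abs_def)

lemma abs_monomial_le:
  fixes x :: "real^'n::finite"
  assumes "\<And>j. \<bar>x $ j\<bar> \<le> X"
  shows "\<bar>monomial \<alpha> x\<bar> \<le> X ^ mi_abs \<alpha>"
proof -
  have "\<bar>monomial \<alpha> x\<bar> = (\<Prod>j\<in>UNIV. \<bar>x $ j\<bar> ^ \<alpha> j)"
    by (simp add: monomial_def abs_prod power_abs)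
  also have "\<dots> \<le> (\<Prod>j\<in>UNIV. X ^ \<alpha> j)"
    using assms by (intro prod_mono) (auto intro: power_mono)
  finally show ?thesis by (simp add: mi_abs_def power_sum)
qed

lemma exists_largest_component:
  fixes x :: "real^'n::finite"
  shows "\<exists>i. \<forall>j. \<bar>x $ j\<bar> \<le> \<bar>x $ i\<bar>"
proof -
  have "Max (range (\<lambda>j. \<bar>x $ j\<bar>)) \<in> range (\<lambda>j. \<bar>x $ j\<bar>)" by (rule Max_in) auto
  then obtain i where i: "Max (range (\<lambda>j. \<bar>x $ j\<bar>)) = \<bar>x $ i\<bar>" by (rule imageE)
  have "\<bar>x $ j\<bar> \<le> \<bar>x $ i\<bar>" for j unfolding i[symmetric] by (rule Max_ge) auto
  then show ?thesis by blast
qed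

lemma power_interpolation:
  fixes t g :: real
  assumes "0 \<le> t" "0 \<le> g" and ab: "a \<le> s" "s \<le> b" "a < b" "1 \<le> s"
    and le: "t ^ a * g \<le> P" "t ^ b * g \<le> Q" and \<theta>: "\<theta> = real (s - a) / real (b - a)"
  shows "t ^ s * g \<le> P powr (1 - \<theta>) * Q powr \<theta>"
proof (cases "t = 0 \<or> g = 0")
  case True
  then have "t ^ s * g = 0" using ab by auto
  also have "0 \<le> P powr (1 - \<theta>) * Q powr \<theta>" by simp
  finally show ?thesis .
next
  case False
  then have tg: "0 < t" "0 < g" using assms by auto
  have \<theta>01: "0 \<le> \<theta>" "\<theta> \<le> 1" using ab by (auto simp: \<theta>)
  have "real a * (1 - \<theta>) + real b * \<theta> = real s"
  proof -
    have "\<theta> * (real b - real a) = real s - real a"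
      using ab by (simp add: \<theta> of_nat_diff)
    then show ?thesis by (simp add: algebra_simps)
  qed
  then have "t ^ s * g = t powr (a * (1 - \<theta>) + b * \<theta>) * g powr ((1 - \<theta>) + \<theta>)"
    using tg by (simp add: powr_realpow)
  also have "\<dots> = (t powr a) powr (1 - \<theta>) * (t powr b) powr \<theta> * (g powr (1 - \<theta>) * g powr \<theta>)"
    by (simp only: powr_add powr_powr)
  also have "\<dots> = (t ^ a * g) powr (1 - \<theta>) * (t ^ b * g) powr \<theta>"
    using tg by (simp add: powr_mult powr_realpow mult_ac)
  also have "\<dots> \<le> P powr (1 - \<theta>) * Q powr \<theta>"
    using le tg \<theta>01 by (intro mult_mono powr_mono2) auto
  finally show ?thesis .
qed

text \<open>The counterpart for powers of the variable of filling gaps between orders of derivatives; here the interpolation is an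
  identity between powers.\<close>

lemma special_base_seq_decay:
  assumes sp: "special_base_seq k" and w: "weight_function \<omega>"
  shows "\<exists>B\<ge>1. \<forall>\<rho> C t g. 0 < \<rho> \<longrightarrow> 0 < C \<longrightarrow> 0 \<le> t \<longrightarrow> 0 \<le> g \<longrightarrow>
      (\<forall>j. t ^ k j * g \<le> C * weight_seq \<omega> \<rho> (k j)) \<longrightarrow> (\<forall>s. t ^ s * g \<le> C * weight_seq \<omega> (B * \<rho>) s)"
proof -
  obtain B :: real where B: "1 \<le> B" and bracket:
    "\<And>s. 1 \<le> s \<Longrightarrow> \<exists>a\<in>range k. \<exists>b\<in>range k. a \<le> s \<and> s \<le> b \<and> a < b \<and> real b \<le> B * real s"
    by (rule special_base_seq_bracket[OF sp]) blast
  show ?thesis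
  proof (intro exI[of _ B] conjI allI impI B)
    fix \<rho> C t g :: real and s :: nat
    assume \<rho>: "0 < \<rho>" and C: "0 < C" and t: "0 \<le> t" and g: "0 \<le> g"
      and le: "\<forall>j. t ^ k j * g \<le> C * weight_seq \<omega> \<rho> (k j)"
    show "t ^ s * g \<le> C * weight_seq \<omega> (B * \<rho>) s"
    proof (cases "s = 0")
      case True
      have "k 0 = 0" using sp by (simp add: special_base_seq_def base_seq_def)
      then have "t ^ s * g \<le> C * weight_seq \<omega> \<rho> s" using le[rule_format, of 0] True by simp
      also have "\<dots> \<le> C * weight_seq \<omega> (B * \<rho>) s"
        using C \<rho> mult_right_mono[OF B, of \<rho>] by (intro mult_left_mono weight_seq_mono[OF w \<rho>]) auto
      finally show ?thesis .
    next
      case False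
      then have s1: "1 \<le> s" by simp
      obtain a b where ab: "a \<in> range k" "b \<in> range k" "a \<le> s" "s \<le> b" "a < b" "real b \<le> B * real s"
        using bracket[OF s1] by blast
      define \<theta> where "\<theta> = real (s - a) / real (b - a)"
      have lea: "t ^ a * g \<le> C * weight_seq \<omega> \<rho> a" and leb: "t ^ b * g \<le> C * weight_seq \<omega> \<rho> b"
        using le ab(1,2) by auto
      have "t ^ s * g \<le> (C * weight_seq \<omega> \<rho> a) powr (1 - \<theta>) * (C * weight_seq \<omega> \<rho> b) powr \<theta>"
        by (rule power_interpolation[OF t g ab(3-5) s1 lea leb \<theta>_def])
      also have "\<dots> = (C powr (1 - \<theta>) * C powr \<theta>) *
          (weight_seq \<omega> \<rho> a powr (1 - \<theta>) * weight_seq \<omega> \<rho> b powr \<theta>)"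
        by (simp add: powr_mult mult_ac)
      also have "C powr (1 - \<theta>) * C powr \<theta> = C" using C by (simp flip: powr_add)
      also have "C * (weight_seq \<omega> \<rho> a powr (1 - \<theta>) * weight_seq \<omega> \<rho> b powr \<theta>) \<le> C * weight_seq \<omega> (B * \<rho>) s"
        using C by (intro mult_left_mono weight_seq_interpolate[OF w \<rho> B ab(3-5) s1 ab(6) \<theta>_def]) auto
      finally show ?thesis .
    qed
  qed
qed

text \<open>Interpolation between the orders \<open>0\<close> and \<open>2|\<beta>|\<close> on a half-space on which the \<open>i\<close>-th coordinate is at least
  \<open>X\<close> in absolute value. There \<open>f\<close> is bounded by the decay estimate of order \<open>2|\<alpha>|\<close>, and interpolation with
  exponent \<open>1/2\<close> turns the squares of the weights into the weights themselves.\<close>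

lemma decay_times_derivative:
  fixes f :: "real^'n::finite \<Rightarrow> complex"
  assumes f: "smooth_on UNIV f" and C: "0 < C" and \<mu>: "0 < \<mu>"
    and deriv: "\<And>\<beta> x. norm (mi_deriv \<beta> f x) \<le> C * weight_seq \<omega> \<mu> (mi_abs \<beta>)"
    and decay: "\<And>i s x. \<bar>x $ i\<bar> ^ s * norm (f x) \<le> C * weight_seq \<omega> \<mu> s"
    and j: "1 \<le> mi_abs \<beta>"
  shows "\<bar>monomial \<alpha> x\<bar> * norm (mi_deriv \<beta> f x) \<le>
    2 * C * (exp (16 * real CARD('n)) ^ mi_abs \<beta> *
      (weight_seq \<omega> (2 * \<mu>) (mi_abs \<alpha>) * weight_seq \<omega> (2 * \<mu>) (mi_abs \<beta>)))"
proof -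
  obtain i where i: "\<And>j. \<bar>x $ j\<bar> \<le> \<bar>x $ i\<bar>"
    using exists_largest_component by blast
  define X where "X = \<bar>x $ i\<bar>"
  define a where "a = mi_abs \<alpha>"
  define b where "b = mi_abs \<beta>"
  define W where "W = weight_seq \<omega> (2 * \<mu>)"
  have W: "0 < W s" for s by (simp add: W_def weight_seq_pos)
  have mono: "\<bar>monomial \<alpha> x\<bar> \<le> X ^ a"
    unfolding X_def a_def by (rule abs_monomial_le[OF i])
  show ?thesis
  proof (cases "X ^ a = 0")
    case True
    then have "\<bar>monomial \<alpha> x\<bar> = 0" using mono True abs_ge_zero[of "monomial \<alpha> x"] by linarith
    then show ?thesis using C W by (simp add: W_def less_imp_le)
  next
    case False
    have X: "0 \<le> X" by (simp add: X_def)
    have Xa: "0 < X ^ a" using False zero_le_power[OF X, of a] by linarith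
    \<comment> \<open>Moving in the directions \<open>s e\<^sub>j\<close> never leaves the half-space \<open>Q\<close>, which has \<open>x\<close> on its boundary.\<close>
    define s :: real where "s = (if 0 \<le> x $ i then 1 else - 1)"
    define Q where "Q = {y. X \<le> s * (y $ i)}"
    have s: "\<bar>s\<bar> = 1" "s * s = 1" "s * (x $ i) = X" by (auto simp: s_def X_def)
    have interp: "interpolates UNIV \<delta> (\<lambda>_ F M. \<forall>y\<in>Q. norm (F y) \<le> M)" if "0 < \<delta>" for \<delta>
    proof (rule interpolates_sup_norm[of "\<lambda>_. Q" UNIV "\<lambda>_. s"])
      fix y j and t :: real assume y: "y \<in> Q" and t: "0 \<le> t"
      have "s * ((y + t *\<^sub>R (s *\<^sub>R axis j 1)) $ i) = s * (y $ i) + (if i = j then t else 0)"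
        using s(2) by (simp add: axis_def algebra_simps)
      also have "X \<le> \<dots>" using y t by (simp add: Q_def add_increasing2)
      finally show "y + t *\<^sub>R (s *\<^sub>R axis j 1) \<in> Q" by (simp only: Q_def mem_Collect_eq)
    qed (use s that in auto)
    define M0 where "M0 = C * (W a ^ 2) / (X ^ a) ^ 2"
    define M1 where "M1 = C * (W b ^ 2)"
    have M: "0 < M0" "0 < M1"
      unfolding M0_def M1_def by (intro mult_pos_pos divide_pos_pos zero_less_power C W Xa)+
    have b: "0 < 2 * b" using j by (simp add: b_def)
    obtain \<delta> where \<delta>: "0 < \<delta>" "M0 * (real (2 * b - 0) / \<delta>) ^ (2 * b - 0) \<le> M1"
      using exists_step_size[OF M, of "2 * b"] b by auto
    have "norm (mi_deriv \<beta> f y) \<le>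
        2 * exp (8 * real CARD('n) * real (2 * b - 0)) * (M0 powr (1 - 1 / 2) * M1 powr (1 / 2))"
      if "y \<in> Q" for y
    proof -
      have "\<forall>y\<in>Q. norm (mi_deriv \<beta> f y) \<le>
        2 * exp (8 * real CARD('n) * real (2 * b - 0)) * (M0 powr (1 - 1 / 2) * M1 powr (1 / 2))"
      proof (rule interpolate_mi_deriv[OF interp[OF \<delta>(1)] f b M \<delta>(2,1)])
        show "\<forall>y\<in>Q. norm (mi_deriv \<gamma> f y) \<le> M0" if "mi_abs \<gamma> = 0" for \<gamma> :: "'n \<Rightarrow> nat"
        proof
          fix y assume "y \<in> Q"
          then have "X \<le> \<bar>y $ i\<bar>" using s(1) by (auto simp: Q_def s_def split: if_splits)
          then have "X ^ (2 * a) * norm (f y) \<le> \<bar>y $ i\<bar> ^ (2 * a) * norm (f y)"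
            using X by (intro mult_right_mono power_mono) auto
          also have "\<dots> \<le> C * W a ^ 2" using decay[of y i "2 * a"] by (simp add: W_def weight_seq_double)
          finally have "norm (f y) * (X ^ a) ^ 2 \<le> C * W a ^ 2"
            by (simp add: mult.commute flip: power_mult)
          then have "norm (f y) \<le> M0"
            unfolding M0_def by (subst pos_le_divide_eq[OF zero_less_power[OF Xa]])
          then show "norm (mi_deriv \<gamma> f y) \<le> M0"
            using that by (simp add: mi_abs_eq_0_iff mi_deriv_0)
        qed
        show "\<forall>y\<in>Q. norm (mi_deriv \<gamma> f y) \<le> M1" if "mi_abs \<gamma> = 2 * b" for \<gamma> :: "'n \<Rightarrow> nat"
          using deriv[of \<gamma>] that by (auto simp: M1_def W_def weight_seq_double)
      qed (use j in \<open>auto simp: b_def\<close>)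
      then show ?thesis using that by blast
    qed
    moreover have "x \<in> Q" using s by (simp add: Q_def)
    moreover have "M0 powr (1 - 1 / 2) * M1 powr (1 / 2) = C * (W a * W b) / X ^ a"
    proof -
      have "M0 powr (1 - 1 / 2) * M1 powr (1 / 2) = sqrt (M0 * M1)"
        using M by (simp add: powr_half_sqrt real_sqrt_mult)
      also have "M0 * M1 = (C * (W a * W b) / X ^ a) ^ 2"
        by (simp add: M0_def M1_def power2_eq_square)
      finally show ?thesis using C W Xa by (simp add: less_imp_le)
    qed
    moreover have "exp (8 * real CARD('n) * real (2 * b - 0)) = exp (16 * real CARD('n)) ^ b"
      by (simp flip: exp_of_nat_mult)
    ultimately have d: "norm (mi_deriv \<beta> f x) \<le> 2 * exp (16 * real CARD('n)) ^ b * (C * (W a * W b) / X ^ a)"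
      by metis
    have "\<bar>monomial \<alpha> x\<bar> * norm (mi_deriv \<beta> f x)
        \<le> X ^ a * (2 * exp (16 * real CARD('n)) ^ b * (C * (W a * W b) / X ^ a))"
      using mono d Xa by (intro mult_mono) auto
    also have "\<dots> = 2 * C * (exp (16 * real CARD('n)) ^ b * (W a * W b))"
    proof -
      have "Y * (2 * e * (C * v / Y)) = 2 * C * (e * v)" if "0 < Y" for Y e v :: real
        using that by simp
      from this[OF Xa] show ?thesis .
    qed
    finally show ?thesis by (simp add: a_def b_def W_def)
  qed
qed

lemma S_class_sub_subset:
  assumes k: "special_base_seq k" and l: "special_base_seq l" and w: "weight_function \<omega>"
  shows "(S_class_sub c \<omega> k l :: (real^'n::finite \<Rightarrow> complex) set) \<subseteq> S_class c \<omega>"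
proof -
  obtain \<Lambda> where \<Lambda>: "1 \<le> \<Lambda>" and gaps:
    "\<And>\<rho>. 0 < \<rho> \<Longrightarrow> \<exists>K\<ge>1. \<forall>(U :: (real^'n) set) bd.
      (\<forall>\<delta>>0. interpolates U \<delta> bd) \<longrightarrow> fills_gaps \<omega> (range l) \<rho> (\<Lambda> * \<rho>) K U bd"
    by (rule special_base_seq_fills_gaps_global[OF l w]) (rule that)
  obtain B where B: "1 \<le> B" and decay:
    "\<forall>\<rho> C t g. 0 < \<rho> \<longrightarrow> 0 < C \<longrightarrow> 0 \<le> t \<longrightarrow> 0 \<le> g \<longrightarrow>
      (\<forall>j. t ^ k j * g \<le> C * weight_seq \<omega> \<rho> (k j)) \<longrightarrow> (\<forall>s. t ^ s * g \<le> C * weight_seq \<omega> (B * \<rho>) s)"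
    using special_base_seq_decay[OF k w] by blast
  have "1 \<le> exp (16 * real CARD('n))" by simp
  then obtain L where L: "1 \<le> L" and absorb:
    "\<And>\<rho>. 0 < \<rho> \<Longrightarrow> \<exists>C\<ge>1. \<forall>j. exp (16 * real CARD('n)) ^ j * weight_seq \<omega> \<rho> j \<le> C * weight_seq \<omega> (L * \<rho>) j"
    by (rule weight_seq_absorb_geometric[OF w]) (rule that)
  define H where "H = L * (2 * (B + \<Lambda>))"
  have H: "0 < H" using L B \<Lambda> by (simp add: H_def)
  show ?thesis
    unfolding S_class_sub_def S_class_def
  proof (intro subsetI CollectI; elim CollectE conjE; intro conjI)
    fix f :: "real^'n \<Rightarrow> complex"
    assume f: "smooth_on UNIV f" and sub: "for_case c (\<lambda>\<rho>. \<exists>C>0. \<forall>j.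
       (\<forall>\<alpha> x. mi_abs \<alpha> = k j \<longrightarrow>
          norm (of_real (monomial \<alpha> x) * f x) \<le> C * weight_seq \<omega> \<rho> (k j)) \<and>
       (\<forall>\<beta> x. mi_abs \<beta> = l j \<longrightarrow> norm (mi_deriv \<beta> f x) \<le> C * weight_seq \<omega> \<rho> (l j)))"
    show "for_case c (\<lambda>\<rho>. bdd_above (range (\<lambda>(\<alpha>, \<beta>, x).
       norm (of_real (monomial \<alpha> x) * mi_deriv \<beta> f x) /
         (weight_seq \<omega> \<rho> (mi_abs \<alpha>) * weight_seq \<omega> \<rho> (mi_abs \<beta>)))))"
    proof (rule for_case_transfer[OF H _ sub])
      fix \<rho> :: real assume \<rho>: "0 < \<rho>"
      assume "\<exists>C>0. \<forall>j.
       (\<forall>\<alpha> x. mi_abs \<alpha> = k j \<longrightarrow>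
          norm (of_real (monomial \<alpha> x) * f x) \<le> C * weight_seq \<omega> \<rho> (k j)) \<and>
       (\<forall>\<beta> x. mi_abs \<beta> = l j \<longrightarrow> norm (mi_deriv \<beta> f x) \<le> C * weight_seq \<omega> \<rho> (l j))"
      then obtain C where C: "0 < C"
        and Ck: "\<And>j \<alpha> x. mi_abs \<alpha> = k j \<Longrightarrow>
          norm (of_real (monomial \<alpha> x) * f x) \<le> C * weight_seq \<omega> \<rho> (k j)"
        and Cl: "\<And>j \<beta> x. mi_abs \<beta> = l j \<Longrightarrow> norm (mi_deriv \<beta> f x) \<le> C * weight_seq \<omega> \<rho> (l j)"
        by blast
      define \<mu> where "\<mu> = (B + \<Lambda>) * \<rho>"
      have \<mu>: "0 < \<mu>" "B * \<rho> \<le> \<mu>" "\<Lambda> * \<rho> \<le> \<mu>" "0 < B * \<rho>" "0 < \<Lambda> * \<rho>"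
        using B \<Lambda> \<rho> by (auto simp: \<mu>_def algebra_simps add_pos_pos)
      let ?bd = "\<lambda>(r::nat) F M. \<forall>x\<in>(UNIV :: (real^'n) set). norm (F x :: complex) \<le> M"
      have interp: "interpolates UNIV \<delta> ?bd" if "0 < \<delta>" for \<delta>
        using interpolates_sup_norm[of "\<lambda>_. UNIV :: (real^'n) set" UNIV "\<lambda>_. 1" \<delta>] that by simp
      obtain K where K: "1 \<le> K" and fill: "fills_gaps \<omega> (range l) \<rho> (\<Lambda> * \<rho>) K UNIV ?bd"
        using gaps[OF \<rho>] interp by blast
      define C1 where "C1 = K * C"
      have C1: "0 < C1" "C \<le> C1" using K C by (auto simp: C1_def)
      have deriv: "norm (mi_deriv \<beta> f x) \<le> C1 * weight_seq \<omega> \<mu> (mi_abs \<beta>)" for \<beta> x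
      proof -
        have "?bd CARD('n) (mi_deriv \<beta> f) (K * C * weight_seq \<omega> (\<Lambda> * \<rho>) (mi_abs \<beta>))"
          by (rule fills_gapsD[OF fill C f]) (use Cl in auto)
        then have "norm (mi_deriv \<beta> f x) \<le> C1 * weight_seq \<omega> (\<Lambda> * \<rho>) (mi_abs \<beta>)"
          by (simp add: C1_def)
        also have "\<dots> \<le> C1 * weight_seq \<omega> \<mu> (mi_abs \<beta>)"
          using C1 \<mu> by (intro mult_left_mono weight_seq_mono[OF w]) auto
        finally show ?thesis .
      qed
      have dec: "\<bar>x $ i\<bar> ^ s * norm (f x) \<le> C1 * weight_seq \<omega> \<mu> s" for i s x
      proof -
        have "\<bar>x $ i\<bar> ^ s * norm (f x) \<le> C * weight_seq \<omega> (B * \<rho>) s"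
        proof (rule decay[rule_format, OF \<rho> C])
          show "\<bar>x $ i\<bar> ^ k j * norm (f x) \<le> C * weight_seq \<omega> \<rho> (k j)" for j
            using Ck[OF monomial_single(2)[of i "k j"], of x]
            by (simp add: monomial_single norm_mult norm_power power_abs)
        qed auto
        also have "\<dots> \<le> C1 * weight_seq \<omega> \<mu> s"
          using C1 C \<mu> by (intro mult_mono weight_seq_mono[OF w]) (auto simp: weight_seq_pos less_imp_le)
        finally show ?thesis .
      qed
      have "0 < 2 * \<mu>" using \<mu> by simp
      from absorb[OF this] obtain D where D: "1 \<le> D"
        "\<And>j. exp (16 * real CARD('n)) ^ j * weight_seq \<omega> (2 * \<mu>) j \<le> D * weight_seq \<omega> (L * (2 * \<mu>)) j"
        by blast
      define \<sigma> where "\<sigma> = H * \<rho>"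
      have \<sigma>: "\<sigma> = L * (2 * \<mu>)" by (simp add: \<sigma>_def H_def \<mu>_def mult_ac)
      have "2 * \<mu> \<le> \<sigma>" "\<mu> \<le> \<sigma>"
        using mult_right_mono[OF L, of "2 * \<mu>"] \<mu>(1) unfolding \<sigma> by linarith+
      then have mono: "weight_seq \<omega> (2 * \<mu>) s \<le> weight_seq \<omega> \<sigma> s" "weight_seq \<omega> \<mu> s \<le> weight_seq \<omega> \<sigma> s" for s
        using \<mu>(1) by (auto intro!: weight_seq_mono[OF w])
      have pos: "0 < weight_seq \<omega> \<sigma> s" for s by (rule weight_seq_pos)
      \<comment> \<open>The second entry serves \<open>\<beta> = 0\<close>, where the weight at \<open>0\<close> has to be compensated.\<close>
      define E where "E = max (2 * C1 * D) (C1 / weight_seq \<omega> \<sigma> 0)"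
      have main: "\<bar>monomial \<alpha> x\<bar> * norm (mi_deriv \<beta> f x)
          \<le> E * (weight_seq \<omega> \<sigma> (mi_abs \<alpha>) * weight_seq \<omega> \<sigma> (mi_abs \<beta>))" for \<alpha> \<beta> x
      proof (cases "mi_abs \<beta> = 0")
        case True
        obtain i where i: "\<And>j. \<bar>x $ j\<bar> \<le> \<bar>x $ i\<bar>"
          using exists_largest_component by blast
        have "\<bar>monomial \<alpha> x\<bar> * norm (mi_deriv \<beta> f x) \<le> \<bar>x $ i\<bar> ^ mi_abs \<alpha> * norm (f x)"
          using True abs_monomial_le[OF i, of \<alpha>]
          by (simp add: mi_abs_eq_0_iff mi_deriv_0 mult_right_mono)
        also have "\<dots> \<le> C1 * weight_seq \<omega> \<mu> (mi_abs \<alpha>)" by (rule dec)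
        also have "\<dots> \<le> C1 * weight_seq \<omega> \<sigma> (mi_abs \<alpha>)"
          using mono C1 by (intro mult_left_mono) auto
        also have "\<dots> = C1 / weight_seq \<omega> \<sigma> 0 * (weight_seq \<omega> \<sigma> (mi_abs \<alpha>) * weight_seq \<omega> \<sigma> 0)"
          using pos[of 0] by simp
        also have "\<dots> \<le> E * (weight_seq \<omega> \<sigma> (mi_abs \<alpha>) * weight_seq \<omega> \<sigma> 0)"
          using pos by (intro mult_right_mono) (auto simp: E_def less_imp_le)
        finally show ?thesis using True by simp
      next
        case False
        then have "1 \<le> mi_abs \<beta>" by simp
        from decay_times_derivative[OF f C1(1) \<mu>(1) deriv dec this, of \<alpha> x]
        have "\<bar>monomial \<alpha> x\<bar> * norm (mi_deriv \<beta> f x) \<le> 2 * C1 * (weight_seq \<omega> (2 * \<mu>) (mi_abs \<alpha>) *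
            (exp (16 * real CARD('n)) ^ mi_abs \<beta> * weight_seq \<omega> (2 * \<mu>) (mi_abs \<beta>)))"
          by (simp add: mult_ac)
        also have "\<dots> \<le> 2 * C1 * (weight_seq \<omega> \<sigma> (mi_abs \<alpha>) * (D * weight_seq \<omega> \<sigma> (mi_abs \<beta>)))"
          using D(2)[of "mi_abs \<beta>"] C1 mono(1)[of "mi_abs \<alpha>"] pos[of "mi_abs \<alpha>"] weight_seq_pos[of \<omega> "2 * \<mu>" "mi_abs \<beta>"]
          unfolding \<sigma>[symmetric] by (intro mult_left_mono mult_mono[of "weight_seq \<omega> (2 * \<mu>) (mi_abs \<alpha>)"]) auto
        also have "\<dots> = 2 * C1 * D * (weight_seq \<omega> \<sigma> (mi_abs \<alpha>) * weight_seq \<omega> \<sigma> (mi_abs \<beta>))"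
          by (simp add: mult_ac)
        also have "\<dots> \<le> E * (weight_seq \<omega> \<sigma> (mi_abs \<alpha>) * weight_seq \<omega> \<sigma> (mi_abs \<beta>))"
          using pos by (intro mult_right_mono) (auto simp: E_def less_imp_le)
        finally show ?thesis .
      qed
      show "bdd_above (range (\<lambda>(\<alpha>, \<beta>, x).
       norm (of_real (monomial \<alpha> x) * mi_deriv \<beta> f x) /
         (weight_seq \<omega> (H * \<rho>) (mi_abs \<alpha>) * weight_seq \<omega> (H * \<rho>) (mi_abs \<beta>))))"
      proof (rule bdd_aboveI2, clarify)
        fix \<alpha> \<beta> x
        show "norm (of_real (monomial \<alpha> x) * mi_deriv \<beta> f x) /
         (weight_seq \<omega> (H * \<rho>) (mi_abs \<alpha>) * weight_seq \<omega> (H * \<rho>) (mi_abs \<beta>)) \<le> E"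
          using main[of \<alpha> x \<beta>] pos unfolding \<sigma>_def[symmetric]
          by (subst pos_divide_le_eq) (auto simp: norm_mult)
      qed
    qed
  qed
qed

lemma S_class_subset:
  "(S_class c \<omega> :: (real^'n::finite \<Rightarrow> complex) set) \<subseteq> S_class_sub c \<omega> k l"
  unfolding S_class_sub_def S_class_def
proof (intro subsetI CollectI; elim CollectE conjE; intro conjI)
  fix f :: "real^'n \<Rightarrow> complex"
  assume full: "for_case c (\<lambda>\<rho>. bdd_above (range (\<lambda>(\<alpha>, \<beta>, x).
       norm (of_real (monomial \<alpha> x) * mi_deriv \<beta> f x) /
         (weight_seq \<omega> \<rho> (mi_abs \<alpha>) * weight_seq \<omega> \<rho> (mi_abs \<beta>)))))"
  show "for_case c (\<lambda>\<rho>. \<exists>C>0. \<forall>j.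
       (\<forall>\<alpha> x. mi_abs \<alpha> = k j \<longrightarrow>
          norm (of_real (monomial \<alpha> x) * f x) \<le> C * weight_seq \<omega> \<rho> (k j)) \<and>
       (\<forall>\<beta> x. mi_abs \<beta> = l j \<longrightarrow> norm (mi_deriv \<beta> f x) \<le> C * weight_seq \<omega> \<rho> (l j)))"
  proof (rule for_case_mono[OF full])
    fix \<rho> :: real
    let ?W = "weight_seq \<omega> \<rho>"
    assume "bdd_above (range (\<lambda>(\<alpha>, \<beta>, x).
       norm (of_real (monomial \<alpha> x) * mi_deriv \<beta> f x) / (?W (mi_abs \<alpha>) * ?W (mi_abs \<beta>))))"
    then obtain M where "\<forall>y\<in>range (\<lambda>(\<alpha>, \<beta>, x).
       norm (of_real (monomial \<alpha> x) * mi_deriv \<beta> f x) / (?W (mi_abs \<alpha>) * ?W (mi_abs \<beta>))). y \<le> M"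
      unfolding bdd_above_def by blast
    from bspec[OF this rangeI, of "(\<alpha>, \<beta>, x)" for \<alpha> \<beta> x]
    have M: "norm (of_real (monomial \<alpha> x) * mi_deriv \<beta> f x) / (?W (mi_abs \<alpha>) * ?W (mi_abs \<beta>)) \<le> M"
      for \<alpha> \<beta> x by simp
    have pos: "0 < ?W s" for s by (rule weight_seq_pos)
    define C where "C = max M 1 * ?W 0"
    have C: "0 < C" using pos[of 0] by (simp add: C_def)
    have bound: "norm (of_real (monomial \<alpha> x) * mi_deriv \<beta> f x) \<le> max M 1 * (?W (mi_abs \<alpha>) * ?W (mi_abs \<beta>))"
      for \<alpha> \<beta> x
    proof -
      have "norm (of_real (monomial \<alpha> x) * mi_deriv \<beta> f x) \<le> M * (?W (mi_abs \<alpha>) * ?W (mi_abs \<beta>))"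
        using M[of \<alpha> x \<beta>] pos by (simp add: pos_divide_le_eq)
      also have "\<dots> \<le> max M 1 * (?W (mi_abs \<alpha>) * ?W (mi_abs \<beta>))"
        using pos by (intro mult_right_mono) (auto simp: less_imp_le)
      finally show ?thesis .
    qed
    have "norm (of_real (monomial \<alpha> x) * f x) \<le> C * ?W (mi_abs \<alpha>)" for \<alpha> x
      using bound[of \<alpha> x "\<lambda>_. 0"] by (simp add: mi_deriv_0 C_def mult_ac)
    moreover have "norm (mi_deriv \<beta> f x) \<le> C * ?W (mi_abs \<beta>)" for \<beta> x
      using bound[of "\<lambda>_. 0" x \<beta>] by (simp add: monomial_0 C_def mult_ac)
    ultimately show "\<exists>C>0. \<forall>j.
       (\<forall>\<alpha> x. mi_abs \<alpha> = k j \<longrightarrow> norm (of_real (monomial \<alpha> x) * f x) \<le> C * ?W (k j)) \<and>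
       (\<forall>\<beta> x. mi_abs \<beta> = l j \<longrightarrow> norm (mi_deriv \<beta> f x) \<le> C * ?W (l j))"
      using C by (intro exI[of _ C]) metis
  qed
qed

theorem theorem5p4:
  fixes p :: ennreal and k l :: "nat \<Rightarrow> nat" and \<omega> :: "real \<Rightarrow> real" and c :: growth_case
  assumes "1 \<le> p"
    and "special_base_seq k" and "special_base_seq l"
    and "weight_function \<omega>"
  shows "(B_class c p \<omega> (range k) :: (real^'n::finite \<Rightarrow> complex) set) = B_class c p \<omega> UNIV \<and>
    (D_class c \<omega> (range k) :: (real^'n \<Rightarrow> complex) set) = D_class c \<omega> UNIV \<and>
    (at_most_linear c \<omega> \<longrightarrow>
       (\<forall>U :: (real^'n) set. open U \<longrightarrow> E_class c p \<omega> (range k) U = E_class c p \<omega> UNIV U) \<and>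
       (S_class_sub c \<omega> k l :: (real^'n \<Rightarrow> complex) set) = S_class c \<omega>)"
proof (intro conjI impI allI)
  show "(B_class c p \<omega> (range k) :: (real^'n \<Rightarrow> complex) set) = B_class c p \<omega> UNIV"
    by (rule B_class_eq[OF assms(1,2,4)])
  show "(D_class c \<omega> (range k) :: (real^'n \<Rightarrow> complex) set) = D_class c \<omega> UNIV"
    by (rule D_class_eq[OF assms(2,4)])
  show "E_class c p \<omega> (range k) U = E_class c p \<omega> UNIV U" if "at_most_linear c \<omega>" "open U"
    for U :: "(real^'n) set"
    by (rule E_class_eq[OF assms(1,2,4) that])
  show "(S_class_sub c \<omega> k l :: (real^'n \<Rightarrow> complex) set) = S_class c \<omega>"
    by (intro equalityI S_class_sub_subset[OF assms(2-4)] S_class_subset)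
qed

end
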